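(* Let $n\ge 2$ and let $\mathbb{S}^n=\{y\in\mathbb{R}^{n+1}\mid y_1^2+\dots+y_{n+1}^2=1\}$ be the round unit sphere with the metric induced from Euclidean $\mathbb{R}^{n+1}$. Let $h:\mathbb{R}^{n-1}\to\mathbb{C}$ be a non-constant function harmonic with respect to the Euclidean metric on $\mathbb{R}^{n-1}$, let $r\ge1$ be an integer, and let $p_r:\mathbb{R}^+\to\mathbb{C}$ be given by $p_r(t)=(a_r+b_r t^{n-1})\cdot\log(t)^{r-1}$, where $(a_r,b_r)\in\mathbb{C}^2$ is non-zero. Let $p_r^*$ and $h^*$ be local complex analytic extensions of $p_r$ and $h$, respectively, and let $W$ be an open subset of $\mathbb{S}^n$ on which the following expression is defined. Then the function $f_r:W\to\mathbb{C}$, $$f_r(y_1,\dots,y_{n+1})=p_r^*\Bigl(\frac{2|y|}{y_2+i\,y_1}\Bigr)\cdot h^*\Bigl(\frac{2y_3}{y_2+i\,y_1},\dots,\frac{2y_{n+1}}{y_2+i\,y_1}\Bigr),$$ is proper $r$-harmonic on $W$.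
   Context: For a Riemannian manifold $(M,g)$ the Laplace–Beltrami operator (tension field) acts on complex-valued functions by $\tau(f)=\sum_{i,j}\frac{1}{\sqrt{|g|}}\frac{\partial}{\partial x_j}\bigl(g^{ij}\sqrt{|g|}\frac{\partial f}{\partial x_i}\bigr)$ in local coordinates. Iterates: $\tau^0(f)=f$, $\tau^r(f)=\tau(\tau^{r-1}(f))$. A function $f$ is $r$-harmonic if $\tau^r(f)=0$, and proper $r$-harmonic if moreover $\tau^{r-1}(f)$ does not vanish identically. Here $|y|$ denotes the Euclidean norm of $y\in\mathbb{R}^{n+1}$. *)

theory Defs
  imports "HOL-Analysis.Analysis"
begin

definition pd :: "'k::finite \<Rightarrow> (real^'k \<Rightarrow> 'b::real_normed_vector) \<Rightarrow> real^'k \<Rightarrow> 'b" where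
  "pd i F x = vector_derivative (\<lambda>t. F (x + t *\<^sub>R axis i 1)) (at 0)"

fun pdl :: "'k::finite list \<Rightarrow> (real^'k \<Rightarrow> 'b::real_normed_vector) \<Rightarrow> real^'k \<Rightarrow> 'b" where
  "pdl [] F = F"
| "pdl (i # is) F = pd i (pdl is F)"

definition Ck_on :: "nat \<Rightarrow> (real^'k::finite) set \<Rightarrow> (real^'k \<Rightarrow> 'b::real_normed_vector) \<Rightarrow> bool" where
  "Ck_on k U F \<longleftrightarrow>
     (\<forall>is. length is \<le> k \<longrightarrow> continuous_on U (pdl is F)) \<and>
     (\<forall>is i. length is < k \<longrightarrow>
        (\<forall>x\<in>U. ((\<lambda>t. pdl is F (x + t *\<^sub>R axis i 1)) has_vector_derivative pdl (i # is) F x) (at 0)))"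

definition smooth_on :: "(real^'k::finite) set \<Rightarrow> (real^'k \<Rightarrow> 'b::real_normed_vector) \<Rightarrow> bool" where
  "smooth_on U F \<longleftrightarrow> (\<forall>k. Ck_on k U F)"

definition metric_coeff :: "(real^'k::finite \<Rightarrow> 'a::real_inner) \<Rightarrow> real^'k \<Rightarrow> real^'k^'k" where
  "metric_coeff \<phi> x = (\<chi> i j. pd i \<phi> x \<bullet> pd j \<phi> x)"

definition tau_loc :: "(real^'k::finite \<Rightarrow> 'a::real_inner) \<Rightarrow> (real^'k \<Rightarrow> complex) \<Rightarrow> real^'k \<Rightarrow> complex" where
  "tau_loc \<phi> F x =
     (\<Sum>i\<in>UNIV. \<Sum>j\<in>UNIV.
        complex_of_real (1 / sqrt (det (metric_coeff \<phi> x))) *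
        pd j (\<lambda>x'. complex_of_real (matrix_inv (metric_coeff \<phi> x') $ i $ j * sqrt (det (metric_coeff \<phi> x')))
                   * pd i F x') x)"

definition is_chart :: "'a::real_inner set \<Rightarrow> (real^'k::finite) set \<Rightarrow> (real^'k \<Rightarrow> 'a) \<Rightarrow> bool" where
  "is_chart M U \<phi> \<longleftrightarrow>
     open U \<and> \<phi> ` U \<subseteq> M \<and> openin (top_of_set M) (\<phi> ` U) \<and>
     (\<exists>\<psi>. homeomorphism U (\<phi> ` U) \<phi> \<psi>) \<and>
     smooth_on U \<phi> \<and>
     (\<forall>x\<in>U. inj (\<lambda>c::real^'k. \<Sum>i\<in>UNIV. c $ i *\<^sub>R pd i \<phi> x))"

text \<open>The Laplace--Beltrami operator of the submanifold M (with the induced metric),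
  where M has dimension CARD('k): at y it is computed in (some) local chart around y.\<close>
definition LB_tau :: "'k::finite itself \<Rightarrow> 'a::real_inner set \<Rightarrow> ('a \<Rightarrow> complex) \<Rightarrow> 'a \<Rightarrow> complex" where
  "LB_tau (_::'k itself) M f y =
     (SOME v. \<exists>(\<phi>::real^'k \<Rightarrow> 'a) U x. is_chart M U \<phi> \<and> x \<in> U \<and> \<phi> x = y \<and> v = tau_loc \<phi> (f \<circ> \<phi>) x)"

definition proper_r_harmonic_on ::
    "'k::finite itself \<Rightarrow> 'a::real_inner set \<Rightarrow> nat \<Rightarrow> 'a set \<Rightarrow> ('a \<Rightarrow> complex) \<Rightarrow> bool" where
  "proper_r_harmonic_on K M r W f \<longleftrightarrow>
     (\<forall>y\<in>W. ((LB_tau K M) ^^ r) f y = 0) \<and> \<not> (\<forall>y\<in>W. ((LB_tau K M) ^^ (r - 1)) f y = 0)"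

definition eucl_harmonic :: "(real^'m::finite \<Rightarrow> complex) \<Rightarrow> bool" where
  "eucl_harmonic h \<longleftrightarrow> Ck_on 2 UNIV h \<and> (\<forall>x. tau_loc (id :: real^'m \<Rightarrow> real^'m) h x = 0)"

text \<open>Complex analytic (holomorphic) on an open set D of C^m: complex (Frechet)
  differentiable, i.e. real differentiable with complex-linear differential.\<close>
definition holo_several :: "(complex^'m::finite \<Rightarrow> complex) \<Rightarrow> (complex^'m) set \<Rightarrow> bool" where
  "holo_several H D \<longleftrightarrow> open D \<and>
     (\<forall>z\<in>D. \<exists>L. (H has_derivative L) (at z) \<and> (\<forall>v. L (\<chi> j. \<i> * v $ j) = \<i> * L v))"

definition realvec :: "real^'m::finite \<Rightarrow> complex^'m" where
  "realvec x = (\<chi> j. complex_of_real (x $ j))"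

text \<open>A point (y1, (y2, w)) stands for (y1, y2, y3, ..., y_{n+1}) with w = (y3,...,y_{n+1}).\<close>
definition sphereS :: "(real \<times> real \<times> (real^'m::finite)) set" where
  "sphereS = {y. (fst y)\<^sup>2 + (fst (snd y))\<^sup>2 + (\<Sum>j\<in>UNIV. (snd (snd y) $ j)\<^sup>2) = 1}"

definition den :: "real \<times> real \<times> (real^'m::finite) \<Rightarrow> complex" where
  "den y = Complex (fst (snd y)) (fst y)"

end

theory Submission
  imports Defs "HOL-Complex_Analysis.Conformal_Mappings"
begin

text \<open>
  On the unit sphere \<open>\<tau> f = \<Delta>F - D\<^sup>2F(y, y) - n DF(y)\<close> for any ambient extension \<open>F\<close> of \<open>f\<close>.
  Dropping \<open>|y| = 1\<close>, one extends by \<open>F(y) = P(u) H(u z)\<close> with \<open>u = 2 / (y\<^sub>2 + i y\<^sub>1)\<close>; as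
  \<open>y\<^sub>2 + i y\<^sub>1\<close> is isotropic and \<open>\<Delta>H = 0\<close>, this \<open>F\<close> is harmonic, and \<open>\<tau>\<close> acts as the ordinary
  differential operator \<open>T = (n - 2) u d/du - u\<^sup>2 d\<^sup>2/du\<^sup>2\<close> on \<open>P\<close> alone. In \<open>s = log u\<close> this
  is \<open>- d/ds (d/ds - (n - 1))\<close>, so \<open>T\<close> lowers the degree in \<open>s\<close> of \<open>s\<^sup>k\<close> and of \<open>e\<^sup>(\<^sup>n\<^sup>-\<^sup>1\<^sup>)\<^sup>s s\<^sup>k\<close> by
  exactly one; hence \<open>T\<^sup>r P = 0\<close> and \<open>T\<^sup>r\<^sup>-\<^sup>1 P = c + d u\<^sup>n\<^sup>-\<^sup>1 \<noteq> 0\<close>.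

  If \<open>\<tau>\<^sup>r\<^sup>-\<^sup>1 f\<close> vanished on \<open>W\<close>, then \<open>H\<close> would vanish on an open part of a rotated real slice
  \<open>e\<^sup>-\<^sup>i\<^sup>\<theta> \<real>\<^sup>n\<^sup>-\<^sup>1\<close>, hence identically, and \<open>h\<close> would vanish on an open set. Unique continuation
  for \<open>h\<close>, which is only assumed to be twice continuously differentiable, is proved through the moments
  \<open>N(r) = \<integral> h(x) (v \<bullet> x)\<^sup>d (r\<^sup>2 - |x|\<^sup>2)\<^sub>+\<^sup>k dx\<close>: Green's identity turns \<open>\<Delta>h = 0\<close> into an Euler
  equation \<open>r N' = C N\<close>, so moments vanishing for small \<open>r\<close> vanish for all \<open>r\<close>.
\<close>

subsection \<open>Directional derivatives\<close>

text \<open>\<open>LB_tau\<close> takes its value by \<open>SOME\<close> over all charts, so two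
  facts come before any computation: all charts yield the same value, and a chart exists. The
  ambient formula settles the first, since no chart occurs in it; a central projection settles the
  second.

  The shape of T is Euler's relation: u is homogeneous of degree -1 and u z of degree 0 in y, so
  DF(y) and D^2F(y, y) differentiate P alone and equal -u P' H and (2 u P' + u^2 P'') H. On the
  sphere the result is again a product with the same H, with T P in place of P, which is why the
  step can be iterated.

  Vanishing moments force h = 0 as follows. Summing over d turns (v \<bullet> x)^d / d! into exp (v
  \<bullet> x). Sums of such exponentials form an algebra that separates points, so by
  Stone-Weierstrass they approximate h uniformly on a box, and the integral of h^2 against a
  nonnegative weight is 0. Powers (v \<bullet> x)^d are convenient for Green's identity because
  their Laplacians are multiples of (v \<bullet> x)^(d - 2); exponentials are convenient because
  they are closed under multiplication.\<close>

lemma has_vector_derivative_line_shift: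
  fixes F :: "'a::real_normed_vector \<Rightarrow> 'b::real_normed_vector"
  assumes "((\<lambda>t. F (x + s *\<^sub>R v + t *\<^sub>R v)) has_vector_derivative d) (at 0)"
  shows "((\<lambda>t. F (x + t *\<^sub>R v)) has_vector_derivative d) (at s)"
proof -
  have "((\<lambda>t. t - s) has_vector_derivative 1) (at s)"
    by (auto intro!: derivative_eq_intros)
  from vector_diff_chain_at[OF this, of "\<lambda>t. F (x + s *\<^sub>R v + t *\<^sub>R v)" d] assms
  have "((\<lambda>t. F (x + s *\<^sub>R v + (t - s) *\<^sub>R v)) has_vector_derivative d) (at s)"
    by (simp add: o_def)
  then show ?thesis by (simp add: algebra_simps)
qed

text \<open>The mean value theorem is applied twice: along \<open>v\<close> to the difference of
  \<open>f\<close> over the step \<open>t *\<^sub>R w\<close>, then along \<open>w\<close> to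
  \<open>fi\<close>. The left-hand side is symmetric in \<open>v\<close> and \<open>w\<close>, which
  is what makes it useful for exchanging derivatives.\<close>

lemma second_difference_mean_value:
  fixes f :: "'a::real_normed_vector \<Rightarrow> real"
  assumes fi: "\<And>y. y \<in> ball x e \<Longrightarrow> ((\<lambda>t. f (y + t *\<^sub>R v)) has_vector_derivative fi y) (at 0)"
    and fij: "\<And>y. y \<in> ball x e \<Longrightarrow> ((\<lambda>t. fi (y + t *\<^sub>R w)) has_vector_derivative fij y) (at 0)"
    and nv: "norm v = 1" "norm w = 1" and t: "0 < t" "2 * t < e"
  shows "\<exists>p. dist x p < 2 * t \<and>
     f (x + t *\<^sub>R v + t *\<^sub>R w) - f (x + t *\<^sub>R v) - f (x + t *\<^sub>R w) + f x = t * t * fij p"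
proof -
  have near: "dist x (x + a *\<^sub>R v + b *\<^sub>R w) \<le> \<bar>a\<bar> + \<bar>b\<bar>" for a b
    using norm_triangle_ineq[of "a *\<^sub>R v" "b *\<^sub>R w"] nv by (simp add: dist_norm norm_minus_commute add.assoc add.commute)
  have inb: "x + a *\<^sub>R v + b *\<^sub>R w \<in> ball x e" if "0 \<le> a" "a \<le> t" "0 \<le> b" "b \<le> t" for a b
    using near[of a b] that t by simp
  define \<phi> where "\<phi> s = f (x + t *\<^sub>R w + s *\<^sub>R v) - f (x + s *\<^sub>R v)" for s
  have d\<phi>: "(\<phi> has_real_derivative fi (x + t *\<^sub>R w + s *\<^sub>R v) - fi (x + s *\<^sub>R v)) (at s)"
    if "0 \<le> s" "s \<le> t" for s
  proof -
    have "((\<lambda>s. f (x + t *\<^sub>R w + s *\<^sub>R v)) has_vector_derivative fi (x + t *\<^sub>R w + s *\<^sub>R v)) (at s)"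
      using inb[of s t] that t by (intro has_vector_derivative_line_shift[OF fi]) (simp only: add.commute add.left_commute)
    moreover have "((\<lambda>s. f (x + s *\<^sub>R v)) has_vector_derivative fi (x + s *\<^sub>R v)) (at s)"
      using inb[of s 0] that t by (intro has_vector_derivative_line_shift[OF fi]) simp
    ultimately show ?thesis unfolding \<phi>_def has_real_derivative_iff_has_vector_derivative
      by (rule has_vector_derivative_diff)
  qed
  obtain \<xi> where \<xi>: "0 < \<xi>" "\<xi> < t" "\<phi> t - \<phi> 0 = (t - 0) * (fi (x + t *\<^sub>R w + \<xi> *\<^sub>R v) - fi (x + \<xi> *\<^sub>R v))"
    using MVT2[OF t(1) d\<phi>] by auto
  have d\<psi>: "((\<lambda>r. fi (x + \<xi> *\<^sub>R v + r *\<^sub>R w)) has_real_derivative fij (x + \<xi> *\<^sub>R v + r *\<^sub>R w)) (at r)"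
    if "0 \<le> r" "r \<le> t" for r
    unfolding has_real_derivative_iff_has_vector_derivative
    using inb[of \<xi> r] that \<xi> by (intro has_vector_derivative_line_shift[OF fij]) simp
  obtain \<eta> where \<eta>: "0 < \<eta>" "\<eta> < t"
    "fi (x + \<xi> *\<^sub>R v + t *\<^sub>R w) - fi (x + \<xi> *\<^sub>R v + 0 *\<^sub>R w) = (t - 0) * fij (x + \<xi> *\<^sub>R v + \<eta> *\<^sub>R w)"
    using MVT2[OF t(1) d\<psi>] by auto
  have "\<phi> t - \<phi> 0 = t * t * fij (x + \<xi> *\<^sub>R v + \<eta> *\<^sub>R w)"
    using \<xi> \<eta> by (simp add: add.commute add.left_commute)
  moreover have "dist x (x + \<xi> *\<^sub>R v + \<eta> *\<^sub>R w) < 2 * t"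
    using near[of \<xi> \<eta>] \<xi> \<eta> by linarith
  ultimately show ?thesis by (intro exI[of _ "x + \<xi> *\<^sub>R v + \<eta> *\<^sub>R w"]) (simp add: \<phi>_def ac_simps)
qed

text \<open>Schwarz's theorem in a form that asks only for derivatives along the two lines, because
  \<open>Ck_on\<close> provides partial derivatives and not Frechet differentiability. Both orders
  give the same second difference, so the two mixed derivatives agree at points \<open>p\<close> and
  \<open>q\<close> arbitrarily close to \<open>x\<close>.\<close>

lemma mixed_directional_derivatives_commute:
  fixes f :: "'a::real_normed_vector \<Rightarrow> real"
  assumes U: "open U" "x \<in> U"
    and f: "\<And>y. y \<in> U \<Longrightarrow> ((\<lambda>t. f (y + t *\<^sub>R v)) has_vector_derivative fv y) (at 0)"
      "\<And>y. y \<in> U \<Longrightarrow> ((\<lambda>t. f (y + t *\<^sub>R w)) has_vector_derivative fw y) (at 0)"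
      "\<And>y. y \<in> U \<Longrightarrow> ((\<lambda>t. fv (y + t *\<^sub>R w)) has_vector_derivative fvw y) (at 0)"
      "\<And>y. y \<in> U \<Longrightarrow> ((\<lambda>t. fw (y + t *\<^sub>R v)) has_vector_derivative fwv y) (at 0)"
    and c: "continuous_on U fvw" "continuous_on U fwv"
    and nv: "norm v = 1" "norm w = 1"
  shows "fvw x = fwv x"
proof (rule ccontr)
  assume "fvw x \<noteq> fwv x"
  define \<epsilon> where "\<epsilon> = \<bar>fvw x - fwv x\<bar> / 2"
  have \<epsilon>: "\<epsilon> > 0" using \<open>fvw x \<noteq> fwv x\<close> by (simp add: \<epsilon>_def)
  have "isCont fvw x" "isCont fwv x" using c U by (simp_all add: continuous_on_eq_continuous_at)
  then obtain d1 d2 where d: "d1 > 0" "d2 > 0" "\<And>p. dist p x < d1 \<Longrightarrow> dist (fvw p) (fvw x) < \<epsilon>"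
    "\<And>p. dist p x < d2 \<Longrightarrow> dist (fwv p) (fwv x) < \<epsilon>"
    unfolding continuous_at_eps_delta using \<epsilon> by metis
  obtain e where e: "e > 0" "ball x e \<subseteq> U" using U open_contains_ball by blast
  \<comment> \<open>The intermediate points lie within \<open>2 * t\<close> of \<open>x\<close>, so
    a quarter of the smallest radius leaves room to spare.\<close>
  define t where "t = min e (min d1 d2) / 4"
  have t: "0 < t" "2 * t < e" "2 * t < d1" "2 * t < d2" using d e by (auto simp: t_def)
  obtain p where p: "dist x p < 2 * t"
     "f (x + t *\<^sub>R v + t *\<^sub>R w) - f (x + t *\<^sub>R v) - f (x + t *\<^sub>R w) + f x = t * t * fvw p"
    using second_difference_mean_value[of x e f v fv w fvw t] f e t nv by blast
  obtain q where q: "dist x q < 2 * t"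
     "f (x + t *\<^sub>R w + t *\<^sub>R v) - f (x + t *\<^sub>R w) - f (x + t *\<^sub>R v) + f x = t * t * fwv q"
    using second_difference_mean_value[of x e f w fw v fwv t] f e t nv by blast
  have comm: "x + t *\<^sub>R w + t *\<^sub>R v = x + t *\<^sub>R v + t *\<^sub>R w" by simp
  have "t * t * fvw p = t * t * fwv q" using p(2) q(2)[unfolded comm] by linarith
  then have "fvw p = fwv q" using t by simp
  moreover have "dist (fvw p) (fvw x) < \<epsilon>" "dist (fwv q) (fwv x) < \<epsilon>"
    using d p q t by (auto simp: dist_commute)
  moreover have "\<bar>fvw x - fwv x\<bar> = 2 * \<epsilon>" by (simp add: \<epsilon>_def)
  ultimately show False unfolding dist_real_def by arith
qed

lemma Ck_on_line_derivative:
  assumes "Ck_on k U F" "0 < k" "x \<in> U"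
  shows "((\<lambda>t. F (x + t *\<^sub>R axis i 1)) has_vector_derivative pd i F x) (at 0)"
  using assms(1)[unfolded Ck_on_def, THEN conjunct2, rule_format, of "[]"] assms(2,3) by simp

lemma Ck_on_line_derivative2:
  assumes "Ck_on k U F" "1 < k" "x \<in> U"
  shows "((\<lambda>t. pd i F (x + t *\<^sub>R axis j 1)) has_vector_derivative pd j (pd i F) x) (at 0)"
  using assms(1)[unfolded Ck_on_def, THEN conjunct2, rule_format, of "[i]"] assms(2,3) by simp

lemma Ck_on_continuous:
  assumes "Ck_on k U F"
  shows "continuous_on U F"
  using assms[unfolded Ck_on_def, THEN conjunct1, rule_format, of "[]"] by simp

lemma Ck_on_continuous1:
  assumes "Ck_on k U F" "1 \<le> k"
  shows "continuous_on U (pd i F)"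
  using assms(1)[unfolded Ck_on_def, THEN conjunct1, rule_format, of "[i]"] assms(2) by simp

lemma Ck_on_continuous2:
  assumes "Ck_on k U F" "2 \<le> k"
  shows "continuous_on U (pd j (pd i F))"
  using assms(1)[unfolded Ck_on_def, THEN conjunct1, rule_format, of "[j, i]"] assms(2) by simp

lemma pd_commute:
  fixes F :: "real^'k::finite \<Rightarrow> 'b::real_inner"
  assumes F: "Ck_on k U F" "2 \<le> k" and U: "open U" "x \<in> U"
  shows "pd i (pd j F) x = pd j (pd i F) x"
proof -
  \<comment> \<open>Pairing with an arbitrary \<open>b\<close> reduces to real-valued functions, for
    which the mean value theorem is available.\<close>
  have "pd i (pd j F) x \<bullet> b = pd j (pd i F) x \<bullet> b" for b
  proof (rule mixed_directional_derivatives_commute[OF U])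
    fix y assume y: "y \<in> U"
    note inn = bounded_linear.has_vector_derivative[OF bounded_linear_inner_left]
    show "((\<lambda>t. F (y + t *\<^sub>R axis i 1) \<bullet> b) has_vector_derivative pd i F y \<bullet> b) (at 0)"
         "((\<lambda>t. F (y + t *\<^sub>R axis j 1) \<bullet> b) has_vector_derivative pd j F y \<bullet> b) (at 0)"
         "((\<lambda>t. pd i F (y + t *\<^sub>R axis j 1) \<bullet> b) has_vector_derivative pd j (pd i F) y \<bullet> b) (at 0)"
         "((\<lambda>t. pd j F (y + t *\<^sub>R axis i 1) \<bullet> b) has_vector_derivative pd i (pd j F) y \<bullet> b) (at 0)"
      using F y by (auto intro!: inn Ck_on_line_derivative Ck_on_line_derivative2)
  qed (use F in \<open>auto intro!: continuous_intros Ck_on_continuous2\<close>)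
  then show ?thesis by (metis inner_commute vector_eq_ldot)
qed

subsection \<open>Jacobi's formula\<close>

text \<open>Purely qualitative: it also serves the numerators in Cramer's rule, whose matrices need
  not be invertible, so that Jacobi's formula in terms of an inverse would not apply to
  them.\<close>

lemma det_differentiable_entries:
  fixes A :: "real \<Rightarrow> real^'n::finite^'n"
  assumes "\<And>i j. ((\<lambda>t. A t $ i $ j) has_real_derivative A' i j) (at t0)"
  shows "(\<lambda>t. det (A t)) differentiable (at t0)"
proof -
  have e: "(\<lambda>t. A t $ i $ j) differentiable (at t0)" for i j
    using assms real_differentiable_def by blast
  have p: "(\<lambda>t. \<Prod>i\<in>S. A t $ i $ p i) differentiable (at t0)" if "finite S" for p :: "'n \<Rightarrow> 'n" and S
    using that by (induction S) (auto intro!: derivative_intros e)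
  show ?thesis unfolding det_def
    by (intro differentiable_sum ballI differentiable_mult differentiable_const p) auto
qed

text \<open>A permutation other than the identity moves at least two indices. Its Leibniz term
  therefore has at least two factors vanishing at \<open>t0\<close> and contributes nothing to first
  order; only the diagonal term remains and gives the trace.\<close>

lemma det_has_derivative_at_mat_1:
  fixes A :: "real \<Rightarrow> real^'n::finite^'n"
  assumes A: "\<And>i j. ((\<lambda>t. A t $ i $ j) has_real_derivative A' i j) (at t0)"
    and one: "A t0 = mat 1"
  shows "((\<lambda>t. det (A t)) has_real_derivative (\<Sum>i\<in>UNIV. A' i i)) (at t0)"
proof -
  have "((\<lambda>t. \<Prod>i\<in>UNIV. A t $ i $ p i) has_derivative
      (\<lambda>y. \<Sum>i\<in>UNIV. (A' i (p i) * y) * (\<Prod>j\<in>UNIV - {i}. A t0 $ j $ p j))) (at t0)" for p :: "'n \<Rightarrow> 'n"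
    by (rule has_derivative_prod) (use A in \<open>simp add: has_field_derivative_def\<close>)
  then have P: "((\<lambda>t. \<Prod>i\<in>UNIV. A t $ i $ p i) has_real_derivative
      (\<Sum>i\<in>UNIV. A' i (p i) * (\<Prod>j\<in>UNIV - {i}. A t0 $ j $ p j))) (at t0)" for p :: "'n \<Rightarrow> 'n"
    by (rule has_derivative_imp_has_field_derivative) (simp add: sum_distrib_left sum_distrib_right algebra_simps)
  have Q: "(\<Sum>i\<in>UNIV. A' i (p i) * (\<Prod>j\<in>UNIV - {i}. A t0 $ j $ p j)) = (if p = id then \<Sum>i\<in>UNIV. A' i i else 0)"
    if p: "p permutes UNIV" for p :: "'n \<Rightarrow> 'n"
  proof (cases "p = id")
    case True
    then show ?thesis by (simp add: one mat_def)
  next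
    case False
    have "(\<Prod>j\<in>UNIV - {i}. A t0 $ j $ p j) = 0" for i
    proof (rule ccontr)
      assume "(\<Prod>j\<in>UNIV - {i}. A t0 $ j $ p j) \<noteq> 0"
      then have *: "p j = j" if "j \<noteq> i" for j
        using that by (auto simp: one mat_def prod_zero_iff split: if_splits)
      then have "p i = i" using permutes_inj[OF p] by (metis inj_eq)
      with * have "p = id" by (auto simp: fun_eq_iff) metis
      with False show False by simp
    qed
    then show ?thesis using False by (simp only: mult_zero_right sum.neutral_const if_False)
  qed
  have "((\<lambda>t. det (A t)) has_real_derivative
     (\<Sum>p | p permutes (UNIV::'n set). of_int (sign p) * (\<Sum>i\<in>UNIV. A' i (p i) * (\<Prod>j\<in>UNIV - {i}. A t0 $ j $ p j)))) (at t0)"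
    unfolding det_def by (intro DERIV_sum DERIV_cmult P)
  also have "(\<Sum>p | p permutes (UNIV::'n set). of_int (sign p) * (\<Sum>i\<in>UNIV. A' i (p i) * (\<Prod>j\<in>UNIV - {i}. A t0 $ j $ p j)))
     = (\<Sum>p | p permutes (UNIV::'n set). if p = id then (\<Sum>i\<in>UNIV. A' i i) else 0)"
    by (intro sum.cong refl) (simp add: Q)
  also have "\<dots> = (\<Sum>i\<in>UNIV. A' i i)"
    by (subst sum.delta) (auto simp: permutes_id)
  finally show ?thesis .
qed

text \<open>Multiplying by the constant inverse reduces this to a derivative at the identity matrix.\<close>
lemma det_has_derivative:
  fixes A :: "real \<Rightarrow> real^'n::finite^'n"
  assumes A: "\<And>i j. ((\<lambda>t. A t $ i $ j) has_real_derivative A' i j) (at t0)"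
    and inv: "B ** A t0 = mat 1"
  shows "((\<lambda>t. det (A t)) has_real_derivative det (A t0) * (\<Sum>i\<in>UNIV. \<Sum>l\<in>UNIV. B $ i $ l * A' l i)) (at t0)"
proof -
  have BA: "((\<lambda>t. (B ** A t) $ i $ j) has_real_derivative (\<Sum>l\<in>UNIV. B $ i $ l * A' l j)) (at t0)" for i j
    unfolding matrix_matrix_mult_def by (simp, intro DERIV_sum DERIV_cmult A)
  have "((\<lambda>t. det (B ** A t)) has_real_derivative (\<Sum>i\<in>UNIV. \<Sum>l\<in>UNIV. B $ i $ l * A' l i)) (at t0)"
    by (rule det_has_derivative_at_mat_1[OF BA inv])
  then have "((\<lambda>t. det (A t0) * det (B ** A t)) has_real_derivative det (A t0) * (\<Sum>i\<in>UNIV. \<Sum>l\<in>UNIV. B $ i $ l * A' l i)) (at t0)"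
    by (rule DERIV_cmult)
  moreover have "det (A t0) * det (B ** A t) = det (A t)" for t
  proof -
    have "det (A t0) * det B = 1" using inv by (metis det_I det_mul mult.commute)
    then show ?thesis by (simp add: det_mul)
  qed
  ultimately show ?thesis by simp
qed

lemma
  fixes A :: "real^'n::finite^'n"
  assumes "invertible A"
  shows matrix_inv_right: "A ** matrix_inv A = mat 1"
    and matrix_inv_left: "matrix_inv A ** A = mat 1"
  using someI_ex[OF assms[unfolded invertible_def]] by (auto simp: matrix_inv_def)

text \<open>Shows that the entries of the inverse are quotients of determinants, from which their
  differentiability can be read off.\<close>

lemma matrix_inv_entry_cramer:
  fixes A :: "real^'n::finite^'n"
  assumes "det A \<noteq> 0"
  shows "matrix_inv A $ i $ j = det (\<chi> a b. if b = i then axis j 1 $ a else A $ a $ b) / det A"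
proof -
  have "invertible A" using assms by (simp add: invertible_det_nz)
  then have "A ** matrix_inv A = mat 1" by (simp add: matrix_inv_right)
  then have "A *v (matrix_inv A *v axis j 1) = axis j 1" by (simp add: matrix_vector_mul_assoc)
  then have "matrix_inv A *v axis j 1 = (\<chi> k. det (\<chi> a b. if b = k then axis j 1 $ a else A $ a $ b) / det A)"
    using cramer[OF assms] by blast
  moreover have "matrix_inv A *v axis j 1 = column j (matrix_inv A)"
    by (simp add: matrix_vector_mult_basis)
  ultimately show ?thesis by (simp add: column_def vec_eq_iff)
qed

text \<open>Cramer's rule yields only that a derivative exists. Its value then follows by
  differentiating the identity inverse times matrix = 1 and multiplying by \<open>B\<close> from the
  right.\<close>

lemma matrix_inv_entry_has_derivative:
  fixes A :: "real \<Rightarrow> real^'n::finite^'n"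
  assumes A: "\<And>i j. ((\<lambda>t. A t $ i $ j) has_real_derivative A' i j) (at t0)"
    and nz: "det (A t0) \<noteq> 0"
  defines "B \<equiv> matrix_inv (A t0)"
  shows "((\<lambda>t. matrix_inv (A t) $ i $ j) has_real_derivative
     - (\<Sum>k\<in>UNIV. \<Sum>l\<in>UNIV. B $ i $ k * A' k l * B $ l $ j)) (at t0)"
proof -
  have dd: "(\<lambda>t. det (A t)) differentiable (at t0)" by (rule det_differentiable_entries[OF A])
  then have "isCont (\<lambda>t. det (A t)) t0" by (simp add: differentiable_imp_continuous_within)
  then have ev: "\<forall>\<^sub>F t in nhds t0. det (A t) \<noteq> 0"
    using nz unfolding isCont_def tendsto_at_iff_tendsto_nhds[of "\<lambda>t. det (A t)" t0]
    by (rule tendsto_imp_eventually_ne)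
  have diff: "(\<lambda>t. matrix_inv (A t) $ i $ j) differentiable (at t0)" for i j
  proof -
    have e: "((\<lambda>t. (\<chi> a b. if b = i then axis j 1 $ a else A t $ a $ b) $ a $ b) has_real_derivative
       (if b = i then 0 else A' a b)) (at t0)" for a b
      using A by auto
    have "(\<lambda>t. det (\<chi> a b. if b = i then axis j 1 $ a else A t $ a $ b) / det (A t)) differentiable (at t0)"
      by (intro differentiable_divide det_differentiable_entries[OF e] dd nz)
    then obtain D where D: "((\<lambda>t. det (\<chi> a b. if b = i then axis j 1 $ a else A t $ a $ b) / det (A t)) has_real_derivative D) (at t0)"
      using real_differentiable_def by blast
    have "((\<lambda>t. matrix_inv (A t) $ i $ j) has_real_derivative D) (at t0)"
    proof -
      have "\<forall>\<^sub>F t in nhds t0. matrix_inv (A t) $ i $ j = det (\<chi> a b. if b = i then axis j 1 $ a else A t $ a $ b) / det (A t)"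
        using ev by (rule eventually_mono) (rule matrix_inv_entry_cramer)
      from DERIV_cong_ev[OF refl this refl] D show ?thesis by (rule iffD2)
    qed
    then show ?thesis using real_differentiable_def by blast
  qed
  define C where "C i j = deriv (\<lambda>t. matrix_inv (A t) $ i $ j) t0" for i j
  have C: "((\<lambda>t. matrix_inv (A t) $ i $ j) has_real_derivative C i j) (at t0)" for i j
    unfolding C_def using diff DERIV_deriv_iff_real_differentiable by blast
  have inv: "invertible (A t0)" using nz by (simp add: invertible_det_nz)
  \<comment> \<open>The product rule for \<open>matrix_inv (A t) ** A t\<close>, which is constantly
    \<open>mat 1\<close> near \<open>t0\<close>.\<close>
  have CA: "(\<Sum>l\<in>UNIV. C i l * A t0 $ l $ j) = - (\<Sum>l\<in>UNIV. B $ i $ l * A' l j)" for i j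
  proof -
    have dsum: "((\<lambda>t. \<Sum>l\<in>UNIV. matrix_inv (A t) $ i $ l * A t $ l $ j) has_real_derivative
       (\<Sum>l\<in>UNIV. C i l * A t0 $ l $ j + A' l j * matrix_inv (A t0) $ i $ l)) (at t0)"
      by (intro DERIV_sum DERIV_mult C A)
    have "\<forall>\<^sub>F t in nhds t0. (\<Sum>l\<in>UNIV. matrix_inv (A t) $ i $ l * A t $ l $ j) = (mat 1 :: real^'n^'n) $ i $ j"
      using ev
    proof (rule eventually_mono)
      fix t assume "det (A t) \<noteq> 0"
      then have "matrix_inv (A t) ** A t = mat 1" by (simp add: invertible_det_nz matrix_inv_left)
      then show "(\<Sum>l\<in>UNIV. matrix_inv (A t) $ i $ l * A t $ l $ j) = (mat 1 :: real^'n^'n) $ i $ j"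
        by (simp add: matrix_matrix_mult_def vec_eq_iff)
    qed
    from DERIV_cong_ev[OF refl this refl] dsum
    have "((\<lambda>t. (mat 1 :: real^'n^'n) $ i $ j) has_real_derivative
       (\<Sum>l\<in>UNIV. C i l * A t0 $ l $ j + A' l j * matrix_inv (A t0) $ i $ l)) (at t0)"
      by (rule iffD1)
    then have "(\<Sum>l\<in>UNIV. C i l * A t0 $ l $ j + A' l j * matrix_inv (A t0) $ i $ l) = 0"
      using DERIV_const DERIV_unique by blast
    then show ?thesis by (simp add: sum.distrib B_def mult.commute)
  qed
  have AB: "(\<Sum>l\<in>UNIV. A t0 $ k $ l * B $ l $ j) = (if k = j then 1 else 0)" for k j
    using matrix_inv_right[OF inv] by (simp add: B_def matrix_matrix_mult_def vec_eq_iff mat_def)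
  have "C i j = (\<Sum>k\<in>UNIV. C i k * (if k = j then 1 else 0))" by (simp add: if_distrib cong: if_cong)
  also have "\<dots> = (\<Sum>k\<in>UNIV. C i k * (\<Sum>l\<in>UNIV. A t0 $ k $ l * B $ l $ j))" by (simp only: AB)
  also have "\<dots> = (\<Sum>l\<in>UNIV. (\<Sum>k\<in>UNIV. C i k * A t0 $ k $ l) * B $ l $ j)"
    unfolding sum_distrib_left sum_distrib_right by (subst sum.swap) (simp add: mult.assoc)
  also have "\<dots> = - (\<Sum>l\<in>UNIV. \<Sum>k\<in>UNIV. B $ i $ k * A' k l * B $ l $ j)"
    by (simp add: CA sum_distrib_right sum_negf)
  also have "\<dots> = - (\<Sum>k\<in>UNIV. \<Sum>l\<in>UNIV. B $ i $ k * A' k l * B $ l $ j)"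
    by (subst sum.swap) simp
  finally show ?thesis using C[of i j] by (simp only:)
qed

text \<open>The real \<open>sqrt\<close> is odd, and writing its derivative as
  \<open>sqrt s / (2 * s)\<close> gives one formula for both signs of \<open>s\<close>.
  Invertibility of the metric is then all one has to know about its determinant.\<close>

lemma sqrt_has_derivative_nonzero:
  fixes f :: "real \<Rightarrow> real"
  assumes "(f has_real_derivative f') (at t0)" "f t0 \<noteq> 0"
  shows "((\<lambda>t. sqrt (f t)) has_real_derivative sqrt (f t0) * f' / (2 * f t0)) (at t0)"
proof -
  have "DERIV sqrt (f t0) :> sqrt (f t0) / (2 * f t0)"
  proof (rule DERIV_real_sqrt_generic[OF assms(2)])
    show "sqrt (f t0) / (2 * f t0) = inverse (sqrt (f t0)) / 2" if "f t0 > 0"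
      using that by (simp add: field_simps)
    show "sqrt (f t0) / (2 * f t0) = - inverse (sqrt (f t0)) / 2" if "f t0 < 0"
    proof -
      have "sqrt (f t0) * sqrt (f t0) = - f t0" using that by (metis abs_of_neg real_sqrt_mult_self)
      with that show ?thesis by (simp add: field_simps)
    qed
  qed
  from DERIV_chain2[OF this assms(1)] show ?thesis by simp
qed

section \<open>Gram matrices and projection onto the tangent space\<close>

lemma metric_coeff_invertible:
  assumes "inj (\<lambda>c::real^'k::finite. \<Sum>i\<in>UNIV. c $ i *\<^sub>R pd i \<phi> x)"
  shows "invertible (metric_coeff \<phi> x)"
proof -
  let ?L = "\<lambda>c::real^'k. \<Sum>i\<in>UNIV. c $ i *\<^sub>R pd i \<phi> x"
  have "c = 0" if "metric_coeff \<phi> x *v c = 0" for c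
  proof -
    \<comment> \<open>The metric is the Gram matrix of the coordinate vectors, so its quadratic form
      at \<open>c\<close> is the squared length of the tangent vector with coordinates
      \<open>c\<close>.\<close>
    have "?L c \<bullet> ?L c = c \<bullet> (metric_coeff \<phi> x *v c)"
      by (simp add: inner_sum_left inner_sum_right metric_coeff_def matrix_vector_mult_def inner_vec_def
          sum_distrib_left mult.assoc) (simp add: ac_simps inner_commute)
    also have "\<dots> = 0" by (simp add: that)
    finally have "?L c = ?L 0" by simp
    then show "c = 0" using assms by (blast dest: injD)
  qed
  then show ?thesis
    by (simp add: invertible_left_inverse matrix_left_invertible_ker)
qed

lemma matrix_inv_symmetric:
  fixes A :: "real^'k::finite^'k"
  assumes "invertible A" "transpose A = A"
  shows "transpose (matrix_inv A) = matrix_inv A"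
proof -
  have "A ** transpose (matrix_inv A) = transpose (matrix_inv A ** A)"
    by (simp add: matrix_transpose_mul assms(2))
  also have "\<dots> = mat 1" by (simp add: matrix_inv_left[OF assms(1)] transpose_mat)
  finally have "matrix_inv A ** A ** transpose (matrix_inv A) = matrix_inv A"
    by (simp flip: matrix_mul_assoc)
  then show ?thesis by (simp add: matrix_inv_left[OF assms(1)])
qed

text \<open>By dimension count the \<open>p i\<close> span the hyperplane orthogonal to
  \<open>y\<close>, and \<open>B\<close> inverts their Gram matrix, so the sum is the orthogonal
  projection of \<open>v\<close> onto that hyperplane. An error term \<open>w\<close> would be
  orthogonal to \<open>y\<close> and to every \<open>p i\<close>, which a one-dimensional complement
  forbids.\<close>

lemma hyperplane_projection:
  fixes p :: "'k::finite \<Rightarrow> 'a::euclidean_space"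
  assumes inj: "inj (\<lambda>c::real^'k. \<Sum>i\<in>UNIV. c $ i *\<^sub>R p i)"
    and dimA: "DIM('a) = CARD('k) + 1"
    and y: "norm y = 1" "\<And>i. y \<bullet> p i = 0"
    and B: "\<And>j l. (\<Sum>i\<in>UNIV. B i j * (p i \<bullet> p l)) = (if j = l then 1 else 0)"
  shows "(\<Sum>i\<in>UNIV. \<Sum>j\<in>UNIV. (B i j * (p j \<bullet> v)) *\<^sub>R p i) = v - (v \<bullet> y) *\<^sub>R y"
proof (rule ccontr)
  assume neq: "\<not> ?thesis"
  define w where "w = v - (v \<bullet> y) *\<^sub>R y - (\<Sum>i\<in>UNIV. \<Sum>j\<in>UNIV. (B i j * (p j \<bullet> v)) *\<^sub>R p i)"
  have w0: "w \<noteq> 0"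
  proof
    assume "w = 0"
    then have "v - (v \<bullet> y) *\<^sub>R y = (\<Sum>i\<in>UNIV. \<Sum>j\<in>UNIV. (B i j * (p j \<bullet> v)) *\<^sub>R p i)"
      unfolding w_def by (simp only: right_minus_eq)
    from neq this[symmetric] show False by (rule notE)
  qed
  have yy: "y \<bullet> y = 1" using y(1) by (simp add: dot_square_norm)
  have py: "p i \<bullet> y = 0" for i using y(2) by (metis inner_commute)
  have wy: "w \<bullet> y = 0" by (simp add: w_def inner_diff_left inner_sum_left yy py)
  have wp: "w \<bullet> p l = 0" for l
  proof -
    have "(\<Sum>i\<in>UNIV. \<Sum>j\<in>UNIV. (B i j * (p j \<bullet> v)) *\<^sub>R p i) \<bullet> p l
        = (\<Sum>j\<in>UNIV. (p j \<bullet> v) * (\<Sum>i\<in>UNIV. B i j * (p i \<bullet> p l)))"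
      by (subst sum.swap) (simp add: inner_sum_left sum_distrib_left mult.assoc mult.left_commute)
    also have "\<dots> = p l \<bullet> v" by (simp add: B if_distrib cong: if_cong)
    finally show ?thesis by (simp add: w_def inner_diff_left y(2) inner_commute[of "p l"])
  qed
  let ?L = "\<lambda>c::real^'k. \<Sum>i\<in>UNIV. c $ i *\<^sub>R p i"
  have lin: "linear ?L"
    by (intro linearI) (simp_all add: sum.distrib scaleR_sum_right algebra_simps)
  have sub: "subspace (range ?L)" using lin linear_subspace_image subspace_UNIV by blast
  have "dim (range ?L) = CARD('k)"
    using dim_image_eq[OF lin inj_on_subset[OF inj subset_UNIV], of UNIV] by simp
  moreover have "dim {z \<in> UNIV. \<forall>x\<in>range ?L. orthogonal x z} + dim (range ?L) = dim (UNIV::'a set)"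
    by (rule dim_subspace_orthogonal_to_vectors[OF sub subspace_UNIV]) simp
  \<comment> \<open>The span of the \<open>p i\<close> has codimension one, so there is no room for
    both \<open>y\<close> and \<open>w\<close> beside it.\<close>
  ultimately have d1: "dim {z. \<forall>x\<in>range ?L. orthogonal x z} = 1" using dimA by simp
  have mem: "{y, w} \<subseteq> {z. \<forall>x\<in>range ?L. orthogonal x z}"
    using py wp by (auto simp: orthogonal_def inner_sum_left inner_sum_right inner_commute[of "p i" for i])
  have "y \<noteq> w" using wy yy by auto
  have "pairwise orthogonal {y, w}" using wy by (auto simp: pairwise_def orthogonal_def inner_commute)
  then have "independent {y, w}"
    using w0 y(1) by (intro pairwise_orthogonal_independent) auto
  then have "card {y, w} \<le> dim {z. \<forall>x\<in>range ?L. orthogonal x z}"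
    using mem independent_card_le_dim by blast
  then show False using d1 \<open>y \<noteq> w\<close> by simp
qed

section \<open>The chain rule in a chart\<close>

lemma has_vector_derivative_transform_nhds:
  assumes "(g has_vector_derivative d) (at t)" "\<forall>\<^sub>F s in nhds t. f s = g s"
  shows "(f has_vector_derivative d) (at t)"
  unfolding has_vector_derivative_def
proof (rule has_derivative_transform_eventually[OF assms(1)[unfolded has_vector_derivative_def]])
  show "\<forall>\<^sub>F s in at t. g s = f s"
    using assms(2) by (auto simp: eventually_at_filter elim: eventually_mono)
  show "g t = f t" using eventually_nhds_x_imp_x[OF assms(2)] by simp
qed simp

lemma line_eventually_in:
  fixes x v :: "'a::real_normed_vector"
  assumes "open U" "x \<in> U"
  shows "\<forall>\<^sub>F t in nhds (0::real). x + t *\<^sub>R v \<in> U"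
proof -
  have "((\<lambda>t::real. x + t *\<^sub>R v) \<longlongrightarrow> x + 0 *\<^sub>R v) (nhds 0)"
    by (intro tendsto_intros filterlim_ident)
  then show ?thesis using assms topological_tendstoD by fastforce
qed

text \<open>\<open>f\<close> is controlled only on the submanifold, where it agrees with
  \<open>F\<close>; all differentiability comes from the ambient extension \<open>F\<close>. A short
  coordinate line through \<open>x\<close> stays in the region of agreement.\<close>

lemma pd_compose_chart:
  fixes \<phi> :: "real^'k::finite \<Rightarrow> 'a::real_normed_vector" and F :: "'a \<Rightarrow> 'b::real_normed_vector"
  assumes \<phi>: "Ck_on k U \<phi>" "0 < k" and U: "open U" "x \<in> U" and N: "open N" "\<phi> x \<in> N"
    and F: "(F has_derivative F') (at (\<phi> x))"
    and f: "\<And>x. x \<in> U \<Longrightarrow> \<phi> x \<in> N \<Longrightarrow> f (\<phi> x) = F (\<phi> x)"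
  shows "pd i (f \<circ> \<phi>) x = F' (pd i \<phi> x)"
proof -
  have "open (U \<inter> \<phi> -` N)"
    using continuous_open_preimage[OF Ck_on_continuous[OF \<phi>(1)] U(1) N(1)] .
  from line_eventually_in[OF this, of x "axis i 1"] U N
  have ev: "\<forall>\<^sub>F t in nhds (0::real). x + t *\<^sub>R axis i 1 \<in> U \<inter> \<phi> -` N" by simp
  have "(F has_derivative F') (at (\<phi> (x + 0 *\<^sub>R axis i 1)))" using F by simp
  from vector_derivative_diff_chain_within[of "\<lambda>t. \<phi> (x + t *\<^sub>R axis i 1)" "pd i \<phi> x" 0 UNIV F F']
  have "((\<lambda>t. F (\<phi> (x + t *\<^sub>R axis i 1))) has_vector_derivative F' (pd i \<phi> x)) (at 0)"
    using Ck_on_line_derivative[OF \<phi> U(2)] F by (simp add: o_def has_derivative_at_withinI)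
  then have "((\<lambda>t. (f \<circ> \<phi>) (x + t *\<^sub>R axis i 1)) has_vector_derivative F' (pd i \<phi> x)) (at 0)"
    by (rule has_vector_derivative_transform_nhds) (use ev f in \<open>auto elim: eventually_mono\<close>)
  then show ?thesis unfolding pd_def by (rule vector_derivative_at)
qed

text \<open>Expanding the tangent vector in a basis makes the product rule applicable, since
  \<open>F'\<close> is only known to be differentiable for a fixed direction.\<close>
lemma pd2_compose_chart:
  fixes \<phi> :: "real^'k::finite \<Rightarrow> 'a::euclidean_space" and F :: "'a \<Rightarrow> complex"
  assumes \<phi>: "Ck_on k U \<phi>" "1 < k" and U: "open U" "x \<in> U" and N: "open N" "\<phi> x \<in> N"
    and F: "\<And>z. z \<in> N \<Longrightarrow> (F has_derivative F' z) (at z)"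
    and F': "\<And>v. ((\<lambda>z. F' z v) has_derivative (\<lambda>w. F'' w v)) (at (\<phi> x))"
    and f: "\<And>x. x \<in> U \<Longrightarrow> \<phi> x \<in> N \<Longrightarrow> f (\<phi> x) = F (\<phi> x)"
  shows "((\<lambda>t. pd i (f \<circ> \<phi>) (x + t *\<^sub>R axis j 1)) has_vector_derivative
      F' (\<phi> x) (pd j (pd i \<phi>) x) + F'' (pd j \<phi> x) (pd i \<phi> x)) (at 0)"
proof -
  have opn: "open (U \<inter> \<phi> -` N)"
    using continuous_open_preimage[OF Ck_on_continuous[OF \<phi>(1)] U(1) N(1)] .
  from line_eventually_in[OF this, of x "axis j 1"] U N
  have ev: "\<forall>\<^sub>F t in nhds (0::real). x + t *\<^sub>R axis j 1 \<in> U \<inter> \<phi> -` N" by simp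
  have lin: "linear (F' z)" if "z \<in> N" for z using F[OF that] has_derivative_linear by blast
  have expand: "F' z v = (\<Sum>b\<in>Basis. (v \<bullet> b) *\<^sub>R F' z b)" if "z \<in> N" for z v
    using that by (subst euclidean_representation[of v, symmetric])
      (simp add: linear_sum[OF lin] linear_cmul[OF lin])
  \<comment> \<open>Linearity of \<open>F''\<close> in its second argument is not among the
    assumptions; it follows from the expansion of \<open>F'\<close> near \<open>\<phi> x\<close> and
    the uniqueness of derivatives.\<close>
  have expand2: "F'' w v = (\<Sum>b\<in>Basis. (v \<bullet> b) *\<^sub>R F'' w b)" for w v
  proof -
    have "((\<lambda>z. \<Sum>b\<in>Basis. (v \<bullet> b) *\<^sub>R F' z b) has_derivative (\<lambda>w. \<Sum>b\<in>Basis. (v \<bullet> b) *\<^sub>R F'' w b)) (at (\<phi> x))"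
      by (intro has_derivative_sum has_derivative_scaleR_right F')
    then have "((\<lambda>z. F' z v) has_derivative (\<lambda>w. \<Sum>b\<in>Basis. (v \<bullet> b) *\<^sub>R F'' w b)) (at (\<phi> x))"
      by (rule has_derivative_transform_within_open[OF _ N]) (simp add: expand)
    from has_derivative_unique[OF F'[of v] this] show ?thesis by (simp add: fun_eq_iff)
  qed
  have d: "((\<lambda>t. F' (\<phi> (x + t *\<^sub>R axis j 1)) b) has_vector_derivative F'' (pd j \<phi> x) b) (at 0)" for b
    using vector_derivative_diff_chain_within[of "\<lambda>t. \<phi> (x + t *\<^sub>R axis j 1)" "pd j \<phi> x" 0 UNIV "\<lambda>z. F' z b" "\<lambda>w. F'' w b"]
      Ck_on_line_derivative[OF \<phi>(1) _ U(2)] \<phi>(2) F'[of b] by (simp add: o_def has_derivative_at_withinI)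
  have di: "((\<lambda>t. pd i \<phi> (x + t *\<^sub>R axis j 1) \<bullet> b) has_real_derivative pd j (pd i \<phi>) x \<bullet> b) (at 0)" for b
    unfolding has_real_derivative_iff_has_vector_derivative
    by (intro bounded_linear.has_vector_derivative[OF bounded_linear_inner_left] Ck_on_line_derivative2[OF \<phi> U(2)])
  have "((\<lambda>t. \<Sum>b\<in>Basis. (pd i \<phi> (x + t *\<^sub>R axis j 1) \<bullet> b) *\<^sub>R F' (\<phi> (x + t *\<^sub>R axis j 1)) b)
      has_vector_derivative (\<Sum>b\<in>Basis. (pd i \<phi> (x + 0 *\<^sub>R axis j 1) \<bullet> b) *\<^sub>R F'' (pd j \<phi> x) b
         + (pd j (pd i \<phi>) x \<bullet> b) *\<^sub>R F' (\<phi> (x + 0 *\<^sub>R axis j 1)) b)) (at 0)"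
    by (intro has_vector_derivative_sum has_vector_derivative_scaleR d di)
  also have "(\<Sum>b\<in>Basis. (pd i \<phi> (x + 0 *\<^sub>R axis j 1) \<bullet> b) *\<^sub>R F'' (pd j \<phi> x) b
         + (pd j (pd i \<phi>) x \<bullet> b) *\<^sub>R F' (\<phi> (x + 0 *\<^sub>R axis j 1)) b)
      = F' (\<phi> x) (pd j (pd i \<phi>) x) + F'' (pd j \<phi> x) (pd i \<phi> x)"
    using expand[OF N(2), of "pd j (pd i \<phi>) x"] expand2[of "pd j \<phi> x" "pd i \<phi> x"]
    by (simp add: sum.distrib)
  finally show ?thesis
  proof (rule has_vector_derivative_transform_nhds)
    show "\<forall>\<^sub>F t in nhds 0. pd i (f \<circ> \<phi>) (x + t *\<^sub>R axis j 1) =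
       (\<Sum>b\<in>Basis. (pd i \<phi> (x + t *\<^sub>R axis j 1) \<bullet> b) *\<^sub>R F' (\<phi> (x + t *\<^sub>R axis j 1)) b)"
      using ev
    proof (rule eventually_mono)
      fix t assume t: "x + t *\<^sub>R axis j 1 \<in> U \<inter> \<phi> -` N"
      then have "pd i (f \<circ> \<phi>) (x + t *\<^sub>R axis j 1) = F' (\<phi> (x + t *\<^sub>R axis j 1)) (pd i \<phi> (x + t *\<^sub>R axis j 1))"
        using \<phi>(2) by (intro pd_compose_chart[OF \<phi>(1) _ U(1) _ N(1) _ F f]) auto
      then show "pd i (f \<circ> \<phi>) (x + t *\<^sub>R axis j 1) =
         (\<Sum>b\<in>Basis. (pd i \<phi> (x + t *\<^sub>R axis j 1) \<bullet> b) *\<^sub>R F' (\<phi> (x + t *\<^sub>R axis j 1)) b)"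
        using expand t by simp
    qed
  qed
qed

text \<open>The prefactor turns the derivative of \<open>sqrt (det (A t))\<close> into a logarithmic
  derivative, which by Jacobi's formula is half the trace of \<open>B\<close> times
  \<open>A'\<close>. What remains is the divergence-form summand of \<open>tau_loc\<close> split by
  order of differentiation.\<close>

lemma sqrt_det_metric_inverse_derivative:
  fixes A :: "real \<Rightarrow> real^'k::finite^'k" and f :: "real \<Rightarrow> complex"
  assumes A: "\<And>i j. ((\<lambda>t. A t $ i $ j) has_real_derivative A' i j) (at t0)"
    and inv: "invertible (A t0)"
    and f: "(f has_vector_derivative f') (at t0)"
  defines "B \<equiv> matrix_inv (A t0)"
  shows "complex_of_real (1 / sqrt (det (A t0))) *
      vector_derivative (\<lambda>t. complex_of_real (matrix_inv (A t) $ i $ j * sqrt (det (A t))) * f t) (at t0)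
    = (B $ i $ j) *\<^sub>R f' + (B $ i $ j * (\<Sum>k\<in>UNIV. \<Sum>l\<in>UNIV. B $ k $ l * A' l k) / 2
        - (\<Sum>k\<in>UNIV. \<Sum>l\<in>UNIV. B $ i $ k * A' k l * B $ l $ j)) *\<^sub>R f t0"
proof -
  let ?tr = "\<Sum>k\<in>UNIV. \<Sum>l\<in>UNIV. B $ k $ l * A' l k"
  let ?db = "- (\<Sum>k\<in>UNIV. \<Sum>l\<in>UNIV. B $ i $ k * A' k l * B $ l $ j)"
  have nz: "det (A t0) \<noteq> 0" using inv by (simp add: invertible_det_nz)
  have BA: "B ** A t0 = mat 1" unfolding B_def by (rule matrix_inv_left[OF inv])
  have ds: "((\<lambda>t. sqrt (det (A t))) has_real_derivative sqrt (det (A t0)) * (det (A t0) * ?tr) / (2 * det (A t0))) (at t0)"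
    by (rule sqrt_has_derivative_nonzero[OF det_has_derivative[OF A BA] nz])
  have db: "((\<lambda>t. matrix_inv (A t) $ i $ j) has_real_derivative ?db) (at t0)"
    unfolding B_def by (rule matrix_inv_entry_has_derivative[OF A nz])
  have "((\<lambda>t. (matrix_inv (A t) $ i $ j * sqrt (det (A t))) *\<^sub>R f t) has_vector_derivative
     (matrix_inv (A t0) $ i $ j * sqrt (det (A t0))) *\<^sub>R f' +
     (?db * sqrt (det (A t0)) + sqrt (det (A t0)) * (det (A t0) * ?tr) / (2 * det (A t0)) * matrix_inv (A t0) $ i $ j) *\<^sub>R f t0) (at t0)"
    by (intro has_vector_derivative_scaleR DERIV_mult db ds f)
  from vector_derivative_at[OF this]
  have vd: "vector_derivative (\<lambda>t. complex_of_real (matrix_inv (A t) $ i $ j * sqrt (det (A t))) * f t) (at t0)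
     = (B $ i $ j * sqrt (det (A t0))) *\<^sub>R f' +
     (?db * sqrt (det (A t0)) + sqrt (det (A t0)) * (det (A t0) * ?tr) / (2 * det (A t0)) * B $ i $ j) *\<^sub>R f t0"
    by (simp add: scaleR_conv_of_real B_def)
  have s: "sqrt (det (A t0)) \<noteq> 0" using nz by simp
  have "complex_of_real (1 / S) * ((b * S) *\<^sub>R f' + (d * S + S * (D * tr) / (2 * D) * b) *\<^sub>R f0)
      = b *\<^sub>R f' + (b * tr / 2 + d) *\<^sub>R f0" if "S \<noteq> 0" "D \<noteq> 0" for S b d D tr f0
    using that by (simp add: scaleR_conv_of_real field_simps)
  from this[OF s nz, of "B $ i $ j" ?db ?tr] show ?thesis unfolding vd by simp
qed

subsection \<open>The Laplace--Beltrami operator of the unit sphere\<close>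

text \<open>With \<open>p\<close> the coordinate vectors, \<open>q\<close> the second derivatives of
  the chart and \<open>B\<close> the inverse metric, \<open>g' j k l\<close> is the j-th derivative
  of the metric entry k, l. The left-hand side is the first-order coefficient of the Laplacian, the
  right-hand side the contraction of the Christoffel symbols with the inverse metric, up to
  sign.\<close>

lemma christoffel_contraction:
  fixes p :: "'k::finite \<Rightarrow> 'a::real_inner" and q :: "'k \<Rightarrow> 'k \<Rightarrow> 'a" and B :: "'k \<Rightarrow> 'k \<Rightarrow> real"
  assumes B: "\<And>i j. B i j = B j i" and q: "\<And>i j. q i j = q j i"
  defines "g' \<equiv> \<lambda>j k l. q k j \<bullet> p l + p k \<bullet> q l j"
  shows "(\<Sum>j\<in>UNIV. B i j * (\<Sum>k\<in>UNIV. \<Sum>l\<in>UNIV. B k l * g' j l k) / 2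
            - (\<Sum>k\<in>UNIV. \<Sum>l\<in>UNIV. B i k * g' j k l * B l j))
        = - (\<Sum>k\<in>UNIV. B i k * (p k \<bullet> (\<Sum>l\<in>UNIV. \<Sum>j\<in>UNIV. B l j *\<^sub>R q l j)))"
proof -
  have tr: "(\<Sum>k\<in>UNIV. \<Sum>l\<in>UNIV. B k l * g' j l k) = 2 * (\<Sum>k\<in>UNIV. \<Sum>l\<in>UNIV. B k l * (q k j \<bullet> p l))" for j
  proof -
    have "(\<Sum>k\<in>UNIV. \<Sum>l\<in>UNIV. B k l * (q l j \<bullet> p k)) = (\<Sum>k\<in>UNIV. \<Sum>l\<in>UNIV. B k l * (q k j \<bullet> p l))"
      by (subst sum.swap) (simp add: B)
    moreover have "(\<Sum>k\<in>UNIV. \<Sum>l\<in>UNIV. B k l * (p l \<bullet> q k j)) = (\<Sum>k\<in>UNIV. \<Sum>l\<in>UNIV. B k l * (q k j \<bullet> p l))"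
      by (simp add: inner_commute)
    ultimately show ?thesis
      by (simp add: g'_def distrib_left sum.distrib)
  qed
  \<comment> \<open>After exchanging \<open>j\<close> and \<open>k\<close>, using the symmetry of
    \<open>q\<close>, this part cancels the trace term exactly.\<close>
  have T: "(\<Sum>j\<in>UNIV. \<Sum>k\<in>UNIV. \<Sum>l\<in>UNIV. B i k * (q k j \<bullet> p l) * B l j)
      = (\<Sum>j\<in>UNIV. B i j * (\<Sum>k\<in>UNIV. \<Sum>l\<in>UNIV. B k l * (q k j \<bullet> p l)))" (is "?S = _")
  proof -
    have "?S = (\<Sum>k\<in>UNIV. \<Sum>j\<in>UNIV. \<Sum>l\<in>UNIV. B i k * (q k j \<bullet> p l) * B l j)"
      by (rule sum.swap)
    also have "\<dots> = (\<Sum>k\<in>UNIV. \<Sum>j\<in>UNIV. \<Sum>l\<in>UNIV. B i k * (B j l * (q j k \<bullet> p l)))"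
    proof (intro sum.cong refl)
      fix k j l show "B i k * (q k j \<bullet> p l) * B l j = B i k * (B j l * (q j k \<bullet> p l))"
        using B[of l j] q[of k j] by simp
    qed
    finally show ?thesis by (simp add: sum_distrib_left)
  qed
  have V: "(\<Sum>j\<in>UNIV. \<Sum>k\<in>UNIV. \<Sum>l\<in>UNIV. B i k * (p k \<bullet> q l j) * B l j)
      = (\<Sum>k\<in>UNIV. B i k * (p k \<bullet> (\<Sum>l\<in>UNIV. \<Sum>j\<in>UNIV. B l j *\<^sub>R q l j)))" (is "?S = _")
  proof -
    have "?S = (\<Sum>k\<in>UNIV. \<Sum>j\<in>UNIV. \<Sum>l\<in>UNIV. B i k * (p k \<bullet> q l j) * B l j)"
      by (rule sum.swap)
    also have "\<dots> = (\<Sum>k\<in>UNIV. \<Sum>l\<in>UNIV. \<Sum>j\<in>UNIV. B i k * (p k \<bullet> q l j) * B l j)"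
      by (rule sum.cong[OF refl], rule sum.swap)
    finally show ?thesis by (simp add: inner_sum_right sum_distrib_left mult.assoc mult.left_commute mult.commute)
  qed
  have "(\<Sum>j\<in>UNIV. B i j * (\<Sum>k\<in>UNIV. \<Sum>l\<in>UNIV. B k l * g' j l k) / 2
            - (\<Sum>k\<in>UNIV. \<Sum>l\<in>UNIV. B i k * g' j k l * B l j))
     = (\<Sum>j\<in>UNIV. B i j * (\<Sum>k\<in>UNIV. \<Sum>l\<in>UNIV. B k l * (q k j \<bullet> p l)))
       - (\<Sum>j\<in>UNIV. \<Sum>k\<in>UNIV. \<Sum>l\<in>UNIV. B i k * (q k j \<bullet> p l) * B l j)
       - (\<Sum>j\<in>UNIV. \<Sum>k\<in>UNIV. \<Sum>l\<in>UNIV. B i k * (p k \<bullet> q l j) * B l j)"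
    unfolding tr by (simp add: g'_def sum_subtractf sum.distrib distrib_left distrib_right)
  then show ?thesis unfolding T V by simp
qed

text \<open>The second-order terms contract to the trace of \<open>F''\<close> over the tangent
  space, that is, the full trace minus the normal entry. The second derivatives of the chart
  contribute \<open>F' y V\<close>, and the Christoffel terms remove the tangential part of
  \<open>V\<close>. The normal part survives, with coefficient minus the dimension.\<close>

lemma tau_loc_unit_sphere:
  fixes \<phi> :: "real^'k::finite \<Rightarrow> 'a::euclidean_space" and F :: "'a \<Rightarrow> complex"
  assumes \<phi>: "Ck_on k U \<phi>" "1 < k" and U: "open U" "x \<in> U" and N: "open N" "\<phi> x \<in> N"
    and inj: "inj (\<lambda>c::real^'k. \<Sum>i\<in>UNIV. c $ i *\<^sub>R pd i \<phi> x)"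
    and unit: "\<And>x. x \<in> U \<Longrightarrow> norm (\<phi> x) = 1"
    and dimA: "DIM('a) = CARD('k) + 1"
    and F: "\<And>z. z \<in> N \<Longrightarrow> (F has_derivative F' z) (at z)"
    and F': "\<And>v. ((\<lambda>z. F' z v) has_derivative (\<lambda>w. F'' w v)) (at (\<phi> x))"
    and f: "\<And>x. x \<in> U \<Longrightarrow> \<phi> x \<in> N \<Longrightarrow> f (\<phi> x) = F (\<phi> x)"
  shows "tau_loc \<phi> (f \<circ> \<phi>) x
     = (\<Sum>b\<in>Basis. F'' b b) - F'' (\<phi> x) (\<phi> x) - of_nat CARD('k) * F' (\<phi> x) (\<phi> x)"
proof -
  define p where "p i = pd i \<phi> x" for i
  define q where "q i j = pd j (pd i \<phi>) x" for i j
  define y where "y = \<phi> x"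
  define B where "B = matrix_inv (metric_coeff \<phi> x)"
  have inv: "invertible (metric_coeff \<phi> x)" by (rule metric_coeff_invertible[OF inj])
  have symA: "transpose (metric_coeff \<phi> x) = metric_coeff \<phi> x"
    by (simp add: metric_coeff_def transpose_def inner_commute)
  have Bsym: "B $ i $ j = B $ j $ i" for i j
    using arg_cong[OF matrix_inv_symmetric[OF inv symA], of "\<lambda>M. M $ j $ i"]
    by (simp add: B_def transpose_def)
  have qsym: "q i j = q j i" for i j
    unfolding q_def using \<phi> by (intro pd_commute[OF \<phi>(1) _ U]) auto
  have dp: "((\<lambda>t. pd i \<phi> (x + t *\<^sub>R axis j 1)) has_vector_derivative q i j) (at 0)" for i j
    unfolding q_def by (rule Ck_on_line_derivative2[OF \<phi> U(2)])
  have d\<phi>: "((\<lambda>t. \<phi> (x' + t *\<^sub>R axis j 1)) has_vector_derivative pd j \<phi> x') (at 0)" if "x' \<in> U" for j x'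
    using \<phi>(2) by (intro Ck_on_line_derivative[OF \<phi>(1) _ that]) simp
  have dinner: "((\<lambda>t. u t \<bullet> v t) has_real_derivative u 0 \<bullet> v' + u' \<bullet> v 0) (at 0)"
    if "(u has_vector_derivative u') (at 0)" "(v has_vector_derivative v') (at 0)" for u v :: "real \<Rightarrow> 'a" and u' v'
    using that bounded_bilinear.has_vector_derivative[OF bounded_bilinear_inner]
    unfolding has_real_derivative_iff_has_vector_derivative by blast
  have tangent: "\<phi> x' \<bullet> pd i \<phi> x' = 0" if x': "x' \<in> U" for x' i
  proof -
    have "((\<lambda>t. \<phi> (x' + t *\<^sub>R axis i 1) \<bullet> \<phi> (x' + t *\<^sub>R axis i 1)) has_real_derivative
        \<phi> (x' + 0 *\<^sub>R axis i 1) \<bullet> pd i \<phi> x' + pd i \<phi> x' \<bullet> \<phi> (x' + 0 *\<^sub>R axis i 1)) (at 0)"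
      by (intro dinner d\<phi> x')
    moreover have ev: "\<forall>\<^sub>F t in nhds (0::real). \<phi> (x' + t *\<^sub>R axis i 1) \<bullet> \<phi> (x' + t *\<^sub>R axis i 1) = 1"
      using line_eventually_in[OF U(1) x', of "axis i 1"] by (rule eventually_mono) (simp add: unit dot_square_norm)
    ultimately have "((\<lambda>t::real. 1::real) has_real_derivative
        \<phi> (x' + 0 *\<^sub>R axis i 1) \<bullet> pd i \<phi> x' + pd i \<phi> x' \<bullet> \<phi> (x' + 0 *\<^sub>R axis i 1)) (at 0)"
      using DERIV_cong_ev[OF refl ev refl] by simp
    then have "\<phi> (x' + 0 *\<^sub>R axis i 1) \<bullet> pd i \<phi> x' + pd i \<phi> x' \<bullet> \<phi> (x' + 0 *\<^sub>R axis i 1) = 0"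
      using DERIV_const DERIV_unique by blast
    then show ?thesis by (simp add: inner_commute)
  qed
  have yp: "y \<bullet> p i = 0" for i unfolding y_def p_def by (rule tangent[OF U(2)])
  \<comment> \<open>Differentiating the tangency relation once more gives the second fundamental
    form of the unit sphere: minus the metric.\<close>
  have ypq: "y \<bullet> q i j = - (p i \<bullet> p j)" for i j
  proof -
    have "((\<lambda>t. \<phi> (x + t *\<^sub>R axis j 1) \<bullet> pd i \<phi> (x + t *\<^sub>R axis j 1)) has_real_derivative
        \<phi> (x + 0 *\<^sub>R axis j 1) \<bullet> q i j + pd j \<phi> x \<bullet> pd i \<phi> (x + 0 *\<^sub>R axis j 1)) (at 0)"
      by (intro dinner d\<phi> U(2) dp)
    moreover have ev: "\<forall>\<^sub>F t in nhds (0::real). \<phi> (x + t *\<^sub>R axis j 1) \<bullet> pd i \<phi> (x + t *\<^sub>R axis j 1) = 0"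
      using line_eventually_in[OF U, of "axis j 1"] by (rule eventually_mono) (simp add: tangent)
    ultimately have "((\<lambda>t::real. 0::real) has_real_derivative
        \<phi> (x + 0 *\<^sub>R axis j 1) \<bullet> q i j + pd j \<phi> x \<bullet> pd i \<phi> (x + 0 *\<^sub>R axis j 1)) (at 0)"
      using DERIV_cong_ev[OF refl ev refl] by simp
    then have "\<phi> (x + 0 *\<^sub>R axis j 1) \<bullet> q i j + pd j \<phi> x \<bullet> pd i \<phi> (x + 0 *\<^sub>R axis j 1) = 0"
      using DERIV_const DERIV_unique by blast
    then show ?thesis by (simp add: p_def y_def inner_commute)
  qed
  have BA: "(\<Sum>i\<in>UNIV. B $ i $ j * (p i \<bullet> p l)) = (if j = l then 1 else 0)" for j l
  proof -
    have "(B ** metric_coeff \<phi> x) $ j $ l = (if j = l then 1 else 0)"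
      unfolding B_def matrix_inv_left[OF inv] by (simp add: mat_def)
    then show ?thesis by (simp add: matrix_matrix_mult_def metric_coeff_def p_def Bsym[of _ j])
  qed
  have proj: "(\<Sum>i\<in>UNIV. \<Sum>j\<in>UNIV. (B $ i $ j * (p j \<bullet> v)) *\<^sub>R p i) = v - (v \<bullet> y) *\<^sub>R y" for v
    by (rule hyperplane_projection[OF _ dimA _ yp BA]) (use inj unit[OF U(2)] in \<open>simp_all add: p_def y_def\<close>)
  define V where "V = (\<Sum>l\<in>UNIV. \<Sum>j\<in>UNIV. B $ l $ j *\<^sub>R q l j)"
  \<comment> \<open>Contracting minus the metric with its own inverse leaves minus the
    dimension.\<close>
  have Vy: "V \<bullet> y = - real CARD('k)"
  proof -
    have "V \<bullet> y = - (\<Sum>j\<in>UNIV. \<Sum>l\<in>UNIV. B $ l $ j * (p l \<bullet> p j))"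
      unfolding V_def by (subst sum.swap) (simp add: inner_sum_right inner_commute[of _ y] ypq sum_negf)
    then show ?thesis by (simp add: BA)
  qed
  have linF': "linear (F' y)" using F[OF N(2)] has_derivative_linear y_def by blast
  have linF''1: "linear (\<lambda>w. F'' w v)" for v using F'[of v] has_derivative_linear by blast
  \<comment> \<open>Linearity in the slot that is held fixed during differentiation is inherited
    from \<open>F' z\<close> for \<open>z\<close> near \<open>\<phi> x\<close>.\<close>
  have linF''2: "linear (F'' w)" for w
  proof -
    have c: "F'' w (a *\<^sub>R u + v) = a *\<^sub>R F'' w u + F'' w v" for a u v
    proof -
      have "((\<lambda>z. a *\<^sub>R F' z u + F' z v) has_derivative (\<lambda>w. a *\<^sub>R F'' w u + F'' w v)) (at (\<phi> x))"
        by (intro has_derivative_add has_derivative_scaleR_right F')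
      then have "((\<lambda>z. F' z (a *\<^sub>R u + v)) has_derivative (\<lambda>w. a *\<^sub>R F'' w u + F'' w v)) (at (\<phi> x))"
      proof (rule has_derivative_transform_within_open[OF _ N])
        fix z assume "z \<in> N"
        from has_derivative_linear[OF F[OF this]]
        show "a *\<^sub>R F' z u + F' z v = F' z (a *\<^sub>R u + v)" by (simp add: linear_add linear_cmul)
      qed
      from has_derivative_unique[OF F'[of "a *\<^sub>R u + v"] this] show ?thesis by (simp add: fun_eq_iff)
    qed
    have z: "F'' w 0 = 0" using c[of "-1" 0 0] by simp
    show ?thesis using c[of 1] c[of _ _ 0] z by (intro linearI) auto
  qed
  have summand: "complex_of_real (1 / sqrt (det (metric_coeff \<phi> x))) *
        pd j (\<lambda>x'. complex_of_real (matrix_inv (metric_coeff \<phi> x') $ i $ j * sqrt (det (metric_coeff \<phi> x')))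
                   * pd i (f \<circ> \<phi>) x') x
     = (B $ i $ j) *\<^sub>R (F' y (q i j) + F'' (p j) (p i)) +
       (B $ i $ j * (\<Sum>k\<in>UNIV. \<Sum>l\<in>UNIV. B $ k $ l * (q l j \<bullet> p k + p l \<bullet> q k j)) / 2
        - (\<Sum>k\<in>UNIV. \<Sum>l\<in>UNIV. B $ i $ k * (q k j \<bullet> p l + p k \<bullet> q l j) * B $ l $ j)) *\<^sub>R F' y (p i)" for i j
  proof -
    have A: "((\<lambda>t. metric_coeff \<phi> (x + t *\<^sub>R axis j 1) $ k $ l) has_real_derivative q k j \<bullet> p l + p k \<bullet> q l j) (at 0)" for k l
      unfolding metric_coeff_def using dinner[OF dp[of k j] dp[of l j]] by (simp add: p_def add.commute)
    have fx: "pd i (f \<circ> \<phi>) x = F' y (p i)"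
      using \<phi>(2) unfolding p_def y_def by (intro pd_compose_chart[OF \<phi>(1) _ U N F[OF N(2)] f]) auto
    have fd: "((\<lambda>t. pd i (f \<circ> \<phi>) (x + t *\<^sub>R axis j 1)) has_vector_derivative F' y (q i j) + F'' (p j) (p i)) (at 0)"
      unfolding y_def q_def p_def by (rule pd2_compose_chart[OF \<phi> U N F F' f])
    have inv0: "invertible (metric_coeff \<phi> (x + 0 *\<^sub>R axis j 1))" using inv by simp
    show ?thesis
      using sqrt_det_metric_inverse_derivative[OF A inv0 fd, of i j]
      unfolding pd_def[of j] by (simp add: B_def fx)
  qed
  have "tau_loc \<phi> (f \<circ> \<phi>) x = (\<Sum>i\<in>UNIV. \<Sum>j\<in>UNIV. (B $ i $ j) *\<^sub>R F' y (q i j))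
     + (\<Sum>i\<in>UNIV. \<Sum>j\<in>UNIV. (B $ i $ j) *\<^sub>R F'' (p j) (p i))
     + (\<Sum>i\<in>UNIV. (\<Sum>j\<in>UNIV. B $ i $ j * (\<Sum>k\<in>UNIV. \<Sum>l\<in>UNIV. B $ k $ l * (q l j \<bullet> p k + p l \<bullet> q k j)) / 2
        - (\<Sum>k\<in>UNIV. \<Sum>l\<in>UNIV. B $ i $ k * (q k j \<bullet> p l + p k \<bullet> q l j) * B $ l $ j)) *\<^sub>R F' y (p i))"
    unfolding tau_loc_def summand by (simp only: sum.distrib scaleR_add_right scaleR_sum_left)
  also have "(\<Sum>i\<in>UNIV. \<Sum>j\<in>UNIV. (B $ i $ j) *\<^sub>R F' y (q i j)) = F' y V"
    unfolding V_def by (simp add: linear_sum[OF linF'] linear_cmul[OF linF'])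
  also have "(\<Sum>i\<in>UNIV. (\<Sum>j\<in>UNIV. B $ i $ j * (\<Sum>k\<in>UNIV. \<Sum>l\<in>UNIV. B $ k $ l * (q l j \<bullet> p k + p l \<bullet> q k j)) / 2
        - (\<Sum>k\<in>UNIV. \<Sum>l\<in>UNIV. B $ i $ k * (q k j \<bullet> p l + p k \<bullet> q l j) * B $ l $ j)) *\<^sub>R F' y (p i))
      = - F' y (V - (V \<bullet> y) *\<^sub>R y)"
  proof -
    have "(\<Sum>i\<in>UNIV. (\<Sum>j\<in>UNIV. B $ i $ j * (\<Sum>k\<in>UNIV. \<Sum>l\<in>UNIV. B $ k $ l * (q l j \<bullet> p k + p l \<bullet> q k j)) / 2
        - (\<Sum>k\<in>UNIV. \<Sum>l\<in>UNIV. B $ i $ k * (q k j \<bullet> p l + p k \<bullet> q l j) * B $ l $ j)) *\<^sub>R F' y (p i))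
       = (\<Sum>i\<in>UNIV. (- (\<Sum>k\<in>UNIV. B $ i $ k * (p k \<bullet> V))) *\<^sub>R F' y (p i))"
      unfolding V_def
      by (intro sum.cong refl arg_cong2[of _ _ _ _ scaleR] christoffel_contraction Bsym qsym)
    also have "\<dots> = - F' y (\<Sum>i\<in>UNIV. \<Sum>j\<in>UNIV. (B $ i $ j * (p j \<bullet> V)) *\<^sub>R p i)"
      by (simp add: linear_sum[OF linF'] linear_cmul[OF linF'] sum_negf scaleR_sum_left)
    finally show ?thesis unfolding proj .
  qed
  \<comment> \<open>Expanding \<open>p j\<close> in the standard basis makes the contraction with
    \<open>B\<close> the projection of each basis vector, so subtracting normal components leaves
    the full trace minus the entry at \<open>y\<close>.\<close>
  also have "(\<Sum>i\<in>UNIV. \<Sum>j\<in>UNIV. (B $ i $ j) *\<^sub>R F'' (p j) (p i)) = (\<Sum>b\<in>Basis. F'' b b) - F'' y y"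
  proof -
    have "(\<Sum>i\<in>UNIV. \<Sum>j\<in>UNIV. (B $ i $ j) *\<^sub>R F'' (p j) (p i))
        = (\<Sum>i\<in>UNIV. \<Sum>j\<in>UNIV. \<Sum>b\<in>Basis. (B $ i $ j * (p j \<bullet> b)) *\<^sub>R F'' b (p i))"
    proof (intro sum.cong refl)
      fix i j
      have "F'' (p j) (p i) = (\<Sum>b\<in>Basis. (p j \<bullet> b) *\<^sub>R F'' b (p i))"
        by (subst euclidean_representation[of "p j", symmetric])
          (simp add: linear_sum[OF linF''1] linear_cmul[OF linF''1])
      then show "(B $ i $ j) *\<^sub>R F'' (p j) (p i) = (\<Sum>b\<in>Basis. (B $ i $ j * (p j \<bullet> b)) *\<^sub>R F'' b (p i))"
        by (simp add: scaleR_sum_right)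
    qed
    also have "\<dots> = (\<Sum>i\<in>UNIV. \<Sum>b\<in>Basis. \<Sum>j\<in>UNIV. (B $ i $ j * (p j \<bullet> b)) *\<^sub>R F'' b (p i))"
      by (rule sum.cong[OF refl], rule sum.swap)
    also have "\<dots> = (\<Sum>b\<in>Basis. \<Sum>i\<in>UNIV. \<Sum>j\<in>UNIV. (B $ i $ j * (p j \<bullet> b)) *\<^sub>R F'' b (p i))"
      by (rule sum.swap)
    also have "\<dots> = (\<Sum>b\<in>Basis. F'' b (\<Sum>i\<in>UNIV. \<Sum>j\<in>UNIV. (B $ i $ j * (p j \<bullet> b)) *\<^sub>R p i))"
      by (simp add: linear_sum[OF linF''2] linear_cmul[OF linF''2])
    also have "\<dots> = (\<Sum>b\<in>Basis. F'' b b - (b \<bullet> y) *\<^sub>R F'' b y)"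
      unfolding proj by (simp add: linear_diff[OF linF''2] linear_cmul[OF linF''2])
    also have "\<dots> = (\<Sum>b\<in>Basis. F'' b b) - F'' (\<Sum>b\<in>Basis. (y \<bullet> b) *\<^sub>R b) y"
      by (simp add: sum_subtractf linear_sum[OF linF''1] linear_cmul[OF linF''1] inner_commute)
    finally show ?thesis unfolding euclidean_representation .
  qed
  finally have tau: "tau_loc \<phi> (f \<circ> \<phi>) x
      = F' y V + ((\<Sum>b\<in>Basis. F'' b b) - F'' y y) + - F' y (V - (V \<bullet> y) *\<^sub>R y)" .
  have "u + (a - b) + - (u - (- r) *\<^sub>R w) = a - b - of_real r * w" for u a b w :: complex and r
    by (simp add: scaleR_conv_of_real)
  then show ?thesis
    unfolding tau Vy linear_diff[OF linF'] linear_cmul[OF linF'] by (simp add: y_def)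
qed

text \<open>Contains the components of the central projection from the tangent space onto a
  hemisphere and is closed under partial differentiation.\<close>
inductive hemisphere_fun :: "(real^'k::finite \<Rightarrow> 'a::real_normed_vector) \<Rightarrow> bool" where
  base: "hemisphere_fun (\<lambda>x. (1 / sqrt (1 + x \<bullet> x)) *\<^sub>R v)"
| coord: "hemisphere_fun f \<Longrightarrow> hemisphere_fun (\<lambda>x. (x $ i) *\<^sub>R f x)"
| recip: "hemisphere_fun f \<Longrightarrow> hemisphere_fun (\<lambda>x. (1 / (1 + x \<bullet> x)) *\<^sub>R f x)"
| scale: "hemisphere_fun f \<Longrightarrow> hemisphere_fun (\<lambda>x. c *\<^sub>R f x)"
| add: "hemisphere_fun f \<Longrightarrow> hemisphere_fun g \<Longrightarrow> hemisphere_fun (\<lambda>x. f x + g x)"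

lemma one_plus_inner_pos: "0 < 1 + x \<bullet> x" for x :: "'a::real_inner"
  using inner_ge_zero[of x] by linarith

lemma hemisphere_fun_continuous:
  fixes f :: "real^'k::finite \<Rightarrow> 'a::real_normed_vector"
  shows "hemisphere_fun f \<Longrightarrow> continuous_on UNIV f"
proof (induction rule: hemisphere_fun.induct)
  case (base v)
  have "1 + x \<bullet> x \<noteq> 0" for x :: "real^'k" using one_plus_inner_pos[of x] by simp
  then show ?case by (intro continuous_intros) auto
next
  case (recip f)
  have "1 + x \<bullet> x \<noteq> 0" for x :: "real^'k" using one_plus_inner_pos[of x] by simp
  with recip show ?case by (intro continuous_intros) auto
qed (auto intro!: continuous_intros)

lemma one_plus_inner_line_derivative:
  fixes x :: "real^'k::finite"
  shows "((\<lambda>t. 1 + (x + t *\<^sub>R axis i 1) \<bullet> (x + t *\<^sub>R axis i 1)) has_real_derivative 2 * x $ i) (at 0)"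
proof -
  have "(\<lambda>t. 1 + (x + t *\<^sub>R axis i 1) \<bullet> (x + t *\<^sub>R axis i 1)) = (\<lambda>t. 1 + x \<bullet> x + 2 * t * x $ i + t\<^sup>2)"
    by (auto simp: inner_add_left inner_add_right inner_axis inner_axis' power2_eq_square algebra_simps)
  then show ?thesis by (auto intro!: derivative_eq_intros)
qed

text \<open>The derivative is written as a product of the factors that generate
  \<open>hemisphere_fun\<close>, so that membership can be seen from its form.\<close>

lemma inverse_sqrt_line_derivative:
  fixes x :: "real^'k::finite"
  shows "((\<lambda>t. 1 / sqrt (1 + (x + t *\<^sub>R axis i 1) \<bullet> (x + t *\<^sub>R axis i 1))) has_real_derivative
     - (x $ i * (1 / (1 + x \<bullet> x) * (1 / sqrt (1 + x \<bullet> x))))) (at 0)"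
proof -
  let ?q = "\<lambda>t. 1 + (x + t *\<^sub>R axis i 1) \<bullet> (x + t *\<^sub>R axis i 1)"
  have pos: "0 < 1 + x \<bullet> x" by (rule one_plus_inner_pos)
  have "((\<lambda>t. sqrt (?q t)) has_real_derivative sqrt (?q 0) * (2 * x $ i) / (2 * ?q 0)) (at 0)"
    by (rule sqrt_has_derivative_nonzero[OF one_plus_inner_line_derivative]) (use pos in simp)
  then have "((\<lambda>t. sqrt (?q t)) has_real_derivative x $ i * sqrt (1 + x \<bullet> x) / (1 + x \<bullet> x)) (at 0)"
    by (rule DERIV_cong) (use pos in \<open>simp add: divide_simps\<close>)
  from DERIV_inverse'[OF this] pos
  have "((\<lambda>t. inverse (sqrt (?q t))) has_real_derivative
     - (inverse (sqrt (1 + x \<bullet> x)) * (x $ i * sqrt (1 + x \<bullet> x) / (1 + x \<bullet> x)) * inverse (sqrt (1 + x \<bullet> x)))) (at 0)"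
    by simp
  moreover have "- (inverse S * (a * S / q) * inverse S) = - (a * (1 / q * (1 / S)))"
    if "S \<noteq> 0" for S a q :: real
    using that by (simp add: divide_simps)
  from this[of "sqrt (1 + x \<bullet> x)" "x $ i" "1 + x \<bullet> x"] pos
  have "- (inverse (sqrt (1 + x \<bullet> x)) * (x $ i * sqrt (1 + x \<bullet> x) / (1 + x \<bullet> x)) * inverse (sqrt (1 + x \<bullet> x)))
     = - (x $ i * (1 / (1 + x \<bullet> x) * (1 / sqrt (1 + x \<bullet> x))))" by simp
  ultimately show ?thesis unfolding inverse_eq_divide[symmetric] by (simp only:)
qed

text \<open>One function \<open>g\<close> must serve all points \<open>x\<close>, so that the
  partial derivative as a function is again in the class and the argument can be repeated for every
  order.\<close>

lemma hemisphere_fun_line_derivative: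
  fixes f :: "real^'k::finite \<Rightarrow> 'a::real_normed_vector"
  assumes "hemisphere_fun f"
  shows "\<exists>g. hemisphere_fun g \<and> (\<forall>x. ((\<lambda>t. f (x + t *\<^sub>R axis i 1)) has_vector_derivative g x) (at 0))"
  using assms
proof (induction rule: hemisphere_fun.induct)
  case (base v)
  let ?g = "\<lambda>x. (-1) *\<^sub>R ((x $ i) *\<^sub>R ((1 / (1 + x \<bullet> x)) *\<^sub>R ((1 / sqrt (1 + x \<bullet> x)) *\<^sub>R v)))"
  have "((\<lambda>t. (1 / sqrt (1 + (x + t *\<^sub>R axis i 1) \<bullet> (x + t *\<^sub>R axis i 1))) *\<^sub>R v) has_vector_derivative ?g x) (at 0)" for x
    using has_vector_derivative_scaleR[OF inverse_sqrt_line_derivative[of x i] has_vector_derivative_const[of v]]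
    by simp
  moreover have "hemisphere_fun ?g" by (intro hemisphere_fun.intros)
  ultimately show ?case by blast
next
  case (coord f j)
  then obtain g where g: "hemisphere_fun g" "\<And>x. ((\<lambda>t. f (x + t *\<^sub>R axis i 1)) has_vector_derivative g x) (at 0)"
    by blast
  let ?g = "\<lambda>x. (x $ j) *\<^sub>R g x + (if j = i then 1 else 0) *\<^sub>R f x"
  have "((\<lambda>t. (x + t *\<^sub>R axis i 1) $ j) has_real_derivative (if j = i then 1 else 0)) (at 0)" for x :: "real^'k"
    by (auto intro!: derivative_eq_intros simp: axis_def)
  from has_vector_derivative_scaleR[OF this g(2)]
  have "((\<lambda>t. ((x + t *\<^sub>R axis i 1) $ j) *\<^sub>R f (x + t *\<^sub>R axis i 1)) has_vector_derivative ?g x) (at 0)" for x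
    by simp
  moreover have "hemisphere_fun ?g" using coord g by (intro hemisphere_fun.intros)
  ultimately show ?case by blast
next
  case (recip f)
  then obtain g where g: "hemisphere_fun g" "\<And>x. ((\<lambda>t. f (x + t *\<^sub>R axis i 1)) has_vector_derivative g x) (at 0)"
    by blast
  let ?g = "\<lambda>x. (1 / (1 + x \<bullet> x)) *\<^sub>R g x + (-2) *\<^sub>R ((x $ i) *\<^sub>R ((1 / (1 + x \<bullet> x)) *\<^sub>R ((1 / (1 + x \<bullet> x)) *\<^sub>R f x)))"
  have "((\<lambda>t. 1 / (1 + (x + t *\<^sub>R axis i 1) \<bullet> (x + t *\<^sub>R axis i 1))) has_real_derivative
      - 2 * x $ i * (1 / (1 + x \<bullet> x)) * (1 / (1 + x \<bullet> x))) (at 0)" for x :: "real^'k"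
    using DERIV_inverse'[OF one_plus_inner_line_derivative[of x i]] one_plus_inner_pos[of x]
    by (simp add: divide_inverse ac_simps)
  from has_vector_derivative_scaleR[OF this g(2)]
  have "((\<lambda>t. (1 / (1 + (x + t *\<^sub>R axis i 1) \<bullet> (x + t *\<^sub>R axis i 1))) *\<^sub>R f (x + t *\<^sub>R axis i 1)) has_vector_derivative ?g x) (at 0)" for x
    by simp
  moreover have "hemisphere_fun ?g" using recip g by (intro hemisphere_fun.intros)
  ultimately show ?case by blast
next
  case (scale f c)
  then obtain g where g: "hemisphere_fun g" "\<And>x. ((\<lambda>t. f (x + t *\<^sub>R axis i 1)) has_vector_derivative g x) (at 0)"
    by blast
  have "hemisphere_fun (\<lambda>x. c *\<^sub>R g x)" using g by (intro hemisphere_fun.intros)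
  moreover have "((\<lambda>t. c *\<^sub>R f (x + t *\<^sub>R axis i 1)) has_vector_derivative c *\<^sub>R g x) (at 0)" for x
    using bounded_linear.has_vector_derivative[OF bounded_linear_scaleR_right g(2)] .
  ultimately show ?case by (intro exI[of _ "\<lambda>x. c *\<^sub>R g x"]) blast
next
  case (add f g)
  then obtain f' g' where "hemisphere_fun f'" "\<And>x. ((\<lambda>t. f (x + t *\<^sub>R axis i 1)) has_vector_derivative f' x) (at 0)"
    "hemisphere_fun g'" "\<And>x. ((\<lambda>t. g (x + t *\<^sub>R axis i 1)) has_vector_derivative g' x) (at 0)"
    by blast
  then show ?case
    by (intro exI[of _ "\<lambda>x. f' x + g' x"]) (auto intro!: hemisphere_fun.add has_vector_derivative_add)
qed

lemma hemisphere_fun_pd: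
  assumes "hemisphere_fun f"
  shows "hemisphere_fun (pd i f)"
    and "((\<lambda>t. f (x + t *\<^sub>R axis i 1)) has_vector_derivative pd i f x) (at 0)"
proof -
  obtain g where g: "hemisphere_fun g" "\<And>x. ((\<lambda>t. f (x + t *\<^sub>R axis i 1)) has_vector_derivative g x) (at 0)"
    using hemisphere_fun_line_derivative[OF assms] by blast
  have "pd i f = g" unfolding pd_def using vector_derivative_at[OF g(2)] by (simp add: fun_eq_iff)
  with g show "hemisphere_fun (pd i f)"
    "((\<lambda>t. f (x + t *\<^sub>R axis i 1)) has_vector_derivative pd i f x) (at 0)" by simp_all
qed

lemma hemisphere_fun_smooth:
  assumes "hemisphere_fun f"
  shows "smooth_on UNIV f"
proof -
  have "hemisphere_fun (pdl is f)" for "is"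
    by (induction "is") (auto intro: hemisphere_fun_pd assms)
  then show ?thesis
    unfolding smooth_on_def Ck_on_def
    by (auto intro: hemisphere_fun_pd hemisphere_fun_continuous)
qed

text \<open>Ensures that the choice in \<open>LB_tau\<close> has a witness. The chart is central
  projection of the tangent hyperplane at \<open>y\<close> onto the open hemisphere around
  \<open>y\<close>: normalize \<open>y + L x\<close>, with \<open>L\<close> an isometry onto the
  orthogonal complement of \<open>y\<close>. Its inverse divides by the height
  \<open>y \<bullet> z\<close>.\<close>

lemma unit_sphere_chart_exists:
  fixes y :: "'a::euclidean_space"
  assumes dimA: "DIM('a) = CARD('k::finite) + 1" and y: "norm y = 1"
  shows "\<exists>(\<phi>::real^'k \<Rightarrow> 'a) U x. is_chart (sphere 0 1) U \<phi> \<and> x \<in> U \<and> \<phi> x = y"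
proof -
  have y0: "y \<noteq> 0" and yy: "y \<bullet> y = 1" using y by (auto simp: dot_square_norm)
  let ?T = "{z. y \<bullet> z = 0}"
  have subT: "subspace ?T" by (simp add: subspace_hyperplane)
  have dimT: "dim (UNIV :: (real^'k) set) = dim ?T" using dimA y0 by (simp add: dim_hyperplane)
  obtain L :: "real^'k \<Rightarrow> 'a" and G where LG: "linear L" "linear G" "L ` UNIV = ?T" "G ` ?T = UNIV"
    "\<And>x. x \<in> UNIV \<Longrightarrow> norm (L x) = norm x" "\<And>z. z \<in> ?T \<Longrightarrow> norm (G z) = norm z"
    "\<And>x. x \<in> UNIV \<Longrightarrow> G (L x) = x" "\<And>z. z \<in> ?T \<Longrightarrow> L (G z) = z"
    by (rule isometries_subspaces[OF subspace_UNIV subT dimT], rule that)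
  note L = LG(1-3) LG(5)[OF UNIV_I] LG(7)[OF UNIV_I] LG(8)
  have yL: "y \<bullet> L x = 0" for x using L(3) by blast
  have LL: "L x \<bullet> L x = x \<bullet> x" for x using L(4)[of x] by (simp add: dot_square_norm)
  define s where "s x = 1 / sqrt (1 + x \<bullet> x)" for x :: "real^'k"
  have s: "s x > 0" "s x * s x = 1 / (1 + x \<bullet> x)" for x
    using one_plus_inner_pos[of x] by (auto simp: s_def real_sqrt_mult_self)
  define \<phi> where "\<phi> x = s x *\<^sub>R (y + L x)" for x
  define \<psi> where "\<psi> z = G ((1 / (y \<bullet> z)) *\<^sub>R z - y)" for z
  have y\<phi>: "y \<bullet> \<phi> x = s x" for x by (simp add: \<phi>_def inner_add_right yL yy)
  have n\<phi>: "norm (\<phi> x) = 1" for x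
  proof -
    have "\<phi> x \<bullet> \<phi> x = s x * s x * (1 + x \<bullet> x)"
      by (simp add: \<phi>_def inner_add_left inner_add_right yL yy LL inner_commute[of "L x" y] distrib_left)
    also have "\<dots> = 1" using s one_plus_inner_pos[of x] by simp
    finally show ?thesis by (simp add: norm_eq_1)
  qed
  have \<psi>\<phi>: "\<psi> (\<phi> x) = x" for x
    using s(1)[of x] by (simp add: \<psi>_def y\<phi>) (simp add: \<phi>_def L)
  have \<phi>\<psi>: "\<phi> (\<psi> z) = z" if z: "norm z = 1" "y \<bullet> z > 0" for z
  proof -
    have "(1 / (y \<bullet> z)) *\<^sub>R z - y \<in> ?T" using z yy by (simp add: inner_diff_right)
    then have L\<psi>: "L (\<psi> z) = (1 / (y \<bullet> z)) *\<^sub>R z - y" unfolding \<psi>_def by (rule L(6))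
    have zz: "z \<bullet> z = 1" using z by (simp add: dot_square_norm)
    have "1 + \<psi> z \<bullet> \<psi> z = (y + L (\<psi> z)) \<bullet> (y + L (\<psi> z))"
      by (simp add: inner_add_left inner_add_right yL yy LL inner_commute[of "L x" y for x])
    also have "\<dots> = (1 / (y \<bullet> z))\<^sup>2" by (simp add: L\<psi> zz power2_eq_square)
    finally have "s (\<psi> z) = y \<bullet> z" using z(2) by (simp add: s_def real_sqrt_divide)
    then show ?thesis using z(2) by (simp add: \<phi>_def L\<psi>)
  qed
  have img: "range \<phi> = sphere 0 1 \<inter> {z. y \<bullet> z > 0}"
  proof
    show "range \<phi> \<subseteq> sphere 0 1 \<inter> {z. y \<bullet> z > 0}" using n\<phi> y\<phi> s(1) by auto
    show "sphere 0 1 \<inter> {z. y \<bullet> z > 0} \<subseteq> range \<phi>"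
      using \<phi>\<psi> by (metis (mono_tags, lifting) IntE mem_Collect_eq mem_sphere_0 rangeI subsetI)
  qed
  have hsum: "hemisphere_fun (\<lambda>x. \<Sum>i\<in>A. (x $ i) *\<^sub>R s x *\<^sub>R L (axis i 1))" if "finite A" for A :: "'k set"
    using that
  proof (induction A)
    case empty
    show ?case using hemisphere_fun.base[of "0::'a"] by simp
  next
    case (insert i A)
    have "hemisphere_fun (\<lambda>x. (x $ i) *\<^sub>R s x *\<^sub>R L (axis i 1))"
      unfolding s_def by (intro hemisphere_fun.coord hemisphere_fun.base)
    from hemisphere_fun.add[OF this insert.IH] show ?case
      by (simp only: sum.insert[OF insert.hyps])
  qed
  have \<phi>_eq: "\<phi> = (\<lambda>x. s x *\<^sub>R y + (\<Sum>i\<in>UNIV. (x $ i) *\<^sub>R s x *\<^sub>R L (axis i 1)))"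
  proof
    fix x
    have "L x = L (\<Sum>i\<in>UNIV. (x $ i) *\<^sub>R axis i 1)"
      using basis_expansion[of x] by (simp add: scalar_mult_eq_scaleR)
    also have "\<dots> = (\<Sum>i\<in>UNIV. (x $ i) *\<^sub>R L (axis i 1))"
      by (simp add: linear_sum[OF L(1)] linear_cmul[OF L(1)])
    finally show "\<phi> x = s x *\<^sub>R y + (\<Sum>i\<in>UNIV. (x $ i) *\<^sub>R s x *\<^sub>R L (axis i 1))"
      by (simp add: \<phi>_def scaleR_add_right scaleR_sum_right mult.commute)
  qed
  have hemi: "hemisphere_fun \<phi>"
    unfolding \<phi>_eq by (intro hemisphere_fun.add hsum) (auto simp: s_def intro: hemisphere_fun.base)
  have pd\<phi>: "pd i \<phi> x = s x *\<^sub>R L (axis i 1) - (x $ i * (1 / (1 + x \<bullet> x) * s x)) *\<^sub>R (y + L x)" for i x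
  proof -
    have "((\<lambda>t. y + L x + t *\<^sub>R L (axis i 1)) has_vector_derivative L (axis i 1)) (at 0)"
      by (auto intro!: derivative_eq_intros)
    then have "((\<lambda>t. y + L (x + t *\<^sub>R axis i 1)) has_vector_derivative L (axis i 1)) (at 0)"
      by (simp add: linear_add[OF L(1)] linear_cmul[OF L(1)] add.assoc)
    from has_vector_derivative_scaleR[OF inverse_sqrt_line_derivative[of x i] this]
    have "((\<lambda>t. \<phi> (x + t *\<^sub>R axis i 1)) has_vector_derivative
       s x *\<^sub>R L (axis i 1) - (x $ i * (1 / (1 + x \<bullet> x) * s x)) *\<^sub>R (y + L x)) (at 0)"
      by (simp add: \<phi>_def s_def)
    then show ?thesis unfolding pd_def by (rule vector_derivative_at)
  qed
  have inj: "inj (\<lambda>c::real^'k. \<Sum>i\<in>UNIV. c $ i *\<^sub>R pd i \<phi> x)" for x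
  proof -
    let ?D = "\<lambda>c::real^'k. \<Sum>i\<in>UNIV. c $ i *\<^sub>R pd i \<phi> x"
    have lin: "linear ?D"
      by (intro linearI) (simp_all add: sum.distrib scaleR_sum_right algebra_simps)
    have D: "?D c = s x *\<^sub>R L c - ((x \<bullet> c) * (1 / (1 + x \<bullet> x) * s x)) *\<^sub>R (y + L x)" for c
    proof -
      have "L c = L (\<Sum>i\<in>UNIV. (c $ i) *\<^sub>R axis i 1)"
        using basis_expansion[of c] by (simp add: scalar_mult_eq_scaleR)
      also have "\<dots> = (\<Sum>i\<in>UNIV. (c $ i) *\<^sub>R L (axis i 1))"
        by (simp add: linear_sum[OF L(1)] linear_cmul[OF L(1)])
      finally have Lc: "L c = (\<Sum>i\<in>UNIV. (c $ i) *\<^sub>R L (axis i 1))" .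
      have "?D c = (\<Sum>i\<in>UNIV. s x *\<^sub>R ((c $ i) *\<^sub>R L (axis i 1)))
          - (\<Sum>i\<in>UNIV. (x $ i * c $ i * (1 / (1 + x \<bullet> x) * s x)) *\<^sub>R (y + L x))"
        unfolding pd\<phi> sum_subtractf[symmetric]
        by (intro sum.cong refl) (simp only: scaleR_diff_right scaleR_scaleR mult.commute mult.left_commute mult.assoc)
      then show ?thesis
        by (simp only: Lc scaleR_sum_right[symmetric] scaleR_sum_left[symmetric] sum_distrib_right[symmetric]) (simp add: inner_vec_def)
    qed
    \<comment> \<open>Pairing with \<open>y\<close> kills the \<open>L\<close> parts and shows that
      the coefficient of \<open>y + L x\<close> vanishes; then \<open>L c\<close> is 0, and
      \<open>L\<close> is isometric.\<close>
    have "c = 0" if "?D c = 0" for c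
    proof -
      have "y \<bullet> ?D c = - ((x \<bullet> c) * (1 / (1 + x \<bullet> x) * s x))"
        unfolding D by (simp add: inner_diff_right inner_add_right yL yy)
      then have "(x \<bullet> c) * (1 / (1 + x \<bullet> x) * s x) = 0" using that by simp
      then have "s x *\<^sub>R L c = 0" using that unfolding D by simp
      then have "L c = 0" using s(1)[of x] by simp
      then show "c = 0" using L(4)[of c] by simp
    qed
    then show ?thesis using linear_injective_0[OF lin] by blast
  qed
  have "is_chart (sphere 0 1) UNIV \<phi>"
    unfolding is_chart_def
  proof (intro conjI exI ballI)
    show "range \<phi> \<subseteq> sphere 0 1" using img by blast
    show "openin (top_of_set (sphere 0 1)) (range \<phi>)"
      unfolding img by (intro openin_open_Int open_halfspace_gt)
    show "homeomorphism UNIV (range \<phi>) \<phi> \<psi>"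
      unfolding homeomorphism_def
    proof (intro conjI ballI)
      have "continuous_on (range \<phi>) (\<lambda>z. (1 / (y \<bullet> z)) *\<^sub>R z - y)"
        by (intro continuous_intros) (auto simp: img)
      then show "continuous_on (range \<phi>) \<psi>"
        unfolding \<psi>_def using linear_continuous_on_compose[OF _ L(2)] by fastforce
      show "\<psi> ` range \<phi> = UNIV" using \<psi>\<phi> by (auto simp: image_image)
      show "\<phi> (\<psi> z) = z" if "z \<in> range \<phi>" for z using that \<psi>\<phi> by auto
    qed (use \<psi>\<phi> hemisphere_fun_continuous[OF hemi] in auto)
    show "smooth_on UNIV \<phi>" by (rule hemisphere_fun_smooth[OF hemi])
  qed (use inj in auto)
  moreover have "\<phi> 0 = y" by (simp add: \<phi>_def s_def linear_0[OF L(1)])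
  ultimately show ?thesis by blast
qed

text \<open>The Hessian is traced over the tangent space; the last term is the mean curvature.\<close>
lemma LB_tau_unit_sphere:
  fixes F :: "'a::euclidean_space \<Rightarrow> complex" and K :: "'k::finite itself"
  assumes dimA: "DIM('a) = CARD('k) + 1" and y: "norm y = 1"
    and N: "open N" "y \<in> N"
    and F: "\<And>z. z \<in> N \<Longrightarrow> (F has_derivative F' z) (at z)"
    and F': "\<And>v. ((\<lambda>z. F' z v) has_derivative (\<lambda>w. F'' w v)) (at y)"
    and f: "\<And>z. norm z = 1 \<Longrightarrow> z \<in> N \<Longrightarrow> f z = F z"
  shows "LB_tau K (sphere 0 1) f y
     = (\<Sum>b\<in>Basis. F'' b b) - F'' y y - of_nat CARD('k) * F' y y"
proof -
  let ?v = "(\<Sum>b\<in>Basis. F'' b b) - F'' y y - of_nat CARD('k) * F' y y"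
  \<comment> \<open>Every admissible chart produces \<open>?v\<close>, so the value selected by
    \<open>SOME\<close> is forced.\<close>
  have chart: "tau_loc \<phi> (f \<circ> \<phi>) x = ?v"
    if c: "is_chart (sphere 0 1) U \<phi>" "x \<in> U" "\<phi> x = y" for \<phi> :: "real^'k \<Rightarrow> 'a" and U x
  proof -
    have sph: "norm (\<phi> x) = 1" if "x \<in> U" for x
      using that c(1) unfolding is_chart_def by (metis image_subset_iff mem_sphere_0)
    have "tau_loc \<phi> (f \<circ> \<phi>) x = (\<Sum>b\<in>Basis. F'' b b) - F'' (\<phi> x) (\<phi> x) - of_nat CARD('k) * F' (\<phi> x) (\<phi> x)"
      by (rule tau_loc_unit_sphere[where k = 2 and U = U and N = N and F = F])
        (use c N F F' f sph dimA in \<open>auto simp: is_chart_def smooth_on_def\<close>)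
    then show ?thesis using c(3) by simp
  qed
  have "(\<exists>(\<phi>::real^'k \<Rightarrow> 'a) U x. is_chart (sphere 0 1) U \<phi> \<and> x \<in> U \<and> \<phi> x = y \<and> v = tau_loc \<phi> (f \<circ> \<phi>) x)
      \<longleftrightarrow> v = ?v" for v
  proof
    assume "v = ?v"
    moreover obtain \<phi> :: "real^'k \<Rightarrow> 'a" and U x
      where c: "is_chart (sphere 0 1) U \<phi>" "x \<in> U" "\<phi> x = y"
      using unit_sphere_chart_exists[OF dimA y] by blast
    ultimately show "\<exists>(\<phi>::real^'k \<Rightarrow> 'a) U x. is_chart (sphere 0 1) U \<phi> \<and> x \<in> U \<and> \<phi> x = y \<and> v = tau_loc \<phi> (f \<circ> \<phi>) x"
      using chart[OF c] by (intro exI[of _ \<phi>] exI[of _ U] exI[of _ x]) (simp add: c)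
  qed (use chart in auto)
  then show ?thesis unfolding LB_tau_def by simp
qed

subsection \<open>Unique continuation for harmonic functions\<close>

text \<open>The supports are balls, but the substitution and parameter rules for integrals used
  below are stated for \<open>cbox\<close>.\<close>

abbreviation centered_box :: "real \<Rightarrow> (real^'m::finite) set" where
  "centered_box S \<equiv> cbox (\<chi> i. - S) (\<chi> i. S)"

lemma norm_le_imp_centered_box: "norm x \<le> S \<Longrightarrow> x \<in> centered_box S"
  using component_le_norm_cart[of x] by (auto simp: mem_box_cart abs_le_iff minus_le_iff) (smt (verit))+

text \<open>The integral of a translate of \<open>g\<close> does not depend on the translation, and
  its derivative at 0 is the integral of \<open>g'\<close>. The margin \<open>R + 1 \<le> S\<close>
  keeps the support inside the box for all shifts shorter than 1, so no boundary terms
  arise.\<close>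

lemma integral_line_derivative_zero:
  fixes g :: "real^'m::finite \<Rightarrow> real"
  assumes d: "\<And>x. ((\<lambda>t. g (x + t *\<^sub>R axis i 1)) has_real_derivative g' x) (at 0)"
    and c: "continuous_on UNIV g" "continuous_on UNIV g'"
    and supp: "\<And>x. R \<le> norm x \<Longrightarrow> g x = 0" and S: "R + 1 \<le> S"
  shows "integral (centered_box S) g' = 0"
proof -
  let ?b = "centered_box S :: (real^'m) set"
  let ?e = "axis i 1 :: real^'m"
  define J where "J t = integral ?b (\<lambda>x. g (x + t *\<^sub>R ?e))" for t
  have cs: "continuous_on A (\<lambda>x. g (x + t *\<^sub>R ?e))" for A t
    by (rule continuous_on_compose2[OF c(1)]) (auto intro!: continuous_intros)
  have outside: "g (x + t *\<^sub>R ?e) = 0" if "x \<notin> ?b" "\<bar>t\<bar> < 1" for x t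
  proof (rule supp)
    have "norm x > S" using that(1) norm_le_imp_centered_box[of x S] by linarith
    moreover have "norm (x + t *\<^sub>R ?e) \<ge> norm x - \<bar>t\<bar>"
      using norm_triangle_ineq4[of "x + t *\<^sub>R ?e" "t *\<^sub>R ?e"] by simp
    ultimately show "R \<le> norm (x + t *\<^sub>R ?e)" using S that by linarith
  qed
  have J: "J t = J 0" if t: "\<bar>t\<bar> < 1" for t
  proof -
    have g0: "(g has_integral J 0) ?b"
      unfolding J_def using cs[of ?b 0] by (simp add: integrable_continuous integrable_integral)
    from has_integral_affinity[OF this, of 1 "t *\<^sub>R ?e"]
    have "((\<lambda>x. g (x + t *\<^sub>R ?e)) has_integral J 0) ((\<lambda>x. x - t *\<^sub>R ?e) ` ?b)" by simp
    then have "((\<lambda>x. g (x + t *\<^sub>R ?e)) has_integral J 0) UNIV"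
    proof (rule has_integral_on_superset)
      fix x assume "x \<notin> (\<lambda>x. x - t *\<^sub>R ?e) ` ?b"
      then have "x + t *\<^sub>R ?e \<notin> ?b" by (metis add_diff_cancel_right' image_eqI)
      then show "g (x + t *\<^sub>R ?e) = 0" using outside[of "x + t *\<^sub>R ?e" 0] by simp
    qed simp
    moreover have "((\<lambda>x. g (x + t *\<^sub>R ?e)) has_integral J t) UNIV"
    proof (rule has_integral_on_superset)
      show "((\<lambda>x. g (x + t *\<^sub>R ?e)) has_integral J t) ?b"
        unfolding J_def using cs[of ?b t] by (simp add: integrable_continuous integrable_integral)
    qed (use outside t in auto)
    ultimately show ?thesis using has_integral_unique by blast
  qed
  have "(J has_vector_derivative integral ?b (\<lambda>x. g' (x + 0 *\<^sub>R ?e))) (at 0 within {-1<..<1})"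
    unfolding J_def
  proof (rule leibniz_rule_vector_derivative)
    fix t :: real and x
    have "((\<lambda>s. g (x + s *\<^sub>R ?e)) has_vector_derivative g' (x + t *\<^sub>R ?e)) (at t)"
      by (rule has_vector_derivative_line_shift) (use d in \<open>simp add: has_real_derivative_iff_has_vector_derivative\<close>)
    then show "((\<lambda>t. g (x + t *\<^sub>R ?e)) has_vector_derivative g' (x + t *\<^sub>R ?e)) (at t within {-1<..<1})"
      by (rule has_vector_derivative_at_within)
    show "(\<lambda>x. g (x + t *\<^sub>R ?e)) integrable_on ?b" by (rule integrable_continuous[OF cs])
  next
    have "continuous_on ({-1<..<1} \<times> ?b) (\<lambda>z. g' (snd z + fst z *\<^sub>R ?e))"
      by (rule continuous_on_compose2[OF c(2)]) (auto intro!: continuous_intros)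
    then show "continuous_on ({-1<..<1} \<times> ?b) (\<lambda>(t, x). g' (x + t *\<^sub>R ?e))"
      by (simp add: case_prod_beta')
  qed auto
  moreover have "at (0::real) within {-1<..<1} = at 0" by (rule at_within_open) auto
  ultimately have "(J has_vector_derivative integral ?b g') (at 0)"
    by (simp only: scaleR_zero_left add_0_right)
  then have "(J has_real_derivative integral ?b g') (at 0)"
    by (simp add: has_real_derivative_iff_has_vector_derivative)
  moreover have ev: "\<forall>\<^sub>F t in nhds 0. J t = J 0"
    unfolding eventually_nhds_metric by (intro exI[of _ 1]) (auto simp: dist_real_def intro: J)
  ultimately have "((\<lambda>_. J 0) has_real_derivative integral ?b g') (at 0)"
    using DERIV_cong_ev[OF refl ev refl] by simp
  then show ?thesis using DERIV_const DERIV_unique by blast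
qed

text \<open>Green's identity in one coordinate direction: the derivatives of \<open>h1 * Q\<close>
  and of \<open>h * Q1\<close> both integrate to 0. Only the test function has to vanish outside the
  ball.\<close>

lemma integral_by_parts_twice:
  fixes h Q :: "real^'m::finite \<Rightarrow> real"
  assumes h: "\<And>x. ((\<lambda>t. h (x + t *\<^sub>R axis i 1)) has_real_derivative h1 x) (at 0)"
      "\<And>x. ((\<lambda>t. h1 (x + t *\<^sub>R axis i 1)) has_real_derivative h2 x) (at 0)"
    and Q: "\<And>x. ((\<lambda>t. Q (x + t *\<^sub>R axis i 1)) has_real_derivative Q1 x) (at 0)"
      "\<And>x. ((\<lambda>t. Q1 (x + t *\<^sub>R axis i 1)) has_real_derivative Q2 x) (at 0)"
    and ch: "continuous_on UNIV h" "continuous_on UNIV h1" "continuous_on UNIV h2"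
    and cQ: "continuous_on UNIV Q" "continuous_on UNIV Q1" "continuous_on UNIV Q2"
    and supp: "\<And>x. R \<le> norm x \<Longrightarrow> Q x = 0" "\<And>x. R \<le> norm x \<Longrightarrow> Q1 x = 0" and S: "R + 1 \<le> S"
  shows "integral (centered_box S) (\<lambda>x. h2 x * Q x) = integral (centered_box S) (\<lambda>x. h x * Q2 x)"
proof -
  have int: "f integrable_on centered_box S" if "continuous_on UNIV f" for f :: "real^'m \<Rightarrow> real"
    using that by (intro integrable_continuous) (rule continuous_on_subset, auto)
  have "integral (centered_box S) (\<lambda>x. h2 x * Q x + Q1 x * h1 x) = 0"
    by (rule integral_line_derivative_zero[where g = "\<lambda>x. h1 x * Q x" and R = R])
      (use DERIV_mult[OF h(2) Q(1)] ch cQ supp S in \<open>auto intro!: continuous_intros\<close>)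
  moreover have "integral (centered_box S) (\<lambda>x. h1 x * Q1 x + Q2 x * h x) = 0"
    by (rule integral_line_derivative_zero[where g = "\<lambda>x. h x * Q1 x" and R = R])
      (use DERIV_mult[OF h(1) Q(2)] ch cQ supp S in \<open>auto intro!: continuous_intros\<close>)
  moreover have "integral (centered_box S) (\<lambda>x. h2 x * Q x + Q1 x * h1 x)
     = integral (centered_box S) (\<lambda>x. h2 x * Q x) + integral (centered_box S) (\<lambda>x. h1 x * Q1 x)"
    using ch cQ by (subst integral_add[symmetric]) (auto intro!: int continuous_intros simp: mult.commute)
  moreover have "integral (centered_box S) (\<lambda>x. h1 x * Q1 x + Q2 x * h x)
     = integral (centered_box S) (\<lambda>x. h1 x * Q1 x) + integral (centered_box S) (\<lambda>x. h x * Q2 x)"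
    using ch cQ by (subst integral_add[symmetric]) (auto intro!: int continuous_intros simp: mult.commute)
  ultimately show ?thesis by linarith
qed

text \<open>Taking the positive part makes the support compact, while inside the ball the weight is
  a polynomial whose derivatives stay in the same family with smaller \<open>k\<close>.\<close>

definition radial_weight :: "nat \<Rightarrow> real \<Rightarrow> 'a::real_inner \<Rightarrow> real" where
  "radial_weight k r x = max 0 (r\<^sup>2 - x \<bullet> x) ^ k"

lemma radial_weight_continuous: "continuous_on A (radial_weight k r)"
  unfolding radial_weight_def by (intro continuous_intros)

lemma radial_weight_zero: "0 \<le> r \<Longrightarrow> r \<le> norm x \<Longrightarrow> 0 < k \<Longrightarrow> radial_weight k r x = 0"
  using power_mono[of r "norm x" 2] by (simp add: radial_weight_def max_def dot_square_norm)

text \<open>Exponents start at 2 so that the kink at 0 is smoothed out: there the difference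
  quotient is at most \<open>\<bar>h\<bar> ^ (k + 1)\<close>, which tends to 0.\<close>

lemma max_zero_power_derivative:
  fixes s :: real
  shows "((\<lambda>s. max 0 s ^ (k + 2)) has_real_derivative real (k + 2) * max 0 s ^ (k + 1)) (at s)"
proof -
  consider "s > 0" | "s < 0" | "s = 0" by linarith
  then show ?thesis
  proof cases
    case 1
    have "((\<lambda>s::real. s ^ (k + 2)) has_real_derivative real (k + 2) * max 0 s ^ (k + 1)) (at s)"
      using DERIV_pow[of "k + 2" s] 1 by simp
    then show ?thesis
      by (rule has_field_derivative_transform_within_open[of _ _ _ "{0<..}"]) (use 1 in auto)
  next
    case 2
    have "((\<lambda>s::real. 0) has_real_derivative real (k + 2) * max 0 s ^ (k + 1)) (at s)"
      using 2 by (auto intro!: derivative_eq_intros)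
    then show ?thesis
      by (rule has_field_derivative_transform_within_open[of _ _ _ "{..<0}"]) (use 2 in auto)
  next
    case 3
    have "((\<lambda>h. (max 0 (0 + h) ^ (k + 2) - max 0 0 ^ (k + 2)) / h) \<longlongrightarrow> (0::real)) (at 0)"
    proof (rule Lim_null_comparison)
      show "\<forall>\<^sub>F h::real in at 0. norm ((max 0 (0 + h) ^ (k + 2) - max 0 0 ^ (k + 2)) / h) \<le> \<bar>h\<bar> ^ (k + 1)"
        by (intro always_eventually) (auto simp: max_def power_abs intro!: mult_nonpos_nonneg)
      have "((\<lambda>h::real. \<bar>h\<bar> ^ (k + 1)) \<longlongrightarrow> \<bar>0\<bar> ^ (k + 1)) (at 0)"
        by (intro tendsto_intros)
      then show "((\<lambda>h::real. \<bar>h\<bar> ^ (k + 1)) \<longlongrightarrow> 0) (at 0)" by simp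
    qed
    then show ?thesis using 3 by (simp add: DERIV_def)
  qed
qed

lemma radial_weight_line_derivative:
  fixes x :: "real^'m::finite"
  shows "((\<lambda>t. radial_weight (k + 2) r (x + t *\<^sub>R axis i 1)) has_real_derivative
     - 2 * real (k + 2) * x $ i * radial_weight (k + 1) r x) (at 0)"
proof -
  have "(\<lambda>t. r\<^sup>2 - (x + t *\<^sub>R axis i 1) \<bullet> (x + t *\<^sub>R axis i 1)) = (\<lambda>t. r\<^sup>2 - x \<bullet> x - 2 * t * x $ i - t\<^sup>2)"
    by (auto simp: inner_add_left inner_add_right inner_axis inner_axis' power2_eq_square algebra_simps)
  then have "((\<lambda>t. r\<^sup>2 - (x + t *\<^sub>R axis i 1) \<bullet> (x + t *\<^sub>R axis i 1)) has_real_derivative - 2 * x $ i) (at 0)"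
    by (auto intro!: derivative_eq_intros)
  from DERIV_chain2[OF max_zero_power_derivative this, of k]
  show ?thesis by (simp add: radial_weight_def algebra_simps)
qed

lemma radial_weight_radius_derivative:
  "((\<lambda>r. radial_weight (k + 2) r x) has_real_derivative 2 * real (k + 2) * r * radial_weight (k + 1) r x) (at r)"
proof -
  have "((\<lambda>r. r\<^sup>2 - x \<bullet> x) has_real_derivative 2 * r) (at r)" by (auto intro!: derivative_eq_intros)
  from DERIV_chain2[OF max_zero_power_derivative this, of k]
  show ?thesis by (simp add: radial_weight_def algebra_simps)
qed

text \<open>Removes the factor \<open>x \<bullet> x\<close> that the Laplacian of a weight creates,
  trading it for the radius and the next weight.\<close>

lemma radial_weight_Suc: "(x \<bullet> x) * radial_weight (k + 1) r x = r\<^sup>2 * radial_weight (k + 1) r x - radial_weight (k + 2) r x"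
  by (auto simp: radial_weight_def max_def algebra_simps)

section \<open>Moments of a harmonic function that vanishes near the origin\<close>

context
  fixes h :: "real^'m::finite \<Rightarrow> real" and h1 h2 :: "'m \<Rightarrow> real^'m \<Rightarrow> real" and S \<epsilon> :: real
  assumes h: "\<And>i x. ((\<lambda>t. h (x + t *\<^sub>R axis i 1)) has_real_derivative h1 i x) (at 0)"
      "\<And>i x. ((\<lambda>t. h1 i (x + t *\<^sub>R axis i 1)) has_real_derivative h2 i x) (at 0)"
    and ch: "continuous_on UNIV h" "\<And>i. continuous_on UNIV (h1 i)" "\<And>i. continuous_on UNIV (h2 i)"
    and harmonic: "\<And>x. (\<Sum>i\<in>UNIV. h2 i x) = 0"
    and \<epsilon>: "0 < \<epsilon>" "\<And>x. norm x < \<epsilon> \<Longrightarrow> h x = 0"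
begin

text \<open>For fixed \<open>v\<close> the powers of \<open>v \<bullet> x\<close> are closed under
  the Laplacian up to constants, so the moments satisfy a recursion among themselves. Letting
  \<open>v\<close> and \<open>d\<close> vary recovers all exponentials.\<close>

definition ridge_moment :: "real^'m \<Rightarrow> nat \<Rightarrow> nat \<Rightarrow> real \<Rightarrow> real" where
  "ridge_moment v d k r = integral (centered_box S) (\<lambda>x. h x * ((v \<bullet> x) ^ d * radial_weight k r x))"

lemma integrable_centered_box:
  "continuous_on UNIV f \<Longrightarrow> f integrable_on (centered_box S :: (real^'m) set)" for f :: "real^'m \<Rightarrow> real"
  by (intro integrable_continuous) (rule continuous_on_subset, auto)

lemma ridge_moment_radius_derivative:
  "(ridge_moment v d (k + 2) has_real_derivative 2 * real (k + 2) * r * ridge_moment v d (k + 1) r) (at r)"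
proof -
  let ?f = "\<lambda>r x. h x * ((v \<bullet> x) ^ d * radial_weight (k + 2) r x)"
  let ?f' = "\<lambda>r x. 2 * real (k + 2) * r * (h x * ((v \<bullet> x) ^ d * radial_weight (k + 1) r x))"
  have c: "continuous_on A (\<lambda>x. h (g x))" if "continuous_on A g" for A and g :: "real \<times> (real^'m) \<Rightarrow> real^'m"
    by (rule continuous_on_compose2[OF ch(1) that]) simp
  have "((\<lambda>r. integral (centered_box S) (?f r)) has_vector_derivative integral (centered_box S) (?f' r)) (at r within UNIV)"
  proof (rule leibniz_rule_vector_derivative)
    fix r and x :: "real^'m"
    have "((\<lambda>r. ?f r x) has_real_derivative ?f' r x) (at r)"
      using DERIV_cmult[OF radial_weight_radius_derivative[of k x r], of "h x * (v \<bullet> x) ^ d"]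
      by (simp add: mult_ac)
    then show "((\<lambda>r. ?f r x) has_vector_derivative ?f' r x) (at r within UNIV)"
      by (simp add: has_real_derivative_iff_has_vector_derivative)
    show "?f r integrable_on centered_box S"
      using ch(1) by (intro integrable_centered_box continuous_intros radial_weight_continuous)
  next
    have "continuous_on (UNIV \<times> centered_box S) (\<lambda>z. ?f' (fst z) (snd z))"
      unfolding radial_weight_def by (intro continuous_intros c)
    then show "continuous_on (UNIV \<times> centered_box S) (\<lambda>(r, x). ?f' r x)"
      by (simp add: case_prod_beta')
  qed auto
  then show ?thesis
    by (simp add: has_real_derivative_iff_has_vector_derivative ridge_moment_def[abs_def])
qed

text \<open>Green's identity against \<open>(v \<bullet> x)\<^sup>d (r\<^sup>2 - |x|\<^sup>2)\<^sup>K\<close>.\<close>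
lemma ridge_moment_recursion:
  assumes r: "0 \<le> r" "r + 1 \<le> S"
  shows "real d * real (d - 1) * (v \<bullet> v) * ridge_moment v (d - 2) (k + 3) r
     - 2 * real (k + 3) * (2 * real d + real CARD('m) + 2 * real (k + 2)) * ridge_moment v d (k + 2) r
     + 4 * real (k + 3) * real (k + 2) * r\<^sup>2 * ridge_moment v d (k + 1) r = 0"
proof -
  define \<omega> where "\<omega> j x = radial_weight j r x" for j and x :: "real^'m"
  have c\<omega>: "continuous_on A (\<omega> j)" for A j unfolding \<omega>_def by (rule radial_weight_continuous)
  \<comment> \<open>With exponent \<open>k + 3\<close> both \<open>Q\<close> and its first
    derivatives vanish outside the ball, and the second derivatives are still continuous.\<close>
  define Q where "Q x = (v \<bullet> x) ^ d * \<omega> (k + 3) x" for x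
  define Q1 where "Q1 i x = real d * (v \<bullet> x) ^ (d - 1) * v $ i * \<omega> (k + 3) x
      + - 2 * real (k + 3) * x $ i * \<omega> (k + 2) x * (v \<bullet> x) ^ d" for i x
  define Q2 where "Q2 i x = real d * (real (d - 1) * (v \<bullet> x) ^ (d - 2) * v $ i) * v $ i * \<omega> (k + 3) x
      + - 2 * real (k + 3) * x $ i * \<omega> (k + 2) x * (real d * (v \<bullet> x) ^ (d - 1) * v $ i)
      + ((- 2 * real (k + 3) * \<omega> (k + 2) x + - 2 * real (k + 2) * x $ i * \<omega> (k + 1) x * (- 2 * real (k + 3) * x $ i)) * (v \<bullet> x) ^ d
         + real d * (v \<bullet> x) ^ (d - 1) * v $ i * (- 2 * real (k + 3) * x $ i * \<omega> (k + 2) x))" for i x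
  have dv: "((\<lambda>t. (v \<bullet> (x + t *\<^sub>R axis i 1)) ^ e) has_real_derivative real e * (v \<bullet> x) ^ (e - 1) * v $ i) (at 0)" for x i e
  proof -
    have "((\<lambda>t. v \<bullet> (x + t *\<^sub>R axis i 1)) has_real_derivative v $ i) (at 0)"
      by (auto intro!: derivative_eq_intros simp: inner_add_right inner_axis)
    from DERIV_power[OF this, of e] show ?thesis by (simp add: mult_ac)
  qed
  have d\<omega>: "((\<lambda>t. \<omega> (k + 3) (x + t *\<^sub>R axis i 1)) has_real_derivative - 2 * real (k + 3) * x $ i * \<omega> (k + 2) x) (at 0)"
      "((\<lambda>t. \<omega> (k + 2) (x + t *\<^sub>R axis i 1)) has_real_derivative - 2 * real (k + 2) * x $ i * \<omega> (k + 1) x) (at 0)" for x i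
    unfolding \<omega>_def using radial_weight_line_derivative[of "k + 1" r x i] radial_weight_line_derivative[of k r x i]
    by (simp_all add: numeral_eq_Suc)
  have dx: "((\<lambda>t. (x + t *\<^sub>R axis i 1) $ i) has_real_derivative 1) (at 0)" for x :: "real^'m" and i
    by (auto intro!: derivative_eq_intros)
  have dQ: "((\<lambda>t. Q (x + t *\<^sub>R axis i 1)) has_real_derivative Q1 i x) (at 0)" for x i
    unfolding Q_def Q1_def using DERIV_mult[OF dv[of x i d] d\<omega>(1)[of x i]] by simp
  have dQ1: "((\<lambda>t. Q1 i (x + t *\<^sub>R axis i 1)) has_real_derivative Q2 i x) (at 0)" for x i
  proof -
    have e: "d - 1 - 1 = d - 2" by simp
    have "((\<lambda>t. real d * (v \<bullet> (x + t *\<^sub>R axis i 1)) ^ (d - 1) * v $ i * \<omega> (k + 3) (x + t *\<^sub>R axis i 1)) has_real_derivative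
       real d * (real (d - 1) * (v \<bullet> x) ^ (d - 2) * v $ i) * v $ i * \<omega> (k + 3) x
      + - 2 * real (k + 3) * x $ i * \<omega> (k + 2) x * (real d * (v \<bullet> x) ^ (d - 1) * v $ i)) (at 0)"
      using DERIV_mult[OF DERIV_cmult_right[OF DERIV_cmult[OF dv[of x i "d - 1"], of "real d"], of "v $ i"] d\<omega>(1)[of x i]]
      by (simp only: e scaleR_zero_left add_0_right)
    moreover have "((\<lambda>t. - 2 * real (k + 3) * (x + t *\<^sub>R axis i 1) $ i * \<omega> (k + 2) (x + t *\<^sub>R axis i 1) * (v \<bullet> (x + t *\<^sub>R axis i 1)) ^ d) has_real_derivative
       (- 2 * real (k + 3) * \<omega> (k + 2) x + - 2 * real (k + 2) * x $ i * \<omega> (k + 1) x * (- 2 * real (k + 3) * x $ i)) * (v \<bullet> x) ^ d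
         + real d * (v \<bullet> x) ^ (d - 1) * v $ i * (- 2 * real (k + 3) * x $ i * \<omega> (k + 2) x)) (at 0)"
      using DERIV_mult[OF DERIV_mult[OF DERIV_cmult[OF dx[of x i], of "- 2 * real (k + 3)"] d\<omega>(2)[of x i]] dv[of x i d]]
      by (simp only: scaleR_zero_left add_0_right mult_1_right)
    ultimately show ?thesis unfolding Q1_def Q2_def by (rule DERIV_add)
  qed
  \<comment> \<open>For \<open>d < 2\<close> the truncated exponents are harmless: the factors
    \<open>real d\<close> and \<open>real (d - 1)\<close> remove the terms in which they
    matter.\<close>
  have lap: "(\<Sum>i\<in>UNIV. Q2 i x) = real d * real (d - 1) * (v \<bullet> v) * ((v \<bullet> x) ^ (d - 2) * \<omega> (k + 3) x)
     - 2 * real (k + 3) * (2 * real d + real CARD('m) + 2 * real (k + 2)) * ((v \<bullet> x) ^ d * \<omega> (k + 2) x)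
     + 4 * real (k + 3) * real (k + 2) * r\<^sup>2 * ((v \<bullet> x) ^ d * \<omega> (k + 1) x)" for x
  proof -
    have "Q2 i x = (real d * real (d - 1) * (v \<bullet> x) ^ (d - 2) * \<omega> (k + 3) x) * (v $ i * v $ i)
        - (4 * real (k + 3) * \<omega> (k + 2) x * (real d * (v \<bullet> x) ^ (d - 1))) * (v $ i * x $ i)
        + 4 * real (k + 2) * real (k + 3) * \<omega> (k + 1) x * (v \<bullet> x) ^ d * (x $ i * x $ i)
        - 2 * real (k + 3) * \<omega> (k + 2) x * (v \<bullet> x) ^ d" for i
    proof -
      have "D * (D1 * A2 * vi) * vi * w3 + - 2 * K3 * xi * w2 * (D * A1 * vi)
          + ((- 2 * K3 * w2 + - 2 * K2 * xi * w1 * (- 2 * K3 * xi)) * A + D * A1 * vi * (- 2 * K3 * xi * w2))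
        = (D * D1 * A2 * w3) * (vi * vi) - (4 * K3 * w2 * (D * A1)) * (vi * xi)
          + 4 * K2 * K3 * w1 * A * (xi * xi) - 2 * K3 * w2 * A" for D D1 A A1 A2 vi xi w1 w2 w3 K2 K3 :: real
        by (simp add: algebra_simps)
      then show ?thesis unfolding Q2_def .
    qed
    then have "(\<Sum>i\<in>UNIV. Q2 i x) = (real d * real (d - 1) * (v \<bullet> x) ^ (d - 2) * \<omega> (k + 3) x) * (v \<bullet> v)
        - (4 * real (k + 3) * \<omega> (k + 2) x * (real d * (v \<bullet> x) ^ (d - 1))) * (v \<bullet> x)
        + 4 * real (k + 2) * real (k + 3) * \<omega> (k + 1) x * (v \<bullet> x) ^ d * (x \<bullet> x)
        - real CARD('m) * (2 * real (k + 3) * \<omega> (k + 2) x * (v \<bullet> x) ^ d)"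
      by (simp add: sum.distrib sum_subtractf inner_vec_def flip: sum_distrib_left)
    note lapsum = this
    have e1: "real d * (v \<bullet> x) ^ (d - 1) * (v \<bullet> x) = real d * (v \<bullet> x) ^ d"
      by (cases d) auto
    have e2: "\<omega> (k + 1) x * (x \<bullet> x) = r\<^sup>2 * \<omega> (k + 1) x - \<omega> (k + 2) x"
      unfolding \<omega>_def using radial_weight_Suc[of x k r] by (simp add: mult.commute)
    have ring: "D * D1 * A2 * w3 * V - 4 * K3 * w2 * (D * A1) * L + 4 * K2 * K3 * w1 * A * X - m * (2 * K3 * w2 * A)
        = D * D1 * V * (A2 * w3) - 2 * K3 * (2 * D + m + 2 * K2) * (A * w2) + 4 * K3 * K2 * R * (A * w1)"
      if "D * A1 * L = D * A" "w1 * X = R * w1 - w2" for D D1 A A1 A2 L V X R m w1 w2 w3 K2 K3 :: real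
      using that by algebra
    show ?thesis unfolding lapsum by (rule ring[OF e1 e2])
  qed
  have "0 = (\<Sum>i\<in>UNIV. integral (centered_box S) (\<lambda>x. h2 i x * Q x))"
  proof -
    have "(\<Sum>i\<in>UNIV. integral (centered_box S) (\<lambda>x. h2 i x * Q x)) = integral (centered_box S) (\<lambda>x. \<Sum>i\<in>UNIV. h2 i x * Q x)"
      unfolding Q_def by (rule integral_sum[symmetric]) (auto intro!: integrable_centered_box continuous_intros ch c\<omega>)
    then show ?thesis by (simp add: harmonic flip: sum_distrib_right)
  qed
  also have "\<dots> = (\<Sum>i\<in>UNIV. integral (centered_box S) (\<lambda>x. h x * Q2 i x))"
  proof (intro sum.cong refl integral_by_parts_twice[OF h dQ dQ1 ch, where R = r])
    show "continuous_on UNIV Q" "continuous_on UNIV (Q1 i)" "continuous_on UNIV (Q2 i)" for i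
      unfolding Q_def Q1_def Q2_def by (intro continuous_intros c\<omega>)+
    show "Q x = 0" "Q1 i x = 0" if "r \<le> norm x" for x i
      using radial_weight_zero[OF r(1) that] by (simp_all add: Q_def Q1_def \<omega>_def)
  qed (use r in auto)
  also have "\<dots> = integral (centered_box S) (\<lambda>x. \<Sum>i\<in>UNIV. h x * Q2 i x)"
    unfolding Q2_def by (rule integral_sum[symmetric]) (auto intro!: integrable_centered_box continuous_intros ch c\<omega>)
  also have "\<dots> = integral (centered_box S) (\<lambda>x.
     real d * real (d - 1) * (v \<bullet> v) * (h x * ((v \<bullet> x) ^ (d - 2) * \<omega> (k + 3) x))
     - 2 * real (k + 3) * (2 * real d + real CARD('m) + 2 * real (k + 2)) * (h x * ((v \<bullet> x) ^ d * \<omega> (k + 2) x))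
     + 4 * real (k + 3) * real (k + 2) * r\<^sup>2 * (h x * ((v \<bullet> x) ^ d * \<omega> (k + 1) x)))"
    unfolding sum_distrib_left[symmetric] lap by (rule arg_cong[of _ _ "integral (centered_box S)"]) (simp add: fun_eq_iff algebra_simps)
  also have "\<dots> = real d * real (d - 1) * (v \<bullet> v) * ridge_moment v (d - 2) (k + 3) r
     - 2 * real (k + 3) * (2 * real d + real CARD('m) + 2 * real (k + 2)) * ridge_moment v d (k + 2) r
     + 4 * real (k + 3) * real (k + 2) * r\<^sup>2 * ridge_moment v d (k + 1) r"
  proof -
    have i: "(\<lambda>x. c * (h x * ((v \<bullet> x) ^ e * \<omega> j x))) integrable_on centered_box S" for c e j
      by (intro integrable_centered_box continuous_intros ch c\<omega>)
    show ?thesis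
      unfolding ridge_moment_def \<omega>_def[symmetric]
      by (subst integral_add integral_diff, (intro i integrable_diff)+)+ simp
  qed
  finally show ?thesis by simp
qed

text \<open>By induction on \<open>d\<close> the lower moment drops out of the recursion, which
  becomes a first-order Euler equation in the radius. Hence the moment is a constant times
  \<open>r ^ C\<close>, and that constant is seen to be 0 at a small radius. The exponent
  \<open>k\<close> must be arbitrary because the lower moment comes with a larger one.\<close>

lemma ridge_moment_zero:
  assumes "0 < r" "r + 1 \<le> S"
  shows "ridge_moment v d (k + 2) r = 0"
  using assms
proof (induction d arbitrary: k r rule: less_induct)
  case (less d)
  \<comment> \<open>The scaling exponent of the moment for an \<open>h\<close> homogeneous of degree
    \<open>d\<close>: \<open>h\<close> and the ridge power give \<open>2 * d\<close>, Lebesgue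
    measure \<open>CARD('m)\<close>, the weight \<open>2 * (k + 2)\<close>.\<close>
  define C where "C = 2 * d + CARD('m) + 2 * (k + 2)"
  let ?N = "ridge_moment v d (k + 2)"
  \<comment> \<open>The left-hand side is \<open>r\<close> times the radius derivative of
    \<open>?N\<close>.\<close>
  have ode: "2 * real (k + 2) * r * ridge_moment v d (k + 1) r * r = real C * ?N r" if r: "0 < r" "r + 1 \<le> S" for r
  proof -
    have a0: "real d * real (d - 1) * (v \<bullet> v) * ridge_moment v (d - 2) (k + 3) r = 0"
    proof (cases "d < 2")
      case True
      then show ?thesis by (cases "d = 0") (auto simp: less_2_cases_iff)
    next
      case False
      then have "ridge_moment v (d - 2) (k + 1 + 2) r = 0" using less.IH[of "d - 2" r "k + 1"] r by simp
      then show ?thesis by (simp add: numeral_eq_Suc)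
    qed
    have alg: "2 * K2 * r * N1 * r = c * N2"
      if "a = 0" "a - 2 * K3 * c * N2 + 4 * K3 * K2 * r\<^sup>2 * N1 = 0" "K3 \<noteq> 0" for a K2 K3 c N1 N2 :: real
    proof -
      have "2 * K3 * (2 * K2 * r * N1 * r - c * N2) = 0"
        using that(1,2) by (simp add: algebra_simps power2_eq_square)
      then show ?thesis using that(3) by simp
    qed
    have "2 * real (k + 2) * r * ridge_moment v d (k + 1) r * r
        = (2 * real d + real CARD('m) + 2 * real (k + 2)) * ?N r"
      by (rule alg[OF a0 ridge_moment_recursion]) (use r in auto)
    then show ?thesis by (simp add: C_def)
  qed
  define \<phi> where "\<phi> r = ?N r / r ^ C" for r
  have d\<phi>: "(\<phi> has_field_derivative 0) (at r within {0<..S - 1})" if "r \<in> {0<..S - 1}" for r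
  proof -
    have r: "0 < r" "r + 1 \<le> S" using that by auto
    have C: "C = Suc (C - 1)" by (simp add: C_def)
    have "(\<phi> has_field_derivative (2 * real (k + 2) * r * ridge_moment v d (k + 1) r * r ^ C
        - ?N r * (real C * r ^ (C - 1))) / (r ^ C * r ^ C)) (at r)"
      unfolding \<phi>_def using r
      by (intro DERIV_divide ridge_moment_radius_derivative DERIV_pow[of C, simplified]) auto
    moreover have "2 * real (k + 2) * r * ridge_moment v d (k + 1) r * r ^ C = ?N r * (real C * r ^ (C - 1))"
      using ode[OF r] by (subst C) (simp add: mult_ac)
    ultimately show ?thesis by (simp add: has_field_derivative_at_within)
  qed
  obtain c where c: "\<And>r. r \<in> {0<..S - 1} \<Longrightarrow> \<phi> r = c"
    using has_field_derivative_zero_constant[OF _ d\<phi>] by auto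
  \<comment> \<open>At radius \<open>r1 < \<epsilon>\<close> the weight lives where \<open>h\<close>
    vanishes, so the integrand is identically 0.\<close>
  define r1 where "r1 = min r (\<epsilon> / 2)"
  have r1: "0 < r1" "r1 \<le> r" "r1 < \<epsilon>" using less.prems \<epsilon>(1) by (auto simp: r1_def)
  have z: "h x * ((v \<bullet> x) ^ d * radial_weight (k + 2) r1 x) = 0" for x
    using \<epsilon>(2)[of x] radial_weight_zero[of r1 x "k + 2"] r1 by (cases "norm x < \<epsilon>") auto
  have "\<phi> r1 = 0" unfolding \<phi>_def ridge_moment_def z by simp
  then have "\<phi> r = 0" using c[of r1] c[of r] r1 less.prems by simp
  then show ?case using less.prems by (simp add: \<phi>_def)
qed

text \<open>On the box the exponential series times \<open>h\<close> and the weight converges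
  uniformly by the Weierstrass M-test, so it may be integrated term by term; each term is a
  vanishing ridge moment.\<close>

lemma exp_moment_zero:
  assumes "0 < r" "r + 1 \<le> S"
  shows "integral (centered_box S) (\<lambda>x. h x * (exp (v \<bullet> x) * radial_weight 2 r x)) = 0"
proof -
  let ?B = "centered_box S :: (real^'m) set"
  let ?f = "\<lambda>n x. h x * (((v \<bullet> x) ^ n * radial_weight 2 r x)) / fact n"
  have cb: "continuous_on ?B h" using ch(1) by (rule continuous_on_subset) simp
  have "bounded ((\<lambda>x. h x * radial_weight 2 r x) ` ?B)"
    by (intro compact_imp_bounded compact_continuous_image continuous_intros cb radial_weight_continuous compact_cbox)
  then obtain M where M: "\<And>x. x \<in> ?B \<Longrightarrow> \<bar>h x * radial_weight 2 r x\<bar> \<le> M"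
    unfolding bounded_iff by auto
  have "bounded ((\<lambda>x. v \<bullet> x) ` ?B)"
    by (intro compact_imp_bounded compact_continuous_image continuous_intros compact_cbox)
  then obtain L where L: "\<And>x. x \<in> ?B \<Longrightarrow> \<bar>v \<bullet> x\<bar> \<le> L"
    unfolding bounded_iff by auto
  have bound: "norm (?f n x) \<le> M * (inverse (fact n) * L ^ n)" if x: "x \<in> ?B" for n x
  proof -
    have "norm (?f n x) = \<bar>h x * radial_weight 2 r x\<bar> * (inverse (fact n) * \<bar>v \<bullet> x\<bar> ^ n)"
      by (simp add: abs_mult power_abs divide_inverse mult_ac)
    also have "\<dots> \<le> M * (inverse (fact n) * L ^ n)"
      using M[OF x] L[OF x] by (intro mult_mono power_mono) (auto intro: order_trans[OF abs_ge_zero])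
    finally show ?thesis .
  qed
  have "summable (\<lambda>n. M * (inverse (fact n) * L ^ n))"
    using summable_exp[of L] by (intro summable_mult) simp
  with bound have "uniform_limit ?B (\<lambda>n x. \<Sum>i<n. ?f i x) (\<lambda>x. \<Sum>i. ?f i x) sequentially"
    by (rule Weierstrass_m_test[where f = ?f])
  moreover have "(\<Sum>i. ?f i x) = h x * (exp (v \<bullet> x) * radial_weight 2 r x)" for x
  proof -
    have "(\<lambda>i. h x * radial_weight 2 r x * ((v \<bullet> x) ^ i /\<^sub>R fact i)) sums (h x * radial_weight 2 r x * exp (v \<bullet> x))"
      by (intro sums_mult exp_converges)
    then show ?thesis by (simp add: sums_iff divide_inverse mult_ac)
  qed
  ultimately have lim: "uniform_limit ?B (\<lambda>n x. \<Sum>i<n. ?f i x) (\<lambda>x. h x * (exp (v \<bullet> x) * radial_weight 2 r x)) sequentially"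
    by simp
  have cf: "continuous_on ?B (\<lambda>x. \<Sum>i<n. ?f i x)" for n
    by (intro continuous_intros cb radial_weight_continuous) simp
  obtain I J where IJ: "\<And>n. ((\<lambda>x. \<Sum>i<n. ?f i x) has_integral I n) ?B"
    "((\<lambda>x. h x * (exp (v \<bullet> x) * radial_weight 2 r x)) has_integral J) ?B" "I \<longlonglongrightarrow> J"
    by (rule uniform_limit_integral_cbox[OF lim cf], simp, rule that)
  have "I n = 0" for n
  proof -
    have "((\<lambda>x. ?f i x) has_integral 0) ?B" for i
    proof -
      have "((\<lambda>x. h x * ((v \<bullet> x) ^ i * radial_weight 2 r x)) has_integral ridge_moment v i 2 r) ?B"
        unfolding ridge_moment_def
        by (intro integrable_integral integrable_centered_box continuous_intros ch radial_weight_continuous)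
      from has_integral_divide[OF this, of "fact i"] show ?thesis
        using ridge_moment_zero[OF assms, of v i 0] by (simp add: numeral_2_eq_2)
    qed
    then have "((\<lambda>x. \<Sum>i<n. ?f i x) has_integral (\<Sum>i<n. 0)) ?B" by (intro has_integral_sum) auto
    from has_integral_unique[OF IJ(1)[of n] this] show ?thesis by simp
  qed
  then have "I = (\<lambda>_. 0)" by auto
  then have "J = 0" using IJ(3) by (simp add: LIMSEQ_const_iff)
  then show ?thesis using IJ(2) by (simp add: integral_unique)
qed

end

text \<open>A product of ridge powers in different directions is no ridge power, whereas
  exponentials multiply to exponentials. This makes the class an algebra, as Stone-Weierstrass
  demands.\<close>

inductive exp_polynomial :: "('a::real_inner \<Rightarrow> real) \<Rightarrow> bool" where
  exp: "exp_polynomial (\<lambda>x. c * exp (v \<bullet> x))"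
| add: "exp_polynomial f \<Longrightarrow> exp_polynomial g \<Longrightarrow> exp_polynomial (\<lambda>x. f x + g x)"

lemma exp_polynomial_mult_exp:
  "exp_polynomial f \<Longrightarrow> exp_polynomial (\<lambda>x. f x * (c * exp (v \<bullet> x)))"
proof (induction rule: exp_polynomial.induct)
  case (exp c' v')
  have "(\<lambda>x. c' * exp (v' \<bullet> x) * (c * exp (v \<bullet> x))) = (\<lambda>x. (c' * c) * exp ((v' + v) \<bullet> x))"
    by (simp add: inner_add_left exp_add mult_ac)
  then show ?case by (simp only: exp_polynomial.exp)
next
  case (add f g)
  then show ?case by (simp only: distrib_right exp_polynomial.add)
qed

lemma exp_polynomial_mult:
  assumes "exp_polynomial f" "exp_polynomial g"
  shows "exp_polynomial (\<lambda>x. f x * g x)"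
  using assms(2)
proof (induction rule: exp_polynomial.induct)
  case (exp c v)
  then show ?case using exp_polynomial_mult_exp[OF assms(1)] .
next
  case (add g g')
  then show ?case by (simp only: distrib_left exp_polynomial.add)
qed

lemma exp_polynomial_continuous: "exp_polynomial f \<Longrightarrow> continuous_on A f"
  by (induction rule: exp_polynomial.induct) (auto intro!: continuous_intros)

text \<open>\<open>h\<close> is orthogonal to every exponential polynomial with respect to the
  weight. Subtracting a good approximation \<open>g\<close> bounds the weighted integral of
  \<open>h * h\<close> by an arbitrarily small multiple of that of \<open>\<bar>h\<bar>\<close>, so
  it vanishes, and \<open>h\<close> is 0 wherever the weight is positive.\<close>

lemma harmonic_zero_near_0_imp_zero:
  fixes h :: "real^'m::finite \<Rightarrow> real"
  assumes h: "\<And>i x. ((\<lambda>t. h (x + t *\<^sub>R axis i 1)) has_real_derivative h1 i x) (at 0)"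
      "\<And>i x. ((\<lambda>t. h1 i (x + t *\<^sub>R axis i 1)) has_real_derivative h2 i x) (at 0)"
    and ch: "continuous_on UNIV h" "\<And>i. continuous_on UNIV (h1 i)" "\<And>i. continuous_on UNIV (h2 i)"
    and harmonic: "\<And>x. (\<Sum>i\<in>UNIV. h2 i x) = 0"
    and \<epsilon>: "0 < \<epsilon>" "\<And>x. norm x < \<epsilon> \<Longrightarrow> h x = 0"
  shows "h y = 0"
proof -
  \<comment> \<open>Large enough for the weight to be positive at \<open>y\<close>.\<close>
  define r where "r = norm y + 1"
  define S where "S = r + 1"
  have r: "0 < r" "r + 1 \<le> S" "norm y < r" unfolding S_def r_def using norm_ge_zero[of y] by linarith+
  let ?B = "centered_box S :: (real^'m) set"
  let ?w = "radial_weight 2 r :: real^'m \<Rightarrow> real"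
  have cb: "continuous_on ?B h" using ch(1) by (rule continuous_on_subset) simp
  note cw = radial_weight_continuous
  have int: "f integrable_on ?B" if "continuous_on ?B f" for f :: "real^'m \<Rightarrow> real"
    using that by (rule integrable_continuous)
  have zero: "integral ?B (\<lambda>x. h x * (g x * ?w x)) = 0" if "exp_polynomial g" for g
    using that
  proof (induction rule: exp_polynomial.induct)
    case (exp c v)
    have "(\<lambda>x. h x * (c * exp (v \<bullet> x) * ?w x)) = (\<lambda>x. c * (h x * (exp (v \<bullet> x) * ?w x)))"
      by (simp add: mult_ac)
    then show ?case using exp_moment_zero[OF h ch harmonic \<epsilon> r(1,2), of v] by simp
  next
    case (add f g)
    have "integral ?B (\<lambda>x. h x * (f x * ?w x) + h x * (g x * ?w x)) = 0 + 0"
      using add by (subst integral_add)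
        (auto intro!: int continuous_intros cb cw exp_polynomial_continuous[OF add.hyps(1)] exp_polynomial_continuous[OF add.hyps(2)])
    then show ?case by (simp add: algebra_simps)
  qed
  let ?C = "integral ?B (\<lambda>x. \<bar>h x\<bar> * ?w x)"
  have w0: "0 \<le> ?w x" for x by (simp add: radial_weight_def)
  have small: "integral ?B (\<lambda>x. h x * h x * ?w x) \<le> e * ?C" if e: "e > 0" for e
  proof -
    obtain g where g: "exp_polynomial g" "\<And>x. x \<in> ?B \<Longrightarrow> \<bar>h x - g x\<bar> < e"
    proof -
      have "\<exists>g. exp_polynomial g \<and> (\<forall>x\<in>?B. \<bar>h x - g x\<bar> < e)"
      proof (rule Stone_Weierstrass_HOL)
        show "exp_polynomial (\<lambda>x. c)" for c using exp_polynomial.exp[of c 0] by simp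
        show "\<exists>f. exp_polynomial f \<and> f x \<noteq> f y" if "x \<in> ?B \<and> y \<in> ?B \<and> x \<noteq> y" for x y
        proof (intro exI conjI)
          show "exp_polynomial (\<lambda>z. 1 * exp ((x - y) \<bullet> z))" by (rule exp_polynomial.exp)
          have "(x - y) \<bullet> (x - y) \<noteq> 0" using that by simp
          then show "1 * exp ((x - y) \<bullet> x) \<noteq> 1 * exp ((x - y) \<bullet> y)" by (simp add: inner_diff_right)
        qed
      qed (use e cb in \<open>auto intro: exp_polynomial_continuous exp_polynomial.add exp_polynomial_mult\<close>)
      then show ?thesis using that by blast
    qed
    have "integral ?B (\<lambda>x. h x * h x * ?w x) = integral ?B (\<lambda>x. h x * h x * ?w x) - integral ?B (\<lambda>x. h x * (g x * ?w x))"
      using zero[OF g(1)] by simp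
    also have "\<dots> = integral ?B (\<lambda>x. h x * h x * ?w x - h x * (g x * ?w x))"
      by (rule integral_diff[symmetric]) (auto intro!: int continuous_intros cb cw exp_polynomial_continuous[OF g(1)])
    also have "\<dots> \<le> integral ?B (\<lambda>x. e * (\<bar>h x\<bar> * ?w x))"
    proof (rule integral_le)
      fix x assume x: "x \<in> ?B"
      have "h x * h x * ?w x - h x * (g x * ?w x) = (h x * (h x - g x)) * ?w x" by (simp add: algebra_simps)
      also have "\<dots> \<le> (\<bar>h x\<bar> * e) * ?w x"
      proof (rule mult_right_mono[OF _ w0])
        have "h x * (h x - g x) \<le> \<bar>h x\<bar> * \<bar>h x - g x\<bar>" by (metis abs_ge_self abs_mult)
        also have "\<dots> \<le> \<bar>h x\<bar> * e" using g(2)[OF x] by (intro mult_left_mono) auto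
        finally show "h x * (h x - g x) \<le> \<bar>h x\<bar> * e" .
      qed
      finally show "h x * h x * ?w x - h x * (g x * ?w x) \<le> e * (\<bar>h x\<bar> * ?w x)" by (simp add: mult_ac)
    qed (auto intro!: int continuous_intros cb cw exp_polynomial_continuous[OF g(1)])
    finally show ?thesis by simp
  qed
  have C0: "0 \<le> ?C" using w0 by (intro integral_nonneg int continuous_intros cb cw) auto
  have "integral ?B (\<lambda>x. h x * h x * ?w x) \<le> 0"
  proof (rule field_le_epsilon)
    fix e :: real assume "0 < e"
    \<comment> \<open>Dividing by \<open>?C + 1\<close> rather than \<open>?C\<close> covers the
      case \<open>?C = 0\<close>.\<close>
    have "integral ?B (\<lambda>x. h x * h x * ?w x) \<le> e / (?C + 1) * ?C"
      using \<open>0 < e\<close> C0 by (intro small) auto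
    also have "\<dots> \<le> e" using \<open>0 < e\<close> C0 by (simp add: divide_simps)
    finally show "integral ?B (\<lambda>x. h x * h x * ?w x) \<le> 0 + e" by simp
  qed
  moreover have "0 \<le> integral ?B (\<lambda>x. h x * h x * ?w x)"
    using w0 by (intro integral_nonneg int continuous_intros cb cw) auto
  ultimately have i0: "integral ?B (\<lambda>x. h x * h x * ?w x) = 0" by simp
  have chw: "continuous_on ?B (\<lambda>x. h x * h x * ?w x)" by (intro continuous_intros cb cw)
  have hi: "((\<lambda>x. h x * h x * ?w x) has_integral 0) ?B"
    using integrable_integral[OF int[OF chw]] unfolding i0 .
  have "S > 0" "norm y \<le> S" using r by simp_all
  then have "h y * h y * ?w y = 0"
    using w0 norm_le_imp_centered_box[of y S]
    by (intro has_integral_0_cbox_imp_0[OF chw _ hi]) (simp_all add: interval_ne_empty_cart)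
  moreover have "?w y > 0"
    using r(1,3) power_strict_mono[of "norm y" r 2] by (simp add: radial_weight_def max_def dot_square_norm)
  ultimately show ?thesis by simp
qed

subsection \<open>Holomorphic functions of several variables\<close>

lemma norm_axis_complex: "norm (axis j c :: complex^'m::finite) = norm c"
proof -
  have "(\<Sum>i\<in>UNIV. (norm (axis j c $ i :: complex))\<^sup>2) = (\<Sum>i\<in>UNIV. if i = j then (norm c)\<^sup>2 else 0)"
    by (intro sum.cong) (auto simp: axis_def)
  then show ?thesis by (simp add: norm_vec_def L2_set_def)
qed

lemma norm_vector_scalar_mult: "norm (c *s v) = norm c * norm v" for v :: "complex^'m::finite"
  by (simp add: norm_vec_def L2_set_def norm_mult power_mult_distrib real_sqrt_mult flip: sum_distrib_left)

lemma bounded_linear_axis: "bounded_linear (axis j :: complex \<Rightarrow> complex^'m::finite)"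
proof (rule bounded_linear_intro[of _ 1])
  show "norm (axis j x :: complex^'m) \<le> norm x * 1" for x :: complex by (simp add: norm_axis_complex)
qed (auto simp: axis_def vec_eq_iff)

lemma bounded_linear_vector_scalar_mult_left: "bounded_linear (\<lambda>c. c *s (v :: complex^'m::finite))"
  by (rule bounded_linear_intro[of _ "norm v"])
    (auto simp: vec_eq_iff norm_vector_scalar_mult distrib_right)

section \<open>Complex partial derivatives and Cauchy's formula\<close>

definition cpd :: "'m::finite \<Rightarrow> (complex^'m \<Rightarrow> complex) \<Rightarrow> complex^'m \<Rightarrow> complex" where
  "cpd j H z = deriv (\<lambda>t. H (z + axis j t)) 0"

text \<open>A real-linear map that commutes with multiplication by \<i> is complex-linear, hence
  determined by its values on the complex standard basis.\<close>

lemma complex_linear_expand: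
  fixes L :: "complex^'m::finite \<Rightarrow> complex"
  assumes "linear L" and i: "\<And>v. L (\<chi> j. \<i> * v $ j) = \<i> * L v"
  shows "L v = (\<Sum>j\<in>UNIV. v $ j * L (axis j 1))"
proof -
  have ax: "L (axis j c) = c * L (axis j 1)" for j c
  proof -
    have "axis j c = Re c *\<^sub>R axis j 1 + Im c *\<^sub>R (\<chi> l. \<i> * (axis j 1 :: complex^'m) $ l)"
      by (auto simp: vec_eq_iff axis_def complex_eq_iff)
    then have "L (axis j c) = Re c *\<^sub>R L (axis j 1) + Im c *\<^sub>R (\<i> * L (axis j 1))"
      by (simp only: linear_add[OF assms(1)] linear_cmul[OF assms(1)] i)
    also have "\<dots> = (of_real (Re c) + \<i> * of_real (Im c)) * L (axis j 1)"
      by (simp add: scaleR_conv_of_real algebra_simps)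
    finally show ?thesis by (simp flip: complex_eq)
  qed
  have "v = (\<Sum>j\<in>UNIV. axis j (v $ j))" by (simp add: vec_eq_iff axis_def)
  then have "L v = L (\<Sum>j\<in>UNIV. axis j (v $ j))" by (rule arg_cong)
  also have "\<dots> = (\<Sum>j\<in>UNIV. v $ j * L (axis j 1))"
    unfolding linear_sum[OF assms(1)] by (rule sum.cong[OF refl ax])
  finally show ?thesis .
qed

text \<open>Replaces the unspecified differential in \<open>holo_several\<close> by the explicit one
  built from partial derivatives, so that derivatives become functions of \<open>z\<close> which can
  be differentiated again.\<close>

lemma holo_several_has_derivative:
  fixes H :: "complex^'m::finite \<Rightarrow> complex"
  assumes "holo_several H D" "z \<in> D"
  shows "(H has_derivative (\<lambda>v. \<Sum>j\<in>UNIV. v $ j * cpd j H z)) (at z)"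
proof -
  obtain L where L: "(H has_derivative L) (at z)" "\<And>v. L (\<chi> j. \<i> * v $ j) = \<i> * L v"
    using assms unfolding holo_several_def by blast
  note ex = complex_linear_expand[OF has_derivative_linear[OF L(1)] L(2)]
  have "cpd j H z = L (axis j 1)" for j
  proof -
    have "((\<lambda>t. z + axis j t) has_derivative axis j) (at 0)"
      using has_derivative_add[OF has_derivative_const[of z] bounded_linear_imp_has_derivative[OF bounded_linear_axis[of j]]]
      by simp
    moreover have "(H has_derivative L) (at (z + axis j 0))" using L(1) by (simp add: axis_def zero_vec_def[symmetric])
    ultimately have der: "((\<lambda>t. H (z + axis j t)) has_derivative (\<lambda>t. L (axis j t))) (at 0)"
      by (rule has_derivative_compose)
    have "L (axis j t) = t * L (axis j 1)" for t
      using ex[of "axis j t"] by (simp add: axis_def if_distrib if_distribR cong: if_cong)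
    then have "t * L (axis j 1) = L (axis j t)" for t by (rule sym)
    with der have "((\<lambda>t. H (z + axis j t)) has_field_derivative L (axis j 1)) (at 0)"
      by (rule has_derivative_imp_has_field_derivative)
    then show ?thesis unfolding cpd_def by (rule DERIV_imp_deriv)
  qed
  moreover have "L = (\<lambda>v. \<Sum>j\<in>UNIV. v $ j * L (axis j 1))" using ex by blast
  ultimately show ?thesis using L(1) by simp
qed

lemma holo_several_continuous: "holo_several H D \<Longrightarrow> continuous_on D H"
  by (meson continuous_at_imp_continuous_on has_derivative_continuous holo_several_has_derivative)

text \<open>Restriction to complex lines is the way in which one-variable complex analysis
  enters.\<close>

lemma holo_several_line:
  fixes H :: "complex^'m::finite \<Rightarrow> complex"
  assumes "holo_several H D" "z + t *s v \<in> D"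
  shows "((\<lambda>t. H (z + t *s v)) has_field_derivative (\<Sum>j\<in>UNIV. v $ j * cpd j H (z + t *s v))) (at t)"
proof -
  have "((\<lambda>t. z + t *s v) has_derivative (\<lambda>t. t *s v)) (at t)"
    using has_derivative_add[OF has_derivative_const[of z] bounded_linear_imp_has_derivative[OF bounded_linear_vector_scalar_mult_left[of v]]]
    by simp
  from has_derivative_compose[OF this holo_several_has_derivative[OF assms]]
  have "((\<lambda>t. H (z + t *s v)) has_derivative (\<lambda>h. \<Sum>j\<in>UNIV. (h *s v) $ j * cpd j H (z + t *s v))) (at t)" .
  then show ?thesis
    by (rule has_derivative_imp_has_field_derivative) (simp add: sum_distrib_left mult_ac)
qed

lemma axis_eq_scalar_mult: "axis j t = t *s (axis j 1 :: complex^'m::finite)"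
  by (simp add: vec_eq_iff axis_def)

text \<open>Cauchy's formula for the first derivative in the j-th coordinate. It expresses
  \<open>cpd j H\<close> by values of \<open>H\<close> alone over a circle of fixed radius, which
  prepares differentiation under the integral.\<close>

lemma cpd_circle_integral:
  fixes H :: "complex^'m::finite \<Rightarrow> complex"
  assumes H: "holo_several H D" and \<rho>: "0 < \<rho>" "cball z \<rho> \<subseteq> D"
  shows "cpd j H z = (1 / of_real (2 * pi)) *
     integral {0..2*pi} (\<lambda>t. H (z + axis j (of_real \<rho> * cis t)) / (of_real \<rho> * cis t))"
proof -
  let ?f = "\<lambda>t. H (z + axis j t)"
  have inD: "z + axis j t \<in> D" if "norm t \<le> \<rho>" for t
    using that \<rho>(2) by (auto simp: dist_norm norm_axis_complex subset_iff)
  have df: "?f field_differentiable (at t)" if "norm t \<le> \<rho>" for t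
    using holo_several_line[OF H, of z t "axis j 1"] inD[OF that]
    unfolding axis_eq_scalar_mult[symmetric] field_differentiable_def by blast
  have hol: "?f holomorphic_on cball 0 \<rho>"
    using df by (auto simp: holomorphic_on_def intro: field_differentiable_at_within)
  have "((\<lambda>u. ?f u / (u - 0) ^ Suc 1) has_contour_integral ((2 * pi * \<i>) / fact 1 * (deriv ^^ 1) ?f 0)) (circlepath 0 \<rho>)"
    by (rule Cauchy_has_contour_integral_higher_derivative_circlepath)
      (use hol \<rho> in \<open>auto intro: holomorphic_on_imp_continuous_on holomorphic_on_subset\<close>)
  then have "((\<lambda>u. ?f u / u\<^sup>2) has_contour_integral 2 * pi * \<i> * cpd j H z) (part_circlepath 0 \<rho> 0 (2 * pi))"
    by (simp add: circlepath_def cpd_def power2_eq_square)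
  then have "((\<lambda>t. ?f (0 + \<rho> * cis t) / (0 + \<rho> * cis t)\<^sup>2 * \<rho> * \<i> * cis t) has_integral 2 * pi * \<i> * cpd j H z) {0..2*pi}"
    by (subst (asm) has_contour_integral_part_circlepath_iff) auto
  from has_integral_mult_right[OF this, of "1 / (2 * pi * \<i>)"]
  have "((\<lambda>t. 1 / (2 * pi) * (?f (\<rho> * cis t) / (\<rho> * cis t))) has_integral cpd j H z) {0..2*pi}"
    using \<rho>(1) by (simp add: field_simps power2_eq_square)
  from integral_unique[OF this, unfolded integral_mult_right] show ?thesis by simp
qed

text \<open>Halving the radius lets one circle radius serve every centre near \<open>z0\<close>, so
  the integration domain is independent of the parameter.\<close>

lemma holo_several_cball_translate:
  assumes "cball z0 (2 * \<rho>) \<subseteq> D" "z \<in> ball z0 \<rho>" "0 < \<rho>"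
  shows "z + axis j (of_real \<rho> * cis t) \<in> D" "cball z \<rho> \<subseteq> D"
proof -
  show sub: "cball z \<rho> \<subseteq> D"
  proof
    fix w assume "w \<in> cball z \<rho>"
    then have "dist z0 w \<le> 2 * \<rho>" using dist_triangle[of z0 w z] assms(2) by simp
    then show "w \<in> D" using assms(1) by auto
  qed
  have "z + axis j (of_real \<rho> * cis t) \<in> cball z \<rho>"
    using assms(3) by (simp add: dist_norm norm_axis_complex norm_mult)
  with sub show "z + axis j (of_real \<rho> * cis t) \<in> D" by blast
qed

lemma continuous_on_circle_translate:
  "continuous_on A (\<lambda>x :: (complex^'m::finite) \<times> real. fst x + axis j (of_real \<rho> * cis (snd x)))"
proof -
  have "continuous_on A (\<lambda>x :: (complex^'m) \<times> real. axis j (of_real \<rho> * cis (snd x)) :: complex^'m)"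
    by (rule bounded_linear.continuous_on[OF bounded_linear_axis])
      (auto simp: cis_conv_exp intro!: continuous_intros)
  then show ?thesis by (intro continuous_intros)
qed

text \<open>\<open>holo_several\<close> asks only for pointwise differentiability. Continuity of the
  partial derivatives comes from the Cauchy integral and is what the Leibniz rule needs
  next.\<close>

lemma cpd_continuous:
  fixes H :: "complex^'m::finite \<Rightarrow> complex"
  assumes H: "holo_several H D"
  shows "continuous_on D (cpd j H)"
proof -
  have "isCont (cpd j H) z0" if "z0 \<in> D" for z0
  proof -
    have "open D" using H by (simp add: holo_several_def)
    from bspec[OF iffD1[OF open_contains_cball this] that] obtain e where e: "0 < e" "cball z0 e \<subseteq> D" by blast
    define \<rho> where "\<rho> = e / 2"
    have \<rho>: "0 < \<rho>" "cball z0 (2 * \<rho>) \<subseteq> D" using e by (simp_all add: \<rho>_def)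
    note tr = holo_several_cball_translate[OF \<rho>(2) _ \<rho>(1)]
    have "continuous_on (ball z0 \<rho> \<times> cbox 0 (2*pi)) (\<lambda>x. H (fst x + axis j (of_real \<rho> * cis (snd x))))"
      by (rule continuous_on_compose2[OF holo_several_continuous[OF H] continuous_on_circle_translate])
        (use tr(1) in auto)
    then have "continuous_on (ball z0 \<rho> \<times> cbox 0 (2*pi))
        (\<lambda>x. H (fst x + axis j (of_real \<rho> * cis (snd x))) / (of_real \<rho> * cis (snd x)))"
      using \<rho>(1) by (intro continuous_intros) (auto simp: cis_conv_exp intro!: continuous_intros)
    then have "continuous_on (ball z0 \<rho>)
        (\<lambda>z. integral (cbox 0 (2*pi)) (\<lambda>t. H (z + axis j (of_real \<rho> * cis t)) / (of_real \<rho> * cis t)))"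
      by (intro integral_continuous_on_param) (simp add: case_prod_beta')
    then have "continuous_on (ball z0 \<rho>) (\<lambda>z. (1 / of_real (2 * pi)) *
        integral {0..2*pi} (\<lambda>t. H (z + axis j (of_real \<rho> * cis t)) / (of_real \<rho> * cis t)))"
      by (intro continuous_intros) simp
    then have "continuous_on (ball z0 \<rho>) (cpd j H)"
      by (rule continuous_on_eq) (use cpd_circle_integral[OF H \<rho>(1)] tr(2) in auto)
    then show ?thesis using \<rho>(1) by (simp add: continuous_on_eq_continuous_at)
  qed
  then show ?thesis by (simp add: continuous_at_imp_continuous_on)
qed

lemma integrable_on_cbox_slice:
  fixes F :: "'a::topological_space \<Rightarrow> 'b::euclidean_space \<Rightarrow> 'c::banach"
  assumes F: "continuous_on (U \<times> cbox a b) (\<lambda>(x, t). F x t)" and x: "x \<in> U"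
  shows "F x integrable_on cbox a b"
proof -
  have "continuous_on (cbox a b) (\<lambda>t. (\<lambda>(x, t). F x t) (x, t))"
    by (rule continuous_on_compose2[OF F]) (use x in \<open>auto intro!: continuous_intros\<close>)
  then show ?thesis by (intro integrable_continuous) simp
qed

text \<open>Differentiate the Cauchy integral under the integral sign. The differential of the
  integrand is complex-linear for each \<open>t\<close>, and integration preserves this.\<close>

lemma holo_several_cpd:
  fixes H :: "complex^'m::finite \<Rightarrow> complex"
  assumes H: "holo_several H D"
  shows "holo_several (cpd j H) D"
  unfolding holo_several_def
proof (intro conjI ballI)
  show "open D" using H by (simp add: holo_several_def)
  fix z0 assume z0: "z0 \<in> D"
  from bspec[OF iffD1[OF open_contains_cball \<open>open D\<close>] z0] obtain e where e: "0 < e" "cball z0 e \<subseteq> D" by blast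
  define \<rho> where "\<rho> = e / 2"
  have \<rho>: "0 < \<rho>" "cball z0 (2 * \<rho>) \<subseteq> D" using e by (simp_all add: \<rho>_def)
  note tr = holo_several_cball_translate[OF \<rho>(2) _ \<rho>(1)]
  define G where "G z t = H (z + axis j (of_real \<rho> * cis t)) / (of_real \<rho> * cis t)" for z t
  \<comment> \<open>The Leibniz rule for Frechet derivatives wants a continuous family of bounded
    linear maps, hence the type of bounded linear functions.\<close>
  define dG :: "complex^'m \<Rightarrow> real \<Rightarrow> (complex^'m) \<Rightarrow>\<^sub>L complex"
    where "dG z t = (\<Sum>k\<in>UNIV. blinfun_mult_right (cpd k H (z + axis j (of_real \<rho> * cis t)) / (of_real \<rho> * cis t)) o\<^sub>L Blinfun (\<lambda>v. v $ k))" for z t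
  have dG: "blinfun_apply (dG z t) v = (\<Sum>k\<in>UNIV. v $ k * cpd k H (z + axis j (of_real \<rho> * cis t))) / (of_real \<rho> * cis t)" for z t v
    by (simp add: dG_def blinfun.sum_left bounded_linear_Blinfun_apply bounded_linear_vec_nth sum_divide_distrib mult.commute)
  have cont: "continuous_on (ball z0 \<rho> \<times> cbox 0 (2*pi)) (\<lambda>x. g (fst x + axis j (of_real \<rho> * cis (snd x))) / (of_real \<rho> * cis (snd x)))"
    if "continuous_on D g" for g :: "complex^'m \<Rightarrow> complex"
  proof -
    have "continuous_on (ball z0 \<rho> \<times> cbox 0 (2*pi)) (\<lambda>x. g (fst x + axis j (of_real \<rho> * cis (snd x))))"
      by (rule continuous_on_compose2[OF that continuous_on_circle_translate]) (use tr(1) in auto)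
    then show ?thesis
      using \<rho>(1) by (intro continuous_intros) (auto simp: cis_conv_exp intro!: continuous_intros)
  qed
  have cG: "G z integrable_on cbox 0 (2*pi)" if "z \<in> ball z0 \<rho>" for z
    using cont[OF holo_several_continuous[OF H]] that unfolding G_def
    by (intro integrable_on_cbox_slice[of "ball z0 \<rho>"]) (simp_all add: case_prod_beta')
  have cdG: "continuous_on (ball z0 \<rho> \<times> cbox 0 (2*pi)) (\<lambda>(z, t). dG z t)"
    unfolding dG_def case_prod_beta'
    by (intro continuous_intros bounded_linear.continuous_on[OF bounded_linear_blinfun_mult_right] cont cpd_continuous[OF H])
  have z0b: "z0 \<in> ball z0 \<rho>" using \<rho> by simp
  have int_dG: "dG z0 integrable_on cbox 0 (2*pi)"
    by (rule integrable_on_cbox_slice[OF cdG z0b])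
  have "((\<lambda>z. integral (cbox 0 (2*pi)) (G z)) has_derivative integral (cbox 0 (2*pi)) (dG z0)) (at z0 within ball z0 \<rho>)"
  proof (rule leibniz_rule[OF _ cG cdG z0b convex_ball])
    fix z t assume z: "z \<in> ball z0 \<rho>"
    have "((\<lambda>z. z + axis j (of_real \<rho> * cis t)) has_derivative (\<lambda>v. v)) (at z)"
      by (auto intro!: derivative_eq_intros)
    from has_derivative_compose[OF this holo_several_has_derivative[OF H tr(1)[OF z]]]
    have "((\<lambda>z. H (z + axis j (of_real \<rho> * cis t))) has_derivative
       (\<lambda>v. \<Sum>k\<in>UNIV. v $ k * cpd k H (z + axis j (of_real \<rho> * cis t)))) (at z)" .
    from has_derivative_mult_left[OF this, of "1 / (of_real \<rho> * cis t)"]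
    have "(G_z has_derivative blinfun_apply (dG z t)) (at z)" if "G_z = (\<lambda>z. G z t)" for G_z
      unfolding that G_def dG[abs_def] by simp
    then show "((\<lambda>z. G z t) has_derivative blinfun_apply (dG z t)) (at z within ball z0 \<rho>)"
      by (simp add: has_derivative_at_withinI)
  qed
  then have "((\<lambda>z. integral (cbox 0 (2*pi)) (G z)) has_derivative integral (cbox 0 (2*pi)) (dG z0)) (at z0)"
    unfolding at_within_open[OF z0b open_ball] .
  from has_derivative_mult_right[OF this, of "1 / of_real (2 * pi)"]
  have "((\<lambda>z. (1 / of_real (2 * pi)) * integral (cbox 0 (2*pi)) (G z)) has_derivative
      (\<lambda>v. (1 / of_real (2 * pi)) * integral (cbox 0 (2*pi)) (dG z0) v)) (at z0)" .
  then have "(cpd j H has_derivative (\<lambda>v. (1 / of_real (2 * pi)) * integral (cbox 0 (2*pi)) (dG z0) v)) (at z0)"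
  proof (rule has_derivative_transform_within_open[OF _ open_ball z0b])
    fix z assume "z \<in> ball z0 \<rho>"
    then show "(1 / of_real (2 * pi)) * integral (cbox 0 (2*pi)) (G z) = cpd j H z"
      unfolding G_def using cpd_circle_integral[OF H \<rho>(1) tr(2), of z j] by simp
  qed
  moreover have "integral (cbox 0 (2*pi)) (dG z0) (\<chi> k. \<i> * v $ k) = \<i> * integral (cbox 0 (2*pi)) (dG z0) v" for v
  proof -
    have "blinfun_apply (dG z0 t) (\<chi> k. \<i> * v $ k) = \<i> * blinfun_apply (dG z0 t) v" for t
      by (simp add: dG sum_distrib_left mult.assoc)
    then show ?thesis unfolding blinfun_apply_integral[OF int_dG] by simp
  qed
  ultimately show "\<exists>L. (cpd j H has_derivative L) (at z0) \<and> (\<forall>v. L (\<chi> j. \<i> * v $ j) = \<i> * L v)"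
    by (intro exI conjI) (assumption, simp)
qed

lemma holo_several_sum:
  fixes G :: "'i \<Rightarrow> complex^'m::finite \<Rightarrow> complex"
  assumes "\<And>i. i \<in> I \<Longrightarrow> holo_several (G i) D" "open D"
  shows "holo_several (\<lambda>z. \<Sum>i\<in>I. G i z) D"
  unfolding holo_several_def
proof (intro conjI ballI assms(2))
  fix z assume z: "z \<in> D"
  have "((\<lambda>z. \<Sum>i\<in>I. G i z) has_derivative (\<lambda>v. \<Sum>i\<in>I. \<Sum>j\<in>UNIV. v $ j * cpd j (G i) z)) (at z)"
    by (intro has_derivative_sum holo_several_has_derivative[OF assms(1) z])
  moreover have "(\<Sum>i\<in>I. \<Sum>j\<in>UNIV. (\<chi> j. \<i> * v $ j) $ j * cpd j (G i) z) = \<i> * (\<Sum>i\<in>I. \<Sum>j\<in>UNIV. v $ j * cpd j (G i) z)" for v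
    by (simp add: sum_distrib_left mult.assoc)
  ultimately show "\<exists>L. ((\<lambda>z. \<Sum>i\<in>I. G i z) has_derivative L) (at z) \<and> (\<forall>v. L (\<chi> j. \<i> * v $ j) = \<i> * L v)"
    by blast
qed

text \<open>The one-variable identity theorem on the part of the complex line inside the ball. This
  part is convex, hence connected, and the real parameters near 0 accumulate at 0.\<close>

lemma holo_several_zero_on_line:
  fixes G :: "complex^'m::finite \<Rightarrow> complex"
  assumes G: "holo_several G D" and R: "ball p R \<subseteq> D" and z: "z \<in> ball p R" "z + \<tau> *s v \<in> ball p R"
    and \<delta>: "0 < \<delta>" "\<And>s::real. \<bar>s\<bar> < \<delta> \<Longrightarrow> G (z + of_real s *s v) = 0"
  shows "G (z + \<tau> *s v) = 0"
proof -
  let ?S = "{t. z + t *s v \<in> ball p R}"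
  have cont: "continuous_on A (\<lambda>t. z + t *s v)" for A
    by (intro continuous_intros bounded_linear.continuous_on[OF bounded_linear_vector_scalar_mult_left])
  have opS: "open ?S"
    using continuous_open_preimage[OF cont open_UNIV open_ball, of p R] by (simp add: vimage_def)
  have "convex ?S"
  proof (rule convexI)
    fix s t :: complex and a b :: real
    assume st: "s \<in> ?S" "t \<in> ?S" and ab: "0 \<le> a" "0 \<le> b" "a + b = 1"
    have "z + (a *\<^sub>R s + b *\<^sub>R t) *s v = (a + b) *\<^sub>R z + (a *\<^sub>R s + b *\<^sub>R t) *s v" by (simp add: ab)
    also have "\<dots> = a *\<^sub>R (z + s *s v) + b *\<^sub>R (z + t *s v)"
      by (simp add: vec_eq_iff algebra_simps)
    also have "\<dots> \<in> ball p R" using st ab convexD[OF convex_ball] by blast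
    finally show "a *\<^sub>R s + b *\<^sub>R t \<in> ?S" by simp
  qed
  have hol: "(\<lambda>t. G (z + t *s v)) holomorphic_on ?S"
    unfolding holomorphic_on_def
  proof
    fix t assume "t \<in> ?S"
    then have "z + t *s v \<in> D" using R by blast
    from holo_several_line[OF G this] show "(\<lambda>t. G (z + t *s v)) field_differentiable at t within ?S"
      using field_differentiable_def field_differentiable_at_within by blast
  qed
  let ?U = "?S \<inter> of_real ` {s. \<bar>s\<bar> < \<delta>}"
  have "0 islimpt ?U"
    unfolding islimpt_approachable
  proof (intro allI impI)
    fix e :: real assume e: "0 < e"
    have "0 \<in> ?S" using z by simp
    from bspec[OF iffD1[OF open_contains_ball opS] this] obtain d where d: "0 < d" "ball 0 d \<subseteq> ?S" by blast
    define s where "s = min (min d e) \<delta> / 2"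
    have s: "0 < s" "s < d" "s < e" "s < \<delta>" using d e \<delta> by (auto simp: s_def)
    then have "complex_of_real s \<in> ?U" using d(2) by (auto simp: subset_iff)
    then show "\<exists>x'\<in>?U. x' \<noteq> 0 \<and> dist x' 0 < e" using s by (intro bexI[of _ "of_real s"]) auto
  qed
  then show ?thesis
    by (intro analytic_continuation[OF hol opS convex_connected[OF \<open>convex ?S\<close>], of ?U 0 \<tau>])
      (use z \<delta>(2) in auto)
qed

text \<open>The slice \<open>z0 + c \<real>\<^sup>m\<close> is totally real of maximal dimension: every point near \<open>z0\<close> lies on a
  complex line meeting the slice in a real line.\<close>
lemma holo_several_identity:
  fixes G :: "complex^'m::finite \<Rightarrow> complex"
  assumes G: "holo_several G D" and conn: "connected D" and z0: "z0 \<in> D" and c: "c \<noteq> 0" and \<epsilon>: "0 < \<epsilon>"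
    and zero: "\<And>x. norm x < \<epsilon> \<Longrightarrow> G (z0 + c *s realvec x) = 0"
    and z: "z \<in> D"
  shows "G z = 0"
proof -
  have opD: "open D" using G by (simp add: holo_several_def)
  have realvec_add: "realvec (a + s *\<^sub>R b) = realvec a + of_real s *s realvec b" for a b :: "real^'m" and s
    by (simp add: realvec_def vec_eq_iff)
  have norm_realvec: "norm (realvec a) = norm a" for a :: "real^'m"
    by (simp add: realvec_def norm_vec_def L2_set_def)
  \<comment> \<open>The set of points with a neighbourhood of zeros. Once it is shown to be
    nonempty, open and relatively closed, connectedness of \<open>D\<close> finishes the
    proof.\<close>
  define Z where "Z = {p \<in> D. \<exists>r>0. \<forall>w\<in>ball p r. G w = 0}"
  have Z1: "z0 \<in> Z"
  proof -
    from bspec[OF iffD1[OF open_contains_ball opD] z0] obtain R where R: "0 < R" "ball z0 R \<subseteq> D" by blast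
    \<comment> \<open>The bound by \<open>norm c * \<epsilon> / 2\<close> makes the real and
      imaginary parts \<open>a\<close> and \<open>b\<close> below shorter than
      \<open>\<epsilon> / 2\<close>, so \<open>a + s *\<^sub>R b\<close> stays in the zero region
      for \<open>\<bar>s\<bar> < 1\<close>.\<close>
    define \<eta> where "\<eta> = min R (norm c * \<epsilon> / 2)"
    have \<eta>: "0 < \<eta>" "\<eta> \<le> R" "\<eta> \<le> norm c * \<epsilon> / 2" using R c \<epsilon> by (auto simp: \<eta>_def)
    have "G w = 0" if w: "w \<in> ball z0 \<eta>" for w
    proof -
      \<comment> \<open>In the coordinates of the slice \<open>u\<close> is
        \<open>a + \<i> b\<close>. The complex line through \<open>z0 + c a\<close> in direction
        \<open>c b\<close> meets the slice at real parameters and reaches \<open>w\<close> at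
        parameter \<i>.\<close>
      define u where "u = inverse c *s (w - z0)"
      define a :: "real^'m" where "a = (\<chi> j. Re (u $ j))"
      define b :: "real^'m" where "b = (\<chi> j. Im (u $ j))"
      have cu: "norm c * norm u = norm (w - z0)"
        using c unfolding u_def norm_vector_scalar_mult norm_inverse by simp
      have ab: "norm a \<le> norm u" "norm b \<le> norm u"
        unfolding a_def b_def norm_vec_def by (auto intro!: L2_set_mono abs_Re_le_cmod abs_Im_le_cmod)
      have wn: "norm (w - z0) < \<eta>" using w by (simp add: dist_norm norm_minus_commute)
      have "norm c * norm u < norm c * (\<epsilon> / 2)" using cu wn \<eta>(3) by simp
      then have u\<epsilon>: "norm u < \<epsilon> / 2" using c by simp
      have w_eq: "w = z0 + c *s realvec a + \<i> *s (c *s realvec b)"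
      proof -
        have "realvec a + \<i> *s realvec b = u"
          by (simp add: realvec_def a_def b_def vec_eq_iff flip: complex_eq)
        then have "c *s (realvec a + \<i> *s realvec b) = w - z0"
          using c by (simp only: u_def vector_smult_assoc) simp
        then show ?thesis by (simp add: vec_eq_iff algebra_simps)
      qed
      have "G (z0 + c *s realvec a + \<i> *s (c *s realvec b)) = 0"
      proof (rule holo_several_zero_on_line[OF G R(2)])
        have "norm c * norm a \<le> norm c * norm u" using ab(1) by (intro mult_left_mono) auto
        then have "norm (c *s realvec a) < R"
          using cu wn \<eta>(2) by (simp add: norm_vector_scalar_mult norm_realvec)
        then show "z0 + c *s realvec a \<in> ball z0 R" by (simp add: dist_norm)
        show "z0 + c *s realvec a + \<i> *s (c *s realvec b) \<in> ball z0 R"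
          using w \<eta>(2) unfolding w_eq[symmetric] by simp
        show "0 < (1::real)" by simp
        fix s :: real assume s: "\<bar>s\<bar> < 1"
        have "norm (a + s *\<^sub>R b) \<le> norm a + \<bar>s\<bar> * norm b" by (rule norm_triangle_le) simp
        also have "\<bar>s\<bar> * norm b \<le> 1 * norm b" using s by (intro mult_right_mono) auto
        finally have "norm (a + s *\<^sub>R b) < \<epsilon>" using ab u\<epsilon> by linarith
        from zero[OF this] show "G (z0 + c *s realvec a + of_real s *s (c *s realvec b)) = 0"
          by (simp add: realvec_add vector_add_ldistrib vector_smult_assoc mult.commute add.assoc)
      qed
      then show ?thesis unfolding w_eq .
    qed
    then show ?thesis using z0 \<eta>(1) unfolding Z_def by blast
  qed
  \<comment> \<open>Zeros spread from a small ball around \<open>q\<close> along complex lines to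
    every point of a ball of \<open>D\<close> that contains \<open>q\<close>. This gives both
    openness of \<open>Z\<close> and openness of its complement in \<open>D\<close>.\<close>
  have absorb: "p \<in> Z" if R: "0 < R" "ball p R \<subseteq> D" and q: "q \<in> Z" "q \<in> ball p R" for p q R
  proof -
    obtain r where r: "0 < r" "\<And>w. w \<in> ball q r \<Longrightarrow> G w = 0" using q(1) unfolding Z_def by blast
    have "G w = 0" if w: "w \<in> ball p R" for w
    proof -
      have "G (q + 1 *s (w - q)) = 0"
      proof (rule holo_several_zero_on_line[OF G R(2) q(2)])
        show "q + 1 *s (w - q) \<in> ball p R" using w by simp
        \<comment> \<open>Adding 1 covers the case \<open>w = q\<close>.\<close>
        show "0 < r / (norm (w - q) + 1)" using r(1) norm_ge_zero[of "w - q"] by (simp add: add_nonneg_pos)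
        fix s :: real assume s: "\<bar>s\<bar> < r / (norm (w - q) + 1)"
        have pos: "0 < norm (w - q) + 1" using norm_ge_zero[of "w - q"] by linarith
        have "\<bar>s\<bar> * norm (w - q) \<le> \<bar>s\<bar> * (norm (w - q) + 1)" by (simp add: distrib_left)
        also have "\<dots> < r" using s pos by (simp add: field_simps)
        finally have "norm (of_real s *s (w - q)) < r" unfolding norm_vector_scalar_mult by simp
        then show "G (q + of_real s *s (w - q)) = 0" by (intro r(2)) (simp add: dist_norm del: vector_ssub_ldistrib)
      qed
      then show ?thesis by simp
    qed
    moreover have "p \<in> D" using R by auto
    ultimately show ?thesis using R(1) unfolding Z_def by blast
  qed
  have "open Z"
    unfolding open_contains_ball
  proof
    fix p assume p: "p \<in> Z"
    then have "p \<in> D" by (simp add: Z_def)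
    from bspec[OF iffD1[OF open_contains_ball opD] this] obtain R where R: "0 < R" "ball p R \<subseteq> D" by blast
    have "ball p (R / 2) \<subseteq> Z"
    proof
      fix q assume q: "q \<in> ball p (R / 2)"
      have "ball q (R / 2) \<subseteq> ball p R"
      proof
        fix x assume "x \<in> ball q (R / 2)"
        then show "x \<in> ball p R" using q dist_triangle[of p x q] by simp
      qed
      then show "q \<in> Z" using absorb[of "R / 2" q p] R p q by (auto simp: dist_commute)
    qed
    then show "\<exists>e>0. ball p e \<subseteq> Z" using R(1) by (intro exI[of _ "R / 2"]) simp
  qed
  moreover have "open (D - Z)"
    unfolding open_contains_ball
  proof
    fix p assume p: "p \<in> D - Z"
    then have "p \<in> D" by simp
    from bspec[OF iffD1[OF open_contains_ball opD] this] obtain R where R: "0 < R" "ball p R \<subseteq> D" by blast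
    have "ball p R \<subseteq> D - Z" using absorb[OF R] R(2) p by blast
    then show "\<exists>e>0. ball p e \<subseteq> D - Z" using R(1) by blast
  qed
  ultimately have "Z \<inter> D = {} \<or> (D - Z) \<inter> D = {}"
    using connectedD[OF conn, of Z "D - Z"] by blast
  then have "z \<in> Z" using Z1 z0 z by blast
  then show "G z = 0" unfolding Z_def by force
qed

subsection \<open>Analytic extensions of harmonic functions\<close>

lemma realvec_line: "realvec (x + t *\<^sub>R axis j 1) = realvec x + of_real t *s axis j (1::complex)"
  by (simp add: realvec_def vec_eq_iff axis_def)

lemma bounded_linear_realvec: "bounded_linear (realvec :: real^'m::finite \<Rightarrow> complex^'m)"
  by (rule bounded_linear_intro[of _ 1])
    (auto simp: realvec_def vec_eq_iff norm_vec_def L2_set_def complex_eq_iff)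

lemma open_realvec_vimage:
  assumes "open (D :: (complex^'m::finite) set)"
  shows "open {x. realvec x \<in> D}"
  using open_vimage[OF assms linear_continuous_on[OF bounded_linear_realvec]] by (simp only: vimage_def)

text \<open>Agreement with \<open>H\<close> is required only on the part of the real slice inside
  \<open>D\<close>, so the lemma applies a second time with \<open>pd j f\<close> in place of
  \<open>f\<close>.\<close>

lemma pd_holo_several_slice:
  fixes H :: "complex^'m::finite \<Rightarrow> complex"
  assumes H: "holo_several H D" and x: "realvec x \<in> D"
    and f: "\<And>y. realvec y \<in> D \<Longrightarrow> f y = H (realvec y)"
  shows "pd j f x = cpd j H (realvec x)"
proof -
  have "realvec x + of_real 0 *s axis j (1::complex) \<in> D" using x by simp
  from has_vector_derivative_real_field[OF holo_several_line[OF H this], of UNIV]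
  have "((\<lambda>t. H (realvec x + of_real t *s axis j 1)) has_vector_derivative cpd j H (realvec x)) (at 0)"
    by (simp add: axis_def if_distrib if_distribR cong: if_cong)
  moreover have "\<forall>\<^sub>F t in nhds 0. f (x + t *\<^sub>R axis j 1) = H (realvec x + of_real t *s axis j 1)"
  proof -
    have "open D" using H by (simp add: holo_several_def)
    from line_eventually_in[OF open_realvec_vimage[OF this], of x "axis j 1"] x
    have "\<forall>\<^sub>F t in nhds (0::real). x + t *\<^sub>R axis j 1 \<in> {x. realvec x \<in> D}" by simp
    then show ?thesis by (rule eventually_mono) (simp add: f realvec_line)
  qed
  ultimately have "((\<lambda>t. f (x + t *\<^sub>R axis j 1)) has_vector_derivative cpd j H (realvec x)) (at 0)"
    by (rule has_vector_derivative_transform_nhds)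
  then show ?thesis unfolding pd_def by (rule vector_derivative_at)
qed

lemma tau_loc_id:
  fixes h :: "real^'m::finite \<Rightarrow> complex"
  shows "tau_loc id h x = (\<Sum>i\<in>UNIV. pd i (pd i h) x)"
proof -
  have pdid: "pd i id y = axis i 1" for i and y :: "real^'m"
  proof -
    have "((\<lambda>t. y + t *\<^sub>R axis i (1::real)) has_vector_derivative axis i 1) (at 0)"
      by (auto intro!: derivative_eq_intros)
    then show ?thesis unfolding pd_def id_def by (rule vector_derivative_at)
  qed
  have metric: "metric_coeff id y = mat 1" for y :: "real^'m"
    unfolding metric_coeff_def pdid by (simp add: mat_def vec_eq_iff inner_axis_axis)
  have inv: "matrix_inv (mat 1 :: real^'m^'m) = mat 1"
    using matrix_inv_left[of "mat 1 :: real^'m^'m"] by (simp add: invertible_det_nz)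
  have zero: "pd j (\<lambda>_. 0 :: complex) x = 0" for j and x :: "real^'m" by (simp add: pd_def)
  have "tau_loc id h x = (\<Sum>i\<in>UNIV. \<Sum>j\<in>UNIV. if i = j then pd j (pd i h) x else 0)"
    unfolding tau_loc_def metric inv det_I real_sqrt_one by (intro sum.cong refl) (simp add: mat_def zero)
  then show ?thesis by simp
qed

text \<open>The complexified Laplacian of \<open>H\<close> is holomorphic and vanishes on a real
  neighbourhood of \<open>x0\<close>, where it is the Laplacian of \<open>h\<close>. The identity
  theorem with \<open>c = 1\<close> spreads this over \<open>D\<close>.\<close>

lemma harmonic_extension_laplacian:
  fixes H :: "complex^'m::finite \<Rightarrow> complex"
  assumes harm: "eucl_harmonic h" and H: "holo_several H D" "connected D"
    and x0: "realvec x0 \<in> D" and ext: "\<And>x. realvec x \<in> D \<Longrightarrow> H (realvec x) = h x"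
    and z: "z \<in> D"
  shows "(\<Sum>j\<in>UNIV. cpd j (cpd j H) z) = 0"
proof -
  have opD: "open D" using H by (simp add: holo_several_def)
  have slice: "(\<Sum>j\<in>UNIV. cpd j (cpd j H) (realvec x)) = 0" if x: "realvec x \<in> D" for x
  proof -
    have "pd j h y = cpd j H (realvec y)" if "realvec y \<in> D" for j y
      by (rule pd_holo_several_slice[OF H(1) that]) (simp add: ext)
    then have "pd j (pd j h) x = cpd j (cpd j H) (realvec x)" for j
      by (rule pd_holo_several_slice[OF holo_several_cpd[OF H(1)] x])
    then show ?thesis using harm tau_loc_id[of h x] unfolding eucl_harmonic_def by simp
  qed
  from bspec[OF iffD1[OF open_contains_ball open_realvec_vimage[OF opD]], of x0] x0
  obtain \<epsilon> where \<epsilon>: "0 < \<epsilon>" "ball x0 \<epsilon> \<subseteq> {x. realvec x \<in> D}" by auto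
  show ?thesis
  proof (rule holo_several_identity[OF holo_several_sum[OF holo_several_cpd[OF holo_several_cpd[OF H(1)]] opD] H(2) x0 _ \<epsilon>(1) _ z])
    show "(1::complex) \<noteq> 0" by simp
    fix x :: "real^'m" assume "norm x < \<epsilon>"
    then have "x0 + x \<in> ball x0 \<epsilon>" by (simp add: dist_norm)
    then have "realvec (x0 + x) \<in> D" using \<epsilon>(2) by auto
    moreover have "realvec (x0 + x) = realvec x0 + 1 *s realvec x" by (simp add: realvec_def vec_eq_iff)
    ultimately show "(\<Sum>j\<in>UNIV. cpd j (cpd j H) (realvec x0 + 1 *s realvec x)) = 0" using slice by metis
  qed
qed

lemma eucl_harmonic_zero_on_ball:
  fixes h :: "real^'m::finite \<Rightarrow> complex"
  assumes harm: "eucl_harmonic h" and \<epsilon>: "0 < \<epsilon>" "\<And>x. norm x < \<epsilon> \<Longrightarrow> h (x0 + x) = 0"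
  shows "h y = 0"
proof -
  have C2: "Ck_on 2 UNIV h" and lap: "(\<Sum>i\<in>UNIV. pd i (pd i h) x) = 0" for x
    using harm tau_loc_id[of h x] by (auto simp: eucl_harmonic_def)
  \<comment> \<open>Real and imaginary parts are handled together by a bounded real-linear
    functional; translation by \<open>x0\<close> moves the ball to the origin.\<close>
  have part: "l (h y) = 0" if l: "bounded_linear l" for l :: "complex \<Rightarrow> real"
  proof -
    note lin = bounded_linear.linear[OF l]
    note bl = bounded_linear.has_vector_derivative[OF l] bounded_linear.continuous_on[OF l]
    have tr: "continuous_on UNIV (\<lambda>x. f (x0 + x))" if "continuous_on UNIV f" for f :: "real^'m \<Rightarrow> complex"
      by (rule continuous_on_compose2[OF that]) (auto intro!: continuous_intros)
    have "(\<lambda>x. l (h (x0 + x))) (y - x0) = 0"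
    proof (rule harmonic_zero_near_0_imp_zero[where h = "\<lambda>x. l (h (x0 + x))" and ?h1.0 = "\<lambda>i x. l (pd i h (x0 + x))"
          and ?h2.0 = "\<lambda>i x. l (pd i (pd i h) (x0 + x))" and \<epsilon> = \<epsilon>])
      show "((\<lambda>t. l (h (x0 + (x + t *\<^sub>R axis i 1)))) has_real_derivative l (pd i h (x0 + x))) (at 0)" for i x
        unfolding has_real_derivative_iff_has_vector_derivative
        using bl(1)[OF Ck_on_line_derivative[OF C2, of "x0 + x" i]] by (simp add: add.assoc)
      show "((\<lambda>t. l (pd i h (x0 + (x + t *\<^sub>R axis i 1)))) has_real_derivative l (pd i (pd i h) (x0 + x))) (at 0)" for i x
        unfolding has_real_derivative_iff_has_vector_derivative
        using bl(1)[OF Ck_on_line_derivative2[OF C2, of "x0 + x" i i]] by (simp add: add.assoc)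
      show "continuous_on UNIV (\<lambda>x. l (h (x0 + x)))"
        by (rule bl(2)[OF tr[OF Ck_on_continuous[OF C2]]])
      show "continuous_on UNIV (\<lambda>x. l (pd i h (x0 + x)))" for i
        by (rule bl(2)[OF tr[OF Ck_on_continuous1[OF C2]]]) simp
      show "continuous_on UNIV (\<lambda>x. l (pd i (pd i h) (x0 + x)))" for i
        by (rule bl(2)[OF tr[OF Ck_on_continuous2[OF C2]]]) simp
      show "(\<Sum>i\<in>UNIV. l (pd i (pd i h) (x0 + x))) = 0" for x
        using lap[of "x0 + x"] by (simp add: linear_sum[OF lin, symmetric] linear_0[OF lin])
      show "l (h (x0 + x)) = 0" if "norm x < \<epsilon>" for x
        using \<epsilon>(2)[OF that] by (simp add: linear_0[OF lin])
    qed (use \<epsilon> in auto)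
    then show ?thesis by simp
  qed
  have "Re (h y) = 0" "Im (h y) = 0" using part bounded_linear_Re bounded_linear_Im by blast+
  then show ?thesis by (simp add: complex_eq_iff)
qed

text \<open>Vanishing on a piece of any rotated slice makes \<open>H\<close> vanish on
  \<open>D\<close>, hence \<open>h\<close> near \<open>x0\<close>. As \<open>H\<close> extends
  \<open>h\<close> only locally, unique continuation for \<open>h\<close> itself is needed to
  conclude that \<open>h\<close> is constant.\<close>

lemma harmonic_extension_nonzero_on_slice:
  fixes H :: "complex^'m::finite \<Rightarrow> complex"
  assumes harm: "eucl_harmonic h" and noncst: "\<not> (\<exists>c. \<forall>x. h x = c)" and H: "holo_several H D" "connected D"
    and x0: "realvec x0 \<in> D" and ext: "\<And>x. realvec x \<in> D \<Longrightarrow> H (realvec x) = h x"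
    and z: "z \<in> D" "c \<noteq> 0" "0 < \<epsilon>"
  shows "\<exists>x. norm x < \<epsilon> \<and> H (z + c *s realvec x) \<noteq> 0"
proof (rule ccontr)
  assume "\<not> ?thesis"
  then have "H (z + c *s realvec x) = 0" if "norm x < \<epsilon>" for x using that by blast
  then have H0: "H w = 0" if "w \<in> D" for w
    using holo_several_identity[OF H z _ that] by blast
  have opD: "open D" using H by (simp add: holo_several_def)
  from bspec[OF iffD1[OF open_contains_ball open_realvec_vimage[OF opD]], of x0] x0
  obtain \<delta> where \<delta>: "0 < \<delta>" "ball x0 \<delta> \<subseteq> {x. realvec x \<in> D}" by auto
  have "h (x0 + x) = 0" if "norm x < \<delta>" for x
  proof -
    have "x0 + x \<in> ball x0 \<delta>" using that by (simp add: dist_norm)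
    then have "realvec (x0 + x) \<in> D" using \<delta>(2) by auto
    then show ?thesis using ext H0 by metis
  qed
  then have "h y = 0" for y by (rule eucl_harmonic_zero_on_ball[OF harm \<delta>(1)])
  with noncst show False by blast
qed

subsection \<open>The radial operator\<close>

text \<open>In terms of \<open>\<theta> = z d/dz\<close> this is \<open>c \<theta> - \<theta>\<^sup>2\<close>.\<close>
definition radial_op :: "complex \<Rightarrow> (complex \<Rightarrow> complex) \<Rightarrow> complex \<Rightarrow> complex" where
  "radial_op c P z = (c - 1) * z * deriv P z - z\<^sup>2 * deriv (deriv P) z"

lemma radial_op_holomorphic:
  assumes "open D" "P holomorphic_on D"
  shows "(radial_op c ^^ k) P holomorphic_on D"
proof (induction k)
  case (Suc k)
  then show ?case
    unfolding funpow.simps o_def radial_op_def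
    by (intro holomorphic_intros holomorphic_deriv assms)
qed (simp add: assms)

text \<open>The exponents 0 and \<open>n\<close> are the roots of n s - s^2, the symbol of the
  radial operator in the variable log z. This is the space on which it acts with finite
  order.\<close>

definition log_poly :: "nat \<Rightarrow> complex poly \<Rightarrow> complex poly \<Rightarrow> complex \<Rightarrow> complex" where
  "log_poly n p q z = poly p (Ln z) + z ^ n * poly q (Ln z)"

text \<open>Apart from the factor 1/z, differentiation acts on the coefficient polynomials alone,
  sending p to p' and q to n q + q'.\<close>

lemma log_poly_has_field_derivative:
  assumes "z \<notin> \<real>\<^sub>\<le>\<^sub>0"
  shows "(log_poly n p q has_field_derivative
     log_poly n (pderiv p) (smult (of_nat n) q + pderiv q) z / z) (at z)"
proof -
  have z: "z \<noteq> 0" using assms by auto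
  have pl: "((\<lambda>z. poly s (Ln z)) has_field_derivative poly (pderiv s) (Ln z) * inverse z) (at z)" for s
    by (rule DERIV_chain2[OF poly_DERIV has_field_derivative_Ln[OF assms]])
  have "((\<lambda>z. z ^ n) has_field_derivative of_nat n * z ^ n / z) (at z)"
    by (rule DERIV_cong[OF DERIV_power[OF DERIV_ident]]) (use z in \<open>cases n; simp\<close>)
  from DERIV_add[OF pl[of p] DERIV_mult[OF this pl[of q]]]
  show ?thesis unfolding log_poly_def
    by (rule DERIV_cong) (simp add: field_simps add_divide_distrib)
qed

definition euler_op :: "complex \<Rightarrow> complex poly \<Rightarrow> complex poly" where
  "euler_op c p = smult c (pderiv p) - pderiv (pderiv p)"

text \<open>Moving z^n past \<theta> = z d/dz replaces \<theta> by \<theta> + n, and n (\<theta> +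
  n) - (\<theta> + n)^2 = - n \<theta> - \<theta>^2. Hence the same polynomial operator appears on
  \<open>q\<close> with the opposite sign of \<open>n\<close>.\<close>

lemma radial_op_log_poly:
  assumes S: "open S" "S \<inter> \<real>\<^sub>\<le>\<^sub>0 = {}" and P: "\<And>z. z \<in> S \<Longrightarrow> P z = log_poly n p q z" and z: "z \<in> S"
  shows "radial_op (of_nat n) P z = log_poly n (euler_op (of_nat n) p) (euler_op (- of_nat n) q) z"
proof -
  let ?n = "of_nat n :: complex"
  define q1 where "q1 = smult ?n q + pderiv q"
  define q2 where "q2 = smult ?n q1 + pderiv q1"
  let ?E1 = "log_poly n (pderiv p) q1"
  let ?E2 = "log_poly n (pderiv (pderiv p)) q2"
  have notin: "w \<notin> \<real>\<^sub>\<le>\<^sub>0" "w \<noteq> 0" if "w \<in> S" for w using S(2) that by auto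
  have d1: "deriv P w = ?E1 w / w" if w: "w \<in> S" for w
  proof (rule DERIV_imp_deriv)
    show "(P has_field_derivative ?E1 w / w) (at w)"
      using log_poly_has_field_derivative[OF notin(1)[OF w], of n p q] unfolding q1_def
      by (rule has_field_derivative_transform_within_open[OF _ S(1) w]) (simp add: P)
  qed
  have d2: "deriv (deriv P) z = (?E2 z / z * z - ?E1 z * 1) / (z * z)"
  proof (rule DERIV_imp_deriv)
    have "((\<lambda>w. ?E1 w / w) has_field_derivative (?E2 z / z * z - ?E1 z * 1) / (z * z)) (at z)"
      unfolding q2_def by (rule DERIV_divide[OF log_poly_has_field_derivative[OF notin(1)[OF z]] DERIV_ident notin(2)[OF z]])
    then show "(deriv P has_field_derivative (?E2 z / z * z - ?E1 z * 1) / (z * z)) (at z)"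
      by (rule has_field_derivative_transform_within_open[OF _ S(1) z]) (simp add: d1)
  qed
  have "radial_op ?n P z = ?n * ?E1 z - ?E2 z"
    unfolding radial_op_def d2 d1[OF z] using notin(2)[OF z] by (simp add: field_simps power2_eq_square)
  also have "\<dots> = log_poly n (smult ?n (pderiv p) - pderiv (pderiv p)) (smult ?n q1 - q2) z"
    by (simp add: log_poly_def algebra_simps)
  also have "smult ?n q1 - q2 = euler_op (- ?n) q"
    by (simp add: q2_def q1_def euler_op_def pderiv_add pderiv_smult)
  finally show ?thesis by (simp add: euler_op_def)
qed

text \<open>For \<open>c \<noteq> 0\<close> the first derivative dominates the second, and in
  characteristic 0 it lowers the degree by exactly one.\<close>

lemma euler_op_degree:
  assumes "c \<noteq> 0" "0 < degree p"
  shows "euler_op c p \<noteq> 0" "degree (euler_op c p) = degree p - 1"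
proof -
  have p': "degree (smult c (pderiv p)) = degree p - 1" "smult c (pderiv p) \<noteq> 0"
    using assms by (auto simp: degree_pderiv pderiv_eq_0_iff)
  have "pderiv (pderiv p) = 0 \<or> degree (pderiv (pderiv p)) < degree (smult c (pderiv p))"
    using assms by (auto simp: degree_pderiv pderiv_eq_0_iff)
  then have "euler_op c p \<noteq> 0 \<and> degree (euler_op c p) = degree p - 1"
  proof
    assume "pderiv (pderiv p) = 0"
    then show ?thesis using p' unfolding euler_op_def by (simp only: diff_zero) simp
  next
    assume less: "degree (pderiv (pderiv p)) < degree (smult c (pderiv p))"
    then have "degree (euler_op c p) = degree (smult c (pderiv p))"
      unfolding euler_op_def diff_conv_add_uminus by (intro degree_add_eq_left) simp
    moreover have "euler_op c p \<noteq> 0"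
    proof
      assume "euler_op c p = 0"
      then have "smult c (pderiv p) = pderiv (pderiv p)" by (simp add: euler_op_def)
      with less show False by (simp only: less_irrefl)
    qed
    ultimately show ?thesis using p' by simp
  qed
  then show "euler_op c p \<noteq> 0" "degree (euler_op c p) = degree p - 1" by auto
qed

lemma euler_op_power_monom:
  assumes c: "c \<noteq> 0"
  shows "\<exists>d. (euler_op c ^^ k) (monom a k) = [:d:] \<and> (a \<noteq> 0 \<longrightarrow> d \<noteq> 0)"
proof (cases "a = 0")
  case True
  have "(euler_op c ^^ j) 0 = 0" for j by (induction j) (auto simp: euler_op_def)
  with True show ?thesis by auto
next
  case False
  have "(euler_op c ^^ j) (monom a k) \<noteq> 0 \<and> degree ((euler_op c ^^ j) (monom a k)) = k - j" if "j \<le> k" for j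
    using that
  proof (induction j)
    case 0
    then show ?case using False by (simp add: degree_monom_eq)
  next
    case (Suc j)
    then have "0 < degree ((euler_op c ^^ j) (monom a k))" by simp
    from euler_op_degree[OF c this] Suc show ?case by simp
  qed
  from this[of k] have *: "(euler_op c ^^ k) (monom a k) \<noteq> 0" "degree ((euler_op c ^^ k) (monom a k)) = 0" by auto
  then obtain d where "(euler_op c ^^ k) (monom a k) = [:d:]" using degree_eq_zeroE by blast
  with * show ?thesis by auto
qed

text \<open>The formula with the principal logarithm is used only on a disc around
  \<open>t0\<close>, since \<open>Dp\<close> may surround 0 or meet the negative axis. The two
  conclusions involve entire functions only, so the identity theorem carries them from the disc to
  \<open>Dp\<close>.\<close>

lemma radial_op_iterates:
  assumes Dp: "open Dp" "connected Dp" "P holomorphic_on Dp" "0 < t0" "complex_of_real t0 \<in> Dp"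
    and P: "\<And>t. 0 < t \<Longrightarrow> complex_of_real t \<in> Dp \<Longrightarrow>
         P (complex_of_real t) = (a + b * complex_of_real t ^ n) * complex_of_real (ln t) ^ (r - 1)"
    and n: "0 < n" and r: "1 \<le> r" and ab: "(a, b) \<noteq> (0, 0)"
  shows "\<exists>c d. (c, d) \<noteq> (0, 0) \<and> (\<forall>z\<in>Dp. (radial_op (of_nat n) ^^ (r - 1)) P z = c + d * z ^ n)
     \<and> (\<forall>z\<in>Dp. (radial_op (of_nat n) ^^ r) P z = 0)"
proof -
  let ?T = "radial_op (of_nat n)"
  let ?U = "euler_op (of_nat n)" and ?V = "euler_op (- of_nat n)"
  obtain \<delta> where \<delta>: "0 < \<delta>" "ball (complex_of_real t0) \<delta> \<subseteq> Dp" using Dp(1,5) open_contains_ball by blast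
  \<comment> \<open>Radius at most \<open>t0\<close> keeps the disc in the right half-plane, away
    from the branch cut.\<close>
  define \<rho> where "\<rho> = min \<delta> t0"
  define S where "S = ball (complex_of_real t0) \<rho>"
  have \<rho>: "0 < \<rho>" "\<rho> \<le> t0" "S \<subseteq> Dp" using \<delta> Dp(4) by (auto simp: \<rho>_def S_def)
  have S: "open S" "connected S" "of_real t0 \<in> S" using \<rho> by (auto simp: S_def)
  have Re: "0 < Re z" if "z \<in> S" for z
  proof -
    have "\<bar>Re (of_real t0 - z)\<bar> \<le> norm (of_real t0 - z)" by (rule abs_Re_le_cmod)
    also have "\<dots> < t0" using that \<rho>(2) by (simp add: S_def dist_norm)
    finally show ?thesis by simp
  qed
  have Sneg: "S \<inter> \<real>\<^sub>\<le>\<^sub>0 = {}" using Re by (force simp: complex_nonpos_Reals_iff)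
  have P0: "P z = log_poly n (monom a (r - 1)) (monom b (r - 1)) z" if z: "z \<in> S" for z
  proof -
    let ?g = "\<lambda>z. P z - (a + b * z ^ n) * Ln z ^ (r - 1)"
    have hol: "?g holomorphic_on S"
      using Sneg by (intro holomorphic_intros holomorphic_on_subset[OF Dp(3) \<rho>(3)]) auto
    have zero: "?g w = 0" if "w \<in> S \<inter> \<real>" for w
    proof -
      obtain t where t: "w = of_real t" using \<open>w \<in> S \<inter> \<real>\<close> by (auto elim: Reals_cases)
      have "0 < t" using Re[of w] that t by simp
      then show ?thesis using P[of t] that \<rho>(3) t by (auto simp: Ln_of_real)
    qed
    have "of_real t0 islimpt (S \<inter> \<real>)"
      unfolding islimpt_approachable
    proof (intro allI impI)
      fix e :: real assume e: "0 < e"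
      define s where "s = min e \<rho> / 2"
      have s: "0 < s" "s < e" "s < \<rho>" using e \<rho> by (auto simp: s_def)
      then have "complex_of_real (t0 + s) \<in> S \<inter> \<real>" by (auto simp: S_def dist_norm)
      then show "\<exists>x'\<in>S \<inter> \<real>. x' \<noteq> of_real t0 \<and> dist x' (of_real t0) < e"
        using s by (intro bexI[of _ "of_real (t0 + s)"]) (auto simp: dist_norm)
    qed
    then have "?g z = 0"
      using analytic_continuation[OF hol S(1,2) _ S(3) _ zero z, of "S \<inter> \<real>"] by blast
    then show ?thesis by (simp add: log_poly_def poly_monom algebra_simps)
  qed
  have it: "(?T ^^ k) P z = log_poly n ((?U ^^ k) (monom a (r - 1))) ((?V ^^ k) (monom b (r - 1))) z" if "z \<in> S" for k z
    using that
  proof (induction k arbitrary: z)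
    case 0
    then show ?case using P0 by simp
  next
    case (Suc k)
    show ?case using radial_op_log_poly[OF S(1) Sneg Suc.IH Suc.prems] by simp
  qed
  obtain c where c: "(?U ^^ (r - 1)) (monom a (r - 1)) = [:c:]" "a \<noteq> 0 \<longrightarrow> c \<noteq> 0"
    using euler_op_power_monom[of "of_nat n" "r - 1" a] n by auto
  obtain d where d: "(?V ^^ (r - 1)) (monom b (r - 1)) = [:d:]" "b \<noteq> 0 \<longrightarrow> d \<noteq> 0"
    using euler_op_power_monom[of "- of_nat n" "r - 1" b] n by auto
  have rS: "(f ^^ r) x = f ((f ^^ (r - 1)) x)" for f :: "'z \<Rightarrow> 'z" and x
    using r by (cases r) auto
  have TS1: "(?T ^^ (r - 1)) P z = c + d * z ^ n" if "z \<in> S" for z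
    using it[OF that, of "r - 1"] unfolding c d by (simp add: log_poly_def mult.commute)
  have TS2: "(?T ^^ r) P z = 0" if "z \<in> S" for z
    using it[OF that, of r] unfolding rS c d by (simp add: euler_op_def log_poly_def pderiv_pCons)
  have ext: "f z = g z" if "f holomorphic_on Dp" "g holomorphic_on Dp" "\<And>z. z \<in> S \<Longrightarrow> f z = g z" "z \<in> Dp" for f g z
    using analytic_continuation_open[OF S(1) Dp(1) _ Dp(2) \<rho>(3) that] S(3) by blast
  note hol = radial_op_holomorphic[OF Dp(1,3), where c = "of_nat n"]
  have "(?T ^^ (r - 1)) P z = c + d * z ^ n" if "z \<in> Dp" for z
    by (rule ext[OF hol _ TS1 that]) (intro holomorphic_intros)
  moreover have "(?T ^^ r) P z = 0" if "z \<in> Dp" for z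
    by (rule ext[OF hol _ TS2 that]) (intro holomorphic_intros)
  moreover have "(c, d) \<noteq> (0, 0)" using ab c(2) d(2) by auto
  ultimately show ?thesis by blast
qed

subsection \<open>Reduction to the radial operator\<close>

lemma sphereS_eq: "sphereS = (sphere 0 1 :: (real \<times> real \<times> (real^'m::finite)) set)"
proof -
  have "(norm y)\<^sup>2 = (fst y)\<^sup>2 + (fst (snd y))\<^sup>2 + (\<Sum>j\<in>UNIV. (snd (snd y) $ j)\<^sup>2)" for y :: "real \<times> real \<times> (real^'m)"
    by (cases y) (simp add: norm_Pair norm_vec_def L2_set_def sum_nonneg)
  moreover have "norm y = 1 \<longleftrightarrow> (norm y)\<^sup>2 = 1" for y :: "real \<times> real \<times> (real^'m)"
    by (simp add: power2_eq_1_iff) (metis norm_ge_zero not_one_le_zero neg_0_le_iff_le)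
  ultimately show ?thesis unfolding sphereS_def by auto
qed

lemma bounded_linear_den: "bounded_linear (den :: real \<times> real \<times> (real^'m::finite) \<Rightarrow> complex)"
proof -
  have eq: "den = (\<lambda>y :: real \<times> real \<times> (real^'m). fst (snd y) *\<^sub>R 1 + fst y *\<^sub>R \<i>)"
    by (auto simp: den_def complex_eq_iff)
  show ?thesis
    unfolding eq by (intro bounded_linear_add bounded_linear_scaleR_const
      bounded_linear_compose[OF bounded_linear_fst bounded_linear_snd] bounded_linear_fst)
qed

text \<open>The norm in the numerator is dropped: it is 1 on the sphere, and without it
  \<open>ucoord\<close> is homogeneous of degree -1 and \<open>wcoord\<close> of degree 0.\<close>

definition ucoord :: "real \<times> real \<times> (real^'m::finite) \<Rightarrow> complex" where
  "ucoord y = 2 / den y"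

definition wcoord :: "real \<times> real \<times> (real^'m::finite) \<Rightarrow> complex^'m" where
  "wcoord y = ucoord y *s realvec (snd (snd y))"

text \<open>Written through \<open>ucoord\<close> rather than as a quotient, so that second
  derivatives and the later cancellations are polynomial in \<open>ucoord\<close>.\<close>

definition ucoord' :: "real \<times> real \<times> (real^'m::finite) \<Rightarrow> real \<times> real \<times> (real^'m) \<Rightarrow> complex" where
  "ucoord' y v = - ((ucoord y)\<^sup>2 * den v / 2)"

definition wcoord' :: "real \<times> real \<times> (real^'m::finite) \<Rightarrow> real \<times> real \<times> (real^'m) \<Rightarrow> complex^'m" where
  "wcoord' y v = ucoord y *s realvec (snd (snd v)) + ucoord' y v *s realvec (snd (snd y))"

lemma ucoord_has_derivative:
  assumes "den y \<noteq> 0"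
  shows "(ucoord has_derivative ucoord' y) (at y)"
proof -
  have "((\<lambda>y. 2 / den y) has_derivative (\<lambda>v. - (2 * (inverse (den y) * den v * inverse (den y))))) (at y)"
    using assms by (auto intro!: derivative_eq_intros bounded_linear_imp_has_derivative[OF bounded_linear_den] simp: field_simps power2_eq_square)
  moreover have "(\<lambda>v. - (2 * (inverse (den y) * den v * inverse (den y)))) = ucoord' y"
    using assms by (auto simp: ucoord'_def ucoord_def field_simps power2_eq_square)
  ultimately show ?thesis by (simp add: ucoord_def[abs_def])
qed

lemma ucoord'_has_derivative:
  assumes "den y \<noteq> 0"
  shows "((\<lambda>y. ucoord' y v) has_derivative (\<lambda>x. - (ucoord y * ucoord' y x * den v))) (at y)"
  unfolding ucoord'_def[of _ v]
  by (rule has_derivative_eq_rhs, (rule derivative_eq_intros ucoord_has_derivative[OF assms] refl)+)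
    (auto simp: fun_eq_iff)

lemma realvec_component_has_derivative:
  fixes y :: "real \<times> real \<times> (real^'m::finite)"
  shows "((\<lambda>y. realvec (snd (snd y)) $ j) has_derivative (\<lambda>v. realvec (snd (snd v)) $ j)) (at y)"
proof (rule bounded_linear_imp_has_derivative)
  show "bounded_linear (\<lambda>y :: real \<times> real \<times> (real^'m). realvec (snd (snd y)) $ j)"
    using bounded_linear_compose[OF bounded_linear_vec_nth[of j] bounded_linear_compose[OF bounded_linear_realvec
          bounded_linear_compose[OF bounded_linear_snd bounded_linear_snd]]] .
qed

lemma wcoord'_component_has_derivative:
  assumes "den y \<noteq> 0"
  shows "((\<lambda>y. wcoord' y v $ j) has_derivative (\<lambda>x. ucoord' y x * realvec (snd (snd v)) $ j
      + (ucoord' y v * realvec (snd (snd x)) $ j + - (ucoord y * ucoord' y x * den v) * realvec (snd (snd y)) $ j))) (at y)"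
proof -
  have "((\<lambda>y. ucoord y * realvec (snd (snd v)) $ j + ucoord' y v * realvec (snd (snd y)) $ j) has_derivative
      (\<lambda>x. ucoord' y x * realvec (snd (snd v)) $ j
      + (ucoord' y v * realvec (snd (snd x)) $ j + - (ucoord y * ucoord' y x * den v) * realvec (snd (snd y)) $ j))) (at y)"
    by (intro has_derivative_add has_derivative_mult_left has_derivative_mult ucoord_has_derivative
        ucoord'_has_derivative realvec_component_has_derivative assms)
  then show ?thesis by (simp add: wcoord'_def)
qed

lemma wcoord_has_derivative:
  assumes "den y \<noteq> 0"
  shows "(wcoord has_derivative wcoord' y) (at y)"
proof -
  have "((\<lambda>y. wcoord y \<bullet> b) has_derivative (\<lambda>v. wcoord' y v \<bullet> b)) (at y)" if bB: "b \<in> Basis" for b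
  proof -
    obtain j c where b: "b = axis j c" using bB unfolding Basis_vec_def by blast
    have "((\<lambda>y. wcoord y $ j) has_derivative (\<lambda>v. ucoord y * realvec (snd (snd v)) $ j + ucoord' y v * realvec (snd (snd y)) $ j)) (at y)"
      using has_derivative_mult[OF ucoord_has_derivative[OF assms] realvec_component_has_derivative[of j y]]
      by (simp add: wcoord_def)
    then have "((\<lambda>y. wcoord y $ j) has_derivative (\<lambda>v. wcoord' y v $ j)) (at y)" by (simp add: wcoord'_def)
    then show ?thesis unfolding b inner_axis by (rule has_derivative_inner_left)
  qed
  then show ?thesis by (subst has_derivative_componentwise_within) auto
qed

lemma sum_Basis_vec:
  fixes f :: "real^'m::finite \<Rightarrow> 'b::comm_monoid_add"
  shows "(\<Sum>b\<in>Basis. f b) = (\<Sum>j\<in>UNIV. f (axis j 1))"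
proof -
  have B: "(Basis :: (real^'m) set) = (\<lambda>j. axis j 1) ` UNIV" by (auto simp: Basis_vec_def)
  have "inj (\<lambda>j::'m. axis j (1::real) :: real^'m)" by (auto intro!: injI simp: axis_eq_axis)
  then show ?thesis unfolding B by (simp add: sum.reindex)
qed

lemma sum_Basis_prod:
  fixes f :: "'a::euclidean_space \<times> 'b::euclidean_space \<Rightarrow> 'c::comm_monoid_add"
  shows "(\<Sum>b\<in>Basis. f b) = (\<Sum>b\<in>Basis. f (b, 0)) + (\<Sum>b\<in>Basis. f (0, b))"
proof -
  have "inj_on (\<lambda>u. (u::'a, 0::'b)) Basis" "inj_on (\<lambda>u. (0::'a, u::'b)) Basis"
    by (auto intro!: inj_onI)
  then show ?thesis
    unfolding Basis_prod_def by (subst sum.union_disjoint) (auto simp: sum.reindex)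
qed

text \<open>\<open>Q\<close> is an arbitrary holomorphic factor, so the result has the shape of the
  hypothesis and can be iterated. The ambient Laplacian of the product vanishes, and the radial
  derivatives see only \<open>Q\<close>.\<close>

lemma LB_tau_product:
  fixes H :: "complex^'m::finite \<Rightarrow> complex" and K :: "'k::finite itself"
  assumes dimK: "CARD('k) = CARD('m) + 1"
    and Q: "open Dp" "Q holomorphic_on Dp"
    and H: "holo_several H D" and lap: "\<And>z. z \<in> D \<Longrightarrow> (\<Sum>j\<in>UNIV. cpd j (cpd j H) z) = 0"
    and W: "openin (top_of_set sphereS) W" "y \<in> W"
    and Wdef: "\<And>y. y \<in> W \<Longrightarrow> den y \<noteq> 0 \<and> ucoord y \<in> Dp \<and> wcoord y \<in> D"
    and f: "\<And>y. y \<in> W \<Longrightarrow> f y = Q (ucoord y) * H (wcoord y)"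
  shows "LB_tau K sphereS f y = radial_op (of_nat CARD('m)) Q (ucoord y) * H (wcoord y)"
proof -
  let ?Q1 = "deriv Q" and ?Q2 = "deriv (deriv Q)"
  let ?H1 = "\<lambda>j. cpd j H" and ?H2 = "\<lambda>j k. cpd k (cpd j H)"
  have opD: "open D" using H by (simp add: holo_several_def)
  obtain V where V: "open V" "W = sphereS \<inter> V" using W(1) by (auto simp: openin_open)
  \<comment> \<open>An ambient neighbourhood on which the extension is defined; intersecting with
    \<open>V\<close> places its points on the sphere in \<open>W\<close>, where \<open>f\<close> is
    known.\<close>
  define N where "N = V \<inter> {z. den z \<noteq> 0 \<and> ucoord z \<in> Dp \<and> wcoord z \<in> D}"
  have Nden: "den z \<noteq> 0" "ucoord z \<in> Dp" "wcoord z \<in> D" if "z \<in> N" for z using that by (auto simp: N_def)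
  have yN: "y \<in> N" using W(2) V(2) Wdef by (auto simp: N_def)
  have opN: "open N"
  proof -
    let ?A = "{z :: real \<times> real \<times> (real^'m). den z \<noteq> 0}"
    have A: "open ?A"
    proof -
      have "open (den -` (- {0 :: complex}) :: (real \<times> real \<times> (real^'m)) set)"
        by (intro open_vimage linear_continuous_on[OF bounded_linear_den]) auto
      then show ?thesis by (simp add: vimage_def)
    qed
    have "continuous_on ?A ucoord" "continuous_on ?A wcoord"
      using ucoord_has_derivative wcoord_has_derivative
      by (auto intro!: continuous_at_imp_continuous_on has_derivative_continuous)
    from continuous_open_preimage[OF this(1) A Q(1)] continuous_open_preimage[OF this(2) A opD]
    have "open (V \<inter> ((?A \<inter> ucoord -` Dp) \<inter> (?A \<inter> wcoord -` D)))" using V(1) by blast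
    moreover have "V \<inter> ((?A \<inter> ucoord -` Dp) \<inter> (?A \<inter> wcoord -` D)) = N" by (auto simp: N_def)
    ultimately show ?thesis by simp
  qed
  have dg: "((\<lambda>z. g (ucoord z)) has_derivative (\<lambda>v. deriv g (ucoord z) * ucoord' z v)) (at z)"
    if "g holomorphic_on Dp" "z \<in> N" for g z
  proof -
    have "(g has_field_derivative deriv g (ucoord z)) (at (ucoord z))"
      using holomorphic_derivI[OF that(1) Q(1) Nden(2)[OF that(2)]] .
    then have "(g has_derivative (*) (deriv g (ucoord z))) (at (ucoord z))" by (simp add: has_field_derivative_def)
    from has_derivative_compose[OF ucoord_has_derivative[OF Nden(1)[OF that(2)]] this] show ?thesis .
  qed
  have dG: "((\<lambda>z. G (wcoord z)) has_derivative (\<lambda>v. \<Sum>k\<in>UNIV. wcoord' z v $ k * cpd k G (wcoord z))) (at z)"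
    if "holo_several G D" "z \<in> N" for G z
    using has_derivative_compose[OF wcoord_has_derivative[OF Nden(1)[OF that(2)]]
        holo_several_has_derivative[OF that(1) Nden(3)[OF that(2)]]] .
  have Q1: "?Q1 holomorphic_on Dp" using Q by (intro holomorphic_deriv)
  define F where "F z = Q (ucoord z) * H (wcoord z)" for z
  define F' where "F' z v = Q (ucoord z) * (\<Sum>j\<in>UNIV. wcoord' z v $ j * ?H1 j (wcoord z))
      + ?Q1 (ucoord z) * ucoord' z v * H (wcoord z)" for z v
  define w'' where "w'' x v j = ucoord' y x * realvec (snd (snd v)) $ j
      + (ucoord' y v * realvec (snd (snd x)) $ j + - (ucoord y * ucoord' y x * den v) * realvec (snd (snd y)) $ j)" for x v j
  define F'' where "F'' x v =
      Q (ucoord y) * (\<Sum>j\<in>UNIV. wcoord' y v $ j * (\<Sum>k\<in>UNIV. wcoord' y x $ k * ?H2 j k (wcoord y)) + w'' x v j * ?H1 j (wcoord y))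
      + ?Q1 (ucoord y) * ucoord' y x * (\<Sum>j\<in>UNIV. wcoord' y v $ j * ?H1 j (wcoord y))
      + (?Q1 (ucoord y) * ucoord' y v * (\<Sum>k\<in>UNIV. wcoord' y x $ k * ?H1 k (wcoord y))
         + (?Q1 (ucoord y) * - (ucoord y * ucoord' y x * den v) + ?Q2 (ucoord y) * ucoord' y x * ucoord' y v) * H (wcoord y))" for x v
  have dF: "(F has_derivative F' z) (at z)" if "z \<in> N" for z
    unfolding F_def[abs_def] F'_def[abs_def]
    by (rule has_derivative_mult[OF dg[OF Q(2) that] dG[OF H that]])
  have dF': "((\<lambda>z. F' z v) has_derivative (\<lambda>x. F'' x v)) (at y)" for v
    unfolding F'_def F''_def w''_def
    by (intro has_derivative_add has_derivative_mult has_derivative_sum dg[OF Q(2) yN] dg[OF Q1 yN] dG[OF H yN]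
        dG[OF holo_several_cpd[OF H] yN] wcoord'_component_has_derivative ucoord'_has_derivative Nden(1)[OF yN])
  have y1: "norm y = 1" using W(2) V(2) by (auto simp: sphereS_eq)
  have dim: "DIM(real \<times> real \<times> (real^'m)) = CARD('k) + 1" using dimK by simp
  have "LB_tau K sphereS f y = (\<Sum>b\<in>Basis. F'' b b) - F'' y y - of_nat CARD('k) * F' y y"
    unfolding sphereS_eq
  proof (rule LB_tau_unit_sphere[OF dim y1 opN yN dF dF'])
    fix z assume "norm z = 1" "z \<in> N"
    then have "z \<in> W" using V(2) by (auto simp: sphereS_eq N_def)
    then show "f z = F z" by (simp add: f F_def)
  qed
  also have "(\<Sum>b\<in>Basis. F'' b b) = 0"
  proof -
    define c where "c = - ((ucoord y)\<^sup>2 / 2)"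
    define R where "R j = realvec (snd (snd y)) $ j" for j
    define C where "C = Q (ucoord y) * (\<Sum>j\<in>UNIV. c * R j * (\<Sum>k\<in>UNIV. c * R k * ?H2 j k (wcoord y)) + - (ucoord y * c) * R j * ?H1 j (wcoord y))
      + 2 * (?Q1 (ucoord y) * c * (\<Sum>j\<in>UNIV. c * R j * ?H1 j (wcoord y)))
      + (?Q1 (ucoord y) * - (ucoord y * c) + ?Q2 (ucoord y) * c * c) * H (wcoord y)"
    have e1: "F'' (1, 0, 0) (1, 0, 0) + F'' (0, 1, 0) (0, 1, 0) = 0"
    proof -
      have d: "den (1, 0, 0 :: real^'m) = \<i>" "den (0, 1, 0 :: real^'m) = 1" by (simp_all add: den_def complex_eq_iff)
      \<comment> \<open>In the plane of the first two coordinates everything depends on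
        \<open>v\<close> through \<open>den v\<close>. The two basis vectors have \<open>den\<close>
        equal to \<i> and 1, whose squares cancel.\<close>
      have hom: "F'' v v = (den v)\<^sup>2 * C" if v: "snd (snd v) = 0" for v
      proof -
        have r0: "realvec (snd (snd v)) $ j = 0" for j by (simp add: v realvec_def)
        have u: "ucoord' y v = c * den v" by (simp add: ucoord'_def c_def)
        have w: "wcoord' y v $ j = c * den v * R j" for j by (simp add: wcoord'_def u r0 R_def)
        have w2: "w'' v v j = - (ucoord y * c * (den v)\<^sup>2) * R j" for j
          unfolding w''_def u r0 R_def[symmetric] by (simp add: power2_eq_square)
        have s1: "(\<Sum>k\<in>UNIV. c * den v * R k * g k) = den v * (\<Sum>k\<in>UNIV. c * R k * g k)" for g :: "'m \<Rightarrow> complex"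
          by (simp add: sum_distrib_left mult_ac)
        have s2: "(\<Sum>j\<in>UNIV. c * den v * R j * (den v * g j) + - (ucoord y * c * (den v)\<^sup>2) * R j * g' j)
            = (den v)\<^sup>2 * (\<Sum>j\<in>UNIV. c * R j * g j + - (ucoord y * c) * R j * g' j)" for g g' :: "'m \<Rightarrow> complex"
          unfolding sum_distrib_left by (intro sum.cong refl) (simp add: algebra_simps power2_eq_square)
        show ?thesis
          unfolding F''_def w w2 s1 s2 u C_def by (simp add: algebra_simps power2_eq_square)
      qed
      show ?thesis by (simp add: hom d)
    qed
    \<comment> \<open>These directions leave \<open>den\<close> fixed, so only \<open>H\<close> is
      differentiated and each coordinate contributes one term of its Laplacian.\<close>
    have e2: "F'' (0, 0, axis j 1) (0, 0, axis j 1) = Q (ucoord y) * (ucoord y)\<^sup>2 * ?H2 j j (wcoord y)" for j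
    proof -
      have d: "den (0, 0, axis j 1 :: real^'m) = 0" by (simp add: den_def complex_eq_iff)
      have rv: "realvec (axis j 1 :: real^'m) $ k = (if k = j then 1 else 0)" for k by (simp add: realvec_def axis_def)
      have u: "ucoord' y (0, 0, axis j 1) = 0" by (simp add: ucoord'_def d)
      have w: "wcoord' y (0, 0, axis j 1) $ k = (if k = j then ucoord y else 0)" for k
        by (simp add: wcoord'_def u rv)
      show ?thesis
        unfolding F''_def w''_def u w d by (simp add: if_distrib if_distribR power2_eq_square cong: if_cong)
    qed
    have "(\<Sum>b\<in>Basis. F'' b b) = F'' (1, 0, 0) (1, 0, 0) + F'' (0, 1, 0) (0, 1, 0) + (\<Sum>j\<in>UNIV. F'' (0, 0, axis j 1) (0, 0, axis j 1))"
      by (simp add: sum_Basis_prod sum_Basis_vec zero_prod_def add.assoc)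
    also have "\<dots> = Q (ucoord y) * (ucoord y)\<^sup>2 * (\<Sum>j\<in>UNIV. ?H2 j j (wcoord y))"
      by (simp add: e1 e2 sum_distrib_left)
    finally show ?thesis by (simp add: lap[OF Nden(3)[OF yN]])
  qed
  finally have LB: "LB_tau K sphereS f y = 0 - F'' y y - of_nat CARD('k) * F' y y" .
  have den: "den y = 2 / ucoord y" "ucoord y \<noteq> 0" using Nden(1)[OF yN] by (simp_all add: ucoord_def)
  \<comment> \<open>Euler's relation for degree -1; the next line is the one for degree 0.\<close>
  have u: "ucoord' y y = - ucoord y" using den by (simp add: ucoord'_def power2_eq_square)
  have w: "wcoord' y y $ j = 0" for j by (simp add: wcoord'_def u)
  have w2: "w'' y y j = 0" for j using den(2) unfolding w''_def u den(1) by simp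
  have "F'' y y = (2 * ucoord y * ?Q1 (ucoord y) + (ucoord y)\<^sup>2 * ?Q2 (ucoord y)) * H (wcoord y)"
    unfolding F''_def w w2 u den(1) using den(2) by (simp add: algebra_simps power2_eq_square)
  moreover have "F' y y = - (ucoord y * ?Q1 (ucoord y) * H (wcoord y))"
    unfolding F'_def w u by simp
  ultimately show ?thesis
    unfolding LB radial_op_def dimK by (simp add: algebra_simps)
qed

text \<open>Parametrizes the points of the sphere whose \<open>den\<close> has phase
  \<open>e\<close>. The factor 1/2 offsets the 2 in \<open>ucoord\<close>, so that
  \<open>wcoord\<close> is exactly \<open>x\<close> divided by \<open>e\<close>; the normalizing
  root is the length of the unscaled vector.\<close>

definition sphere_ray :: "complex \<Rightarrow> real^'m::finite \<Rightarrow> real \<times> real \<times> (real^'m)" where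
  "sphere_ray e x = (1 / sqrt (1 + x \<bullet> x / 4)) *\<^sub>R (Im e, Re e, (1 / 2) *\<^sub>R x)"

lemma sphere_ray:
  fixes x :: "real^'m::finite"
  assumes e: "norm e = 1"
  shows "sphere_ray e x \<in> sphereS"
    and "ucoord (sphere_ray e x) = 2 / e * of_real (sqrt (1 + x \<bullet> x / 4))"
    and "wcoord (sphere_ray e x) = (1 / e) *s realvec x"
proof -
  define s where "s = sqrt (1 + x \<bullet> x / 4)"
  have pos: "0 < 1 + x \<bullet> x / 4" using inner_ge_zero[of x] by linarith
  have s: "0 < s" "s\<^sup>2 = 1 + x \<bullet> x / 4" using pos by (auto simp: s_def)
  have e0: "e \<noteq> 0" using e by auto
  have e2: "(Re e)\<^sup>2 + (Im e)\<^sup>2 = 1" using e by (simp add: norm_complex_def)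
  have "(norm (Im e, Re e, (1 / 2) *\<^sub>R x))\<^sup>2 = (Im e)\<^sup>2 + ((Re e)\<^sup>2 + (norm x / 2)\<^sup>2)"
    by (simp add: norm_Pair)
  also have "\<dots> = s\<^sup>2" using e2 by (simp add: s power_divide dot_square_norm)
  finally have n: "norm (Im e, Re e, (1 / 2) *\<^sub>R x) = s" using s(1) by simp
  show "sphere_ray e x \<in> sphereS"
    using s(1) unfolding sphereS_eq sphere_ray_def s_def[symmetric] mem_sphere_0 norm_scaleR n by simp
  have den: "den (sphere_ray e x) = e / of_real s"
    unfolding sphere_ray_def s_def[symmetric] den_def by (simp add: complex_eq_iff)
  show u: "ucoord (sphere_ray e x) = 2 / e * of_real (sqrt (1 + x \<bullet> x / 4))"
    unfolding ucoord_def den s_def[symmetric] by simp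
  have "realvec (snd (snd (sphere_ray e x))) = (1 / (2 * of_real s)) *s realvec x"
    unfolding sphere_ray_def s_def[symmetric] by (simp add: realvec_def vec_eq_iff)
  then show "wcoord (sphere_ray e x) = (1 / e) *s realvec x"
    using s(1) e0 unfolding wcoord_def u s_def[symmetric] by (simp add: vector_smult_assoc)
qed

lemma sphere_ray_surj:
  fixes y :: "real \<times> real \<times> (real^'m::finite)"
  assumes y: "y \<in> sphereS" "den y \<noteq> 0"
  shows "\<exists>e x. norm e = 1 \<and> sphere_ray e x = y"
proof -
  obtain y1 y2 z where yz: "y = (y1, y2, z)" by (cases y)
  define \<rho> where "\<rho> = norm (den y)"
  have \<rho>: "0 < \<rho>" "\<rho>\<^sup>2 = y2\<^sup>2 + y1\<^sup>2"
    using y(2) by (simp_all add: \<rho>_def den_def yz cmod_power2)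
  define e where "e = den y / of_real \<rho>"
  have "norm e = 1" using \<rho>(1) by (simp add: e_def norm_divide \<rho>_def)
  \<comment> \<open>The modulus of \<open>den\<close> on the ray is the reciprocal of the
    normalizing root, which must therefore be \<open>1 / \<rho>\<close>; this determines
    \<open>x\<close>.\<close>
  moreover have "sphere_ray e ((2 / \<rho>) *\<^sub>R z) = y"
  proof -
    have "(norm y)\<^sup>2 = 1" using y(1) by (simp add: sphereS_eq)
    then have "y1\<^sup>2 + (y2\<^sup>2 + z \<bullet> z) = 1" by (simp add: yz norm_Pair dot_square_norm)
    then have zz: "z \<bullet> z = 1 - \<rho>\<^sup>2" using \<rho>(2) by simp
    have "1 + ((2 / \<rho>) *\<^sub>R z) \<bullet> ((2 / \<rho>) *\<^sub>R z) / 4 = (1 / \<rho>)\<^sup>2"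
      using \<rho>(1) by (simp add: zz divide_simps power2_eq_square)
    then have "sqrt (1 + ((2 / \<rho>) *\<^sub>R z) \<bullet> ((2 / \<rho>) *\<^sub>R z) / 4) = 1 / \<rho>"
      using \<rho>(1) by (metis abs_of_pos real_sqrt_abs zero_less_divide_1_iff)
    moreover have "Re e = y2 / \<rho>" "Im e = y1 / \<rho>" by (simp_all add: e_def den_def yz)
    ultimately show ?thesis using \<rho>(1) unfolding sphere_ray_def by (simp add: yz)
  qed
  ultimately show ?thesis by blast
qed

text \<open>On \<open>{den y / |den y| = e}\<close> the argument of \<open>H\<close> runs through an open part of the totally real
  slice \<open>e\<^sup>-\<^sup>1 \<real>\<^sup>m\<close>, while the radial factor only vanishes on a sphere \<open>|x| = const\<close>.\<close>
lemma product_nonvanishing: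
  fixes H :: "complex^'m::finite \<Rightarrow> complex"
  assumes W: "openin (top_of_set sphereS) W" "W \<noteq> {}"
    and Wdef: "\<And>y. y \<in> W \<Longrightarrow> den y \<noteq> 0 \<and> wcoord y \<in> D"
    and nz: "\<And>z k \<epsilon>. z \<in> D \<Longrightarrow> k \<noteq> 0 \<Longrightarrow> 0 < \<epsilon> \<Longrightarrow> \<exists>x. norm x < \<epsilon> \<and> H (z + k *s realvec x) \<noteq> 0"
    and cd: "(c, d) \<noteq> (0, 0)" and n: "0 < n"
  shows "\<exists>y\<in>W. (c + d * ucoord y ^ n) * H (wcoord y) \<noteq> 0"
proof -
  obtain V where V: "open V" "W = sphereS \<inter> V" using W(1) by (auto simp: openin_open)
  obtain y0 where y0: "y0 \<in> W" using W(2) by blast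
  obtain e x0 where e: "norm e = 1" and x0: "sphere_ray e x0 = y0"
    using sphere_ray_surj[of y0] y0 V(2) Wdef by blast
  have e0: "e \<noteq> 0" using e by auto
  have "continuous_on UNIV (sphere_ray e :: real^'m \<Rightarrow> _)"
  proof -
    have "1 + x \<bullet> x / 4 \<noteq> 0" for x :: "real^'m" using inner_ge_zero[of x] by linarith
    then show ?thesis unfolding sphere_ray_def[abs_def] by (intro continuous_intros) auto
  qed
  then have "open (sphere_ray e -` V)" using V(1) by (intro open_vimage)
  moreover have "x0 \<in> sphere_ray e -` V" using x0 y0 V(2) by simp
  ultimately obtain \<epsilon> where \<epsilon>: "0 < \<epsilon>" "ball x0 \<epsilon> \<subseteq> sphere_ray e -` V"
    using open_contains_ball_eq by blast
  have inW: "sphere_ray e x \<in> W" if "x \<in> ball x0 \<epsilon>" for x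
    using that \<epsilon>(2) V(2) sphere_ray(1)[OF e] by blast
  define s where "s x = sqrt (1 + x \<bullet> x / 4)" for x :: "real^'m"
  define \<phi> where "\<phi> x = c + d * (2 / e * of_real (s x)) ^ n" for x
  obtain x1 where x1: "x1 \<in> ball x0 \<epsilon>" "\<phi> x1 \<noteq> 0"
  proof (cases "\<phi> x0 = 0")
    case False
    then show ?thesis using that[of x0] \<epsilon>(1) by simp
  next
    case True
    \<comment> \<open>A direction that does not point inwards: moving along it strictly increases
      \<open>x \<bullet> x\<close>. At the origin any unit vector will do.\<close>
    obtain v :: "real^'m" where v: "norm v = 1" "0 \<le> v \<bullet> x0"
    proof (cases "x0 = 0")
      case True
      then show ?thesis using that[of "axis undefined 1"] by simp
    next
      case False
      then show ?thesis using that[of "x0 /\<^sub>R norm x0"] by simp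
    qed
    define x1 where "x1 = x0 + (\<epsilon> / 2) *\<^sub>R v"
    have "v \<bullet> v = 1" using v(1) by (simp add: dot_square_norm)
    then have "x1 \<bullet> x1 = x0 \<bullet> x0 + \<epsilon> * (v \<bullet> x0) + \<epsilon>\<^sup>2 / 4"
      by (simp add: x1_def inner_add_left inner_add_right inner_commute[of x0 v] power2_eq_square field_simps)
    moreover have "0 \<le> \<epsilon> * (v \<bullet> x0)" "0 < \<epsilon>\<^sup>2 / 4" using v(2) \<epsilon>(1) by simp_all
    ultimately have "x0 \<bullet> x0 < x1 \<bullet> x1" by linarith
    then have "s x0 < s x1" by (simp add: s_def)
    then have less: "s x0 ^ n < s x1 ^ n" using n by (intro power_strict_mono) (simp_all add: s_def)
    have diff: "\<phi> x1 - \<phi> x0 = d * (2 / e) ^ n * of_real (s x1 ^ n - s x0 ^ n)"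
      unfolding \<phi>_def power_mult_distrib by (simp add: right_diff_distrib)
    have "d \<noteq> 0" using True cd by (auto simp: \<phi>_def)
    moreover have "complex_of_real (s x1 ^ n - s x0 ^ n) \<noteq> 0"
      using less unfolding of_real_eq_0_iff by linarith
    moreover have "(2 / e) ^ n \<noteq> 0" using e0 by simp
    ultimately have "\<phi> x1 - \<phi> x0 \<noteq> 0" unfolding diff by (intro no_zero_divisors)
    then have "\<phi> x1 \<noteq> 0" using True by simp
    moreover have "x1 \<in> ball x0 \<epsilon>" using v(1) \<epsilon>(1) by (simp add: x1_def dist_norm)
    ultimately show ?thesis using that by blast
  qed
  have "continuous_on UNIV \<phi>" unfolding \<phi>_def s_def by (intro continuous_intros) simp
  then have "open (\<phi> -` (- {0}))" by (intro open_vimage) auto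
  then have "open (ball x0 \<epsilon> \<inter> \<phi> -` (- {0}))" by blast
  moreover have "x1 \<in> ball x0 \<epsilon> \<inter> \<phi> -` (- {0})" using x1 by simp
  ultimately obtain \<delta> where \<delta>: "0 < \<delta>" "ball x1 \<delta> \<subseteq> ball x0 \<epsilon> \<inter> \<phi> -` (- {0})"
    using open_contains_ball_eq by blast
  have "wcoord (sphere_ray e x1) \<in> D" using Wdef inW x1(1) by blast
  then have "(1 / e) *s realvec x1 \<in> D" unfolding sphere_ray(3)[OF e] .
  \<comment> \<open>On the ball around \<open>x1\<close> the radial factor has no zeros, so a
    nonzero of \<open>H\<close> on the rotated slice suffices.\<close>
  from nz[OF this _ \<delta>(1), of "1 / e"] e0
  obtain x where x: "norm x < \<delta>" "H ((1 / e) *s realvec x1 + (1 / e) *s realvec x) \<noteq> 0" by auto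
  have "x1 + x \<in> ball x1 \<delta>" using x(1) by (simp add: dist_norm)
  then have mem: "x1 + x \<in> ball x0 \<epsilon>" "\<phi> (x1 + x) \<noteq> 0" using \<delta>(2) by auto
  have "(1 / e) *s realvec x1 + (1 / e) *s realvec x = (1 / e) *s realvec (x1 + x)"
    by (simp add: realvec_def vec_eq_iff distrib_left add_divide_distrib)
  then have "(c + d * ucoord (sphere_ray e (x1 + x)) ^ n) * H (wcoord (sphere_ray e (x1 + x))) \<noteq> 0"
    using x(2) mem(2) unfolding sphere_ray(2,3)[OF e] \<phi>_def s_def by simp
  then show ?thesis using inW[OF mem(1)] by blast
qed

theorem theorem5p3:
  fixes h :: "real^'m::finite \<Rightarrow> complex"
    and H :: "complex^'m \<Rightarrow> complex"
    and D :: "(complex^'m) set"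
    and P :: "complex \<Rightarrow> complex"
    and Dp :: "complex set"
    and a b :: complex
    and r :: nat
    and W :: "(real \<times> real \<times> (real^'m)) set"
    and K :: "'k::finite itself"
  assumes dimK: "CARD('k) = CARD('m) + 1"
    and harm: "eucl_harmonic h"
    and noncst: "\<not> (\<exists>c. \<forall>x. h x = c)"
    and r: "r \<ge> 1"
    and ab: "(a, b) \<noteq> (0, 0)"
    and Dp: "open Dp" "connected Dp" "P holomorphic_on Dp" "\<exists>t>0. complex_of_real t \<in> Dp"
    and Pext: "\<And>t. t > 0 \<Longrightarrow> complex_of_real t \<in> Dp \<Longrightarrow>
                 P (complex_of_real t) = (a + b * complex_of_real t ^ CARD('m)) * complex_of_real (ln t) ^ (r - 1)"
    and D: "connected D" "holo_several H D" "\<exists>x. realvec x \<in> D"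
    and Hext: "\<And>x. realvec x \<in> D \<Longrightarrow> H (realvec x) = h x"
    and W: "openin (top_of_set sphereS) W" "W \<noteq> {}"
    and Wdef: "\<And>y. y \<in> W \<Longrightarrow> den y \<noteq> 0 \<and>
                 complex_of_real (2 * norm y) / den y \<in> Dp \<and>
                 (\<chi> j. complex_of_real (2 * snd (snd y) $ j) / den y) \<in> D"
  shows "proper_r_harmonic_on K sphereS r W
           (\<lambda>y. P (complex_of_real (2 * norm y) / den y) *
                H (\<chi> j. complex_of_real (2 * snd (snd y) $ j) / den y))"
proof -
  let ?f = "\<lambda>y. P (complex_of_real (2 * norm y) / den y) * H (\<chi> j. complex_of_real (2 * snd (snd y) $ j) / den y)"
  let ?T = "radial_op (of_nat CARD('m))"
  obtain x0 where x0: "realvec x0 \<in> D" using D(3) by blast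
  obtain t0 where t0: "0 < t0" "complex_of_real t0 \<in> Dp" using Dp(4) by blast
  have coords: "complex_of_real (2 * norm y) / den y = ucoord y"
      "(\<chi> j. complex_of_real (2 * snd (snd y) $ j) / den y) = wcoord y" if "y \<in> W" for y
  proof -
    have "y \<in> sphereS" using that W(1) openin_imp_subset by blast
    then show "complex_of_real (2 * norm y) / den y = ucoord y" by (simp add: sphereS_eq ucoord_def)
    show "(\<chi> j. complex_of_real (2 * snd (snd y) $ j) / den y) = wcoord y"
      by (simp add: wcoord_def ucoord_def realvec_def vec_eq_iff)
  qed
  have Wdef': "den y \<noteq> 0 \<and> ucoord y \<in> Dp \<and> wcoord y \<in> D" if "y \<in> W" for y
    using Wdef[OF that] unfolding coords[OF that] .
  have lap: "(\<Sum>j\<in>UNIV. cpd j (cpd j H) z) = 0" if "z \<in> D" for z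
    by (rule harmonic_extension_laplacian[OF harm D(2,1) x0 Hext that])
  \<comment> \<open>The induction hypothesis has to hold at all points of \<open>W\<close> at once,
    since \<open>LB_tau\<close> at one point differentiates the previous iterate nearby.\<close>
  have iter: "((LB_tau K sphereS) ^^ s) ?f y = (?T ^^ s) P (ucoord y) * H (wcoord y)" if "y \<in> W" for s y
    using that
  proof (induction s arbitrary: y)
    case 0
    then show ?case by (simp only: funpow_0 coords)
  next
    case (Suc s)
    show ?case
      unfolding funpow.simps o_apply
      by (rule LB_tau_product[OF dimK Dp(1) radial_op_holomorphic[OF Dp(1,3)] D(2) lap W(1) Suc.prems Wdef' Suc.IH])
  qed
  obtain c d where cd: "(c, d) \<noteq> (0, 0)"
    and T: "\<forall>z\<in>Dp. (?T ^^ (r - 1)) P z = c + d * z ^ CARD('m)" "\<forall>z\<in>Dp. (?T ^^ r) P z = 0"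
    using radial_op_iterates[OF Dp(1-3) t0 Pext _ r ab] by auto
  have "((LB_tau K sphereS) ^^ r) ?f y = 0" if "y \<in> W" for y
    using T(2) Wdef'[OF that] unfolding iter[OF that] by simp
  moreover obtain y where y: "y \<in> W" "(c + d * ucoord y ^ CARD('m)) * H (wcoord y) \<noteq> 0"
  proof -
    have "\<exists>y\<in>W. (c + d * ucoord y ^ CARD('m)) * H (wcoord y) \<noteq> 0"
    proof (rule product_nonvanishing[OF W _ _ cd])
      show "\<exists>x. norm x < \<epsilon> \<and> H (z + k *s realvec x) \<noteq> 0" if "z \<in> D" "k \<noteq> 0" "0 < \<epsilon>" for z k \<epsilon>
        by (rule harmonic_extension_nonzero_on_slice[OF harm noncst D(2,1) x0 Hext that])
    qed (use Wdef' in auto)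
    then show ?thesis using that by blast
  qed
  moreover have "((LB_tau K sphereS) ^^ (r - 1)) ?f y \<noteq> 0"
    using y(2) T(1) Wdef'[OF y(1)] unfolding iter[OF y(1)] by simp
  ultimately show ?thesis unfolding proper_r_harmonic_on_def by blast
qed

end
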